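(* Let $x\ge -1$, $y\ge 0$, $z\ge 0$ be integers of the same parity, let $k\ge1$ and let $a_1,\dotsc,a_k$ be non-negative integers; put $a:=a_1+\cdots+a_k$, $a_{k+1}:=a_k+1$, and $a_{k+i}:=a_{k-i+1}$ for $i=2,\dotsc,k$. Then \[ \frac{\mathrm{M}_{\odot}(FC'_{x,y,z}(a_1,\dotsc,a_k,a_k,\dotsc,a_1))}{\mathrm{M}_{\odot}(FC'_{x,y,z}(a,a))} = s(a_1,\dotsc,a_{k-1},a_k+1,a_k,\dotsc,a_1)\, \frac{\mathrm{h}(\frac{x+z}{2}+a)}{\mathrm{h}(\frac{x+y}{2}+a)} \] \[ \times\prod_{i\ge 0,\ 1\le 2i+1\le 2k}\frac{\mathrm{h}(\frac{x+y}{2}+a_1+\cdots+a_{2i+1})}{\mathrm{h}(\frac{x+z}{2}+a_1+\cdots+a_{2i+1})} \prod_{i\ge 1,\ 1<2i<2k}\frac{\mathrm{h}(\frac{x+z}{2}+a_1+\cdots+a_{2i})}{\mathrm{h}(\frac{x+y}{2}+a_1+\cdots+a_{2i})}, \] where the argument list of $s$ is $(a_1,\dotsc,a_{k-1},a_k+1,a_k,a_{k-1},\dotsc,a_2,a_1)$ (of length $2k$).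
   Context: We work on the triangular lattice with one family of lattice lines horizontal; its faces are unit up-pointing and down-pointing triangles. A lozenge is the union of two unit triangles sharing an edge; a lozenge tiling of a lattice region $R$ is a covering of $R$ by lozenges without gaps or overlaps. If $R$ is centrally symmetric, $\mathrm{M}_\odot(R)$ denotes the number of lozenge tilings of $R$ invariant under the rotation by $180^\circ$ about the center of $R$. Fern: for non-negative integers $b_1,\dotsc,b_m$, the fern $F(b_1,\dotsc,b_m)$ is a string of $m$ lattice triangles lined up along a horizontal lattice line, consecutive ones touching at a vertex, of side lengths $b_1,\dotsc,b_m$ from left to right, alternately pointing up and down with the leftmost pointing up (a triangle of size $0$ is a single point). Its base point is its leftmost point; it has total width $b_1+\cdots+b_m$. The region $FC'_{x,y,z}(a_1,\dotsc,a_k,a_k,\dotsc,a_1)$: with $a=a_1+\cdots+a_k$, let $H$ be the lattice hexagon with side lengths $x+a+1$, $y+a$, $z+a$, $x+a+1$, $y+a$, $z+a$ listed clockwise starting from the (horizontal) top side. Its center $c$ is the midpoint of a horizontal unit lattice segment $[p,q]$ ($p$ the left endpoint). Remove from $H$ the fern $F(a_1,\dotsc,a_k)$ placed on that horizontal lattice line so that its rightmost point is $p$ (equivalently, its base point is the center of the auxiliary hexagon of side lengths $x,y,z,x,y,z$ clockwise from top sitting in the western corner of $H$), together with the image of this fern under the $180^\circ$ rotation about $c$ (which is the fern with lobes of sizes $a_k,\dotsc,a_1$ from left to right, the leftmost pointing down, starting at $q$). Thus the two removed ferns are separated by the unit segment $[p,q]$. In particular $FC'_{x,y,z}(a,a)$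 is the case where the first removed fern is a single up-pointing triangle of side $a$ and its image a down-pointing triangle of side $a$. Hyperfactorial: $\mathrm{h}(n):=0!\,1!\cdots(n-1)!$ (with $\mathrm{h}(0)=1$). The function $s$: for non-negative integers $b_1,\dotsc,b_{2l}$ set $s(b_1,\dotsc,b_{2l}):=s(b_1,\dotsc,b_{2l-1})$, and \[ s(b_1,\dotsc,b_{2l-1}):=\frac{\prod_{1\le i\le j\le 2l-1,\ j-i+1\text{ odd}}\mathrm{h}(b_i+\cdots+b_j)}{\prod_{1\le i\le j\le 2l-1,\ j-i+1\text{ even}}\mathrm{h}(b_i+\cdots+b_j)}\cdot\frac{1}{\mathrm{h}(b_1+b_3+\cdots+b_{2l-1})}. \]
   Formalization: For even k the products use a_k+1 at position k and a_k at position k+1 (for odd k: a_{k+1}=a_k+1 as stated), since the printed formula fails for even k, e.g. x=y=0, z=2, k=2, a=(1,0): the ratio is 1, the printed right side 1/2. The second fern is the 180° image of the first. *)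

theory Defs
  imports Complex_Main "HOL-Library.Disjoint_Sets"
begin

text \<open>
  A lattice point \<open>(u, v)\<close> stands for \<open>u e + v f\<close>, where \<open>e\<close> is the unit vector pointing east
  and \<open>f\<close> the unit vector at 60 degrees above it (north-east).
\<close>

type_synonym point = "int \<times> int"

datatype tri = Up int int | Down int int

fun verts :: "tri \<Rightarrow> point set" where
  "verts (Up u v) = {(u, v), (u + 1, v), (u, v + 1)}"
| "verts (Down u v) = {(u + 1, v), (u, v + 1), (u + 1, v + 1)}"

text \<open>The faces inside a convex lattice polygon, given by its set of lattice points.\<close>

definition faces :: "point set \<Rightarrow> tri set" where
  "faces P = {t. verts t \<subseteq> P}"

text \<open>Two distinct faces share an edge iff they have exactly two vertices in common.\<close>

definition lozenge :: "tri set \<Rightarrow> bool" where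
  "lozenge L \<longleftrightarrow> (\<exists>s t. L = {s, t} \<and> card (verts s \<inter> verts t) = 2)"

definition lozenge_tiling :: "tri set \<Rightarrow> tri set set \<Rightarrow> bool" where
  "lozenge_tiling R T \<longleftrightarrow> partition_on R T \<and> (\<forall>L\<in>T. lozenge L)"

text \<open>
  \<open>rot C\<close> is the rotation by 180 degrees about the point \<open>C / 2\<close>, that is,
  \<open>verts (rot C t) = (\<lambda>P. C - P) ` verts t\<close>; the doubled centre keeps all coordinates integral.
\<close>

fun rot :: "point \<Rightarrow> tri \<Rightarrow> tri" where
  "rot C (Up u v) = Down (fst C - u - 1) (snd C - v - 1)"
| "rot C (Down u v) = Up (fst C - u - 1) (snd C - v - 1)"

text \<open>
  \<open>M_odot C R\<close> is used for regions \<open>R\<close> that are centrally symmetric about \<open>C / 2\<close>.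
\<close>

definition M_odot :: "point \<Rightarrow> tri set \<Rightarrow> nat" where
  "M_odot C R = card {T. lozenge_tiling R T \<and> (\<lambda>L. rot C ` L) ` T = T}"

text \<open>
  The hexagon with side lengths \<open>p, q, r, p, q, r\<close> clockwise from the top, its western corner
  at the origin. Clockwise from there its corners are
  \<open>(0, 0), (0, r), (p, r), (p + q, r - q), (p + q, - q), (q, - q)\<close>.
\<close>

definition hexagon :: "int \<Rightarrow> int \<Rightarrow> int \<Rightarrow> tri set" where
  "hexagon p q r = faces {(u, v). 0 \<le> u \<and> u \<le> p + q \<and> 0 \<le> u + v \<and> u + v \<le> p + r \<and> - q \<le> v \<and> v \<le> r}"

definition hexagon_centre2 :: "int \<Rightarrow> int \<Rightarrow> int \<Rightarrow> point" where
  "hexagon_centre2 p q r = (p + q, r - q)"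

text \<open>
  Triangles of side \<open>b\<close> whose horizontal side has left endpoint \<open>(u, v)\<close>; the third
  vertex is \<open>(u, v + b)\<close> resp. \<open>(u + b, v - b)\<close>.
\<close>

definition up_triangle :: "point \<Rightarrow> nat \<Rightarrow> tri set" where
  "up_triangle P b = (case P of (u, v) \<Rightarrow> faces {(i, j). u \<le> i \<and> v \<le> j \<and> i + j \<le> u + v + int b})"

definition down_triangle :: "point \<Rightarrow> nat \<Rightarrow> tri set" where
  "down_triangle P b = (case P of (u, v) \<Rightarrow> faces {(i, j). i \<le> u + int b \<and> j \<le> v \<and> u + v \<le> i + j})"

text \<open>The flag tells whether the leftmost lobe points up.\<close>

fun fern_from :: "bool \<Rightarrow> point \<Rightarrow> nat list \<Rightarrow> tri set" where
  "fern_from up P [] = {}"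
| "fern_from up P (b # bs) =
     (if up then up_triangle P b else down_triangle P b)
       \<union> fern_from (\<not> up) (fst P + int b, snd P) bs"

definition fern :: "point \<Rightarrow> nat list \<Rightarrow> tri set" where
  "fern P bs = fern_from True P bs"

text \<open>
  The region \<open>FC'\<^bsub>x,y,z\<^esub>(a\<^sub>1,\<dots>,a\<^sub>k,a\<^sub>k,\<dots>,a\<^sub>1)\<close> is \<open>FC' x y z [a\<^sub>1,\<dots>,a\<^sub>k]\<close>, and \<open>FC'\<^bsub>x,y,z\<^esub>(a,a)\<close>
  is \<open>FC' x y z [a]\<close>. For \<open>x, y, z\<close> of the same parity, \<open>fst C\<close> is odd and \<open>snd C\<close> even, so
  \<open>C / 2\<close> is the midpoint of the unit segment from \<open>p\<close> to \<open>p + (1, 0)\<close>.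
\<close>

definition FC'_centre2 :: "int \<Rightarrow> int \<Rightarrow> int \<Rightarrow> nat list \<Rightarrow> point" where
  "FC'_centre2 x y z bs =
     (let a = int (sum_list bs) in hexagon_centre2 (x + a + 1) (y + a) (z + a))"

definition FC' :: "int \<Rightarrow> int \<Rightarrow> int \<Rightarrow> nat list \<Rightarrow> tri set" where
  "FC' x y z bs =
     (let a = int (sum_list bs);
          C = FC'_centre2 x y z bs;
          p = ((fst C - 1) div 2, snd C div 2);
          F = fern (fst p - a, snd p) bs
      in hexagon (x + a + 1) (y + a) (z + a) - (F \<union> rot C ` F))"

abbreviation M_odot_FC' :: "int \<Rightarrow> int \<Rightarrow> int \<Rightarrow> nat list \<Rightarrow> nat" where
  "M_odot_FC' x y z bs \<equiv> M_odot (FC'_centre2 x y z bs) (FC' x y z bs)"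

definition hyperfact :: "nat \<Rightarrow> real" where
  "hyperfact n = (\<Prod>i<n. fact i)"

text \<open>
  List positions start at 0, so \<open>b\<^sub>1, b\<^sub>3, \<dots>\<close> are the entries at even positions.
\<close>

definition s_odd :: "nat list \<Rightarrow> real" where
  "s_odd b =
     (\<Prod>(i, j) | i \<le> j \<and> j < length b \<and> odd (j - i + 1). hyperfact (\<Sum>t = i..j. b ! t))
     / (\<Prod>(i, j) | i \<le> j \<and> j < length b \<and> even (j - i + 1). hyperfact (\<Sum>t = i..j. b ! t))
     * (1 / hyperfact (\<Sum>i | i < length b \<and> even i. b ! i))"

definition s_fun :: "nat list \<Rightarrow> real" where
  "s_fun b = (if even (length b) then s_odd (butlast b) else s_odd b)"

text \<open>
  The sequence \<open>a\<^sub>1, \<dots>, a\<^sub>2\<^sub>k\<close> obtained from \<open>a\<^sub>1, \<dots>, a\<^sub>k, a\<^sub>k, \<dots>, a\<^sub>1\<close> by adding 1 to one of the two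
  middle entries: to the one with index \<open>k + 1\<close> if \<open>k\<close> is odd (so \<open>a\<^sub>k\<^sub>+\<^sub>1 = a\<^sub>k + 1\<close>), and to the one
  with index \<open>k\<close> if \<open>k\<close> is even (as in the argument list of \<open>s\<close>).

  The source sets \<open>a\<^sub>k\<^sub>+\<^sub>1 = a\<^sub>k + 1\<close> for all \<open>k\<close>, but with that choice the product formula
  fails for even \<open>k\<close>. For instance, for \<open>x = y = 0, z = 2, k = 2, a\<^sub>1 = 1, a\<^sub>2 = 0\<close> the regions in
  the numerator and in the denominator coincide, while the right-hand side would be \<open>1 / 2\<close>.
\<close>

definition lobe_ext :: "nat \<Rightarrow> (nat \<Rightarrow> nat) \<Rightarrow> nat \<Rightarrow> nat" where
  "lobe_ext k a i =
     (if i \<le> k then a i else a (2 * k + 1 - i))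
       + (if i = (if odd k then k + 1 else k) then 1 else 0)"

end

theory Submission
  imports Defs "HOL-Library.FuncSet" "Jordan_Normal_Form.Determinant"
begin

text \<open>
  Cut the region along the horizontal lattice line through its centre. A centrally symmetric tiling is
  determined by its restriction to the upper half together with the set \<open>S\<close> of unit segments of the line
  that are crossed by a lozenge, and \<open>S\<close> has to be symmetric about the centre. After completing the upper half
  to a trapezoid by forced lozenges, its tilings are the Gelfand--Tsetlin patterns whose bottom row is the set
  \<open>D\<close> of dents, so their number is the Vandermonde product of \<open>D\<close> divided by a hyperfactorial.

  Here \<open>D\<close> consists of \<open>S\<close>, of the segments \<open>E\<close> below the up-pointing lobes, and of a run of segments at one
  end which depends on \<open>z - y\<close> only. Measured from the centre, \<open>E\<close> contains exactly one of \<open>j\<close> and \<open>- j\<close> for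
  \<open>1 \<le> j \<le> a\<close>; as \<open>S\<close> is symmetric, the product of all distances between \<open>E\<close> and \<open>S\<close> does not depend on
  the ferns. So the sum over \<open>S\<close> cancels in the quotient, and what remains is the Vandermonde product of \<open>E\<close>,
  which gives \<open>s\<close>, and the distances between \<open>E\<close> and the run, which give the other hyperfactorials.
\<close>

section \<open>Summing Vandermonde products over interlacing sequences\<close>

text \<open>Vandermonde product over hyperfactorial is the determinant of the binomials
  \<open>d i choose j\<close>. Summing row \<open>i\<close> over an interval telescopes and raises
  \<open>j\<close> by one, which yields the determinant of the next size. The sum over S is never
  evaluated: it only has to be common to all ferns and positive. The obstacle is the run, which is
  not symmetric. The distances from a cell to it multiply to a quotient of two factorials. If z < y,
  the run is at the left end and this quotient is already the wanted one. If z > y, it is at the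
  right end and the factorials belong to the reflected cell; multiplied by the factorials of the
  cell itself they become symmetric, so the same quotient results up to a factor common to all
  ferns. The formula reads E in two ways, and the central segment is not in E.
  \<open>lobe_ext\<close> gives it to a lobe of even index, which points down, so the up lobes cover
  exactly E. The argument of s gives it to lobe k, which points up for odd k; its distances to E
  then multiply to a!, and the larger normalising hyperfactorial cancels this.\<close>

definition vandermonde_prod :: "(nat \<Rightarrow> int) \<Rightarrow> nat \<Rightarrow> real" where
  "vandermonde_prod d h = (\<Prod>j<h. \<Prod>i<j. real_of_int (d j - d i))"

text \<open>
  The coefficients of the Newton polynomials \<open>\<Prod>i<j. X - d i\<close> in the basis of binomial coefficients. Passing to
  the Newton polynomials makes the binomial matrix triangular.
\<close>

fun newton_coeff :: "(nat \<Rightarrow> int) \<Rightarrow> nat \<Rightarrow> nat \<Rightarrow> real" where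
  "newton_coeff d k 0 = (if k = 0 then 1 else 0)"
| "newton_coeff d k (Suc j) =
     (if k = 0 then 0 else real k * newton_coeff d (k - 1) j) + (real k - real_of_int (d j)) * newton_coeff d k j"

lemma newton_coeff_eq_0: "j < k \<Longrightarrow> newton_coeff d k j = 0"
  by (induction j arbitrary: k) auto

lemma newton_coeff_diag: "newton_coeff d j j = fact j"
  by (induction j) (auto simp: newton_coeff_eq_0)

text \<open>Multiplication by \<open>x\<close> in the binomial basis; the recursion of
  \<open>newton_coeff\<close> comes from here.\<close>

lemma gbinomial_times_self:
  "(x::real) * (x gchoose k) = real (Suc k) * (x gchoose Suc k) + real k * (x gchoose k)"
  using gbinomial_absorb_comp[of x k] gbinomial_mult_1[of x k] by (simp add: algebra_simps)

lemma newton_expansion: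
  "(\<Prod>i<j. x - real_of_int (d i)) = (\<Sum>k\<le>j. (x gchoose k) * newton_coeff d k j)"
proof (induction j)
  case (Suc j)
  let ?c = "\<lambda>k. newton_coeff d k j"
  have "(\<Prod>i<Suc j. x - real_of_int (d i))
      = (\<Sum>k\<le>j. (x * (x gchoose k) - real_of_int (d j) * (x gchoose k)) * ?c k)"
    by (simp add: Suc.IH sum_distrib_left algebra_simps sum.distrib sum_subtractf)
  also have "\<dots> = (\<Sum>k\<le>j. (x gchoose Suc k) * (real (Suc k) * ?c k))
      + (\<Sum>k\<le>j. (x gchoose k) * ((real k - real_of_int (d j)) * ?c k))"
    unfolding gbinomial_times_self by (simp add: algebra_simps sum.distrib sum_subtractf)
  also have "(\<Sum>k\<le>j. (x gchoose Suc k) * (real (Suc k) * ?c k))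
      = (\<Sum>k\<le>Suc j. (x gchoose k) * (if k = 0 then 0 else real k * ?c (k - 1)))"
    by (subst sum.atMost_Suc_shift) simp
  also have "(\<Sum>k\<le>j. (x gchoose k) * ((real k - real_of_int (d j)) * ?c k))
      = (\<Sum>k\<le>Suc j. (x gchoose k) * ((real k - real_of_int (d j)) * ?c k))"
    by (simp add: newton_coeff_eq_0)
  finally show ?case
    by (simp only: sum.distrib [symmetric] newton_coeff.simps distrib_left)
qed simp

text \<open>Right multiplication by the Newton coefficients turns row \<open>i\<close> into the
  values of the Newton polynomials at \<open>d i\<close>. Polynomial \<open>j\<close> vanishes there
  for \<open>j > i\<close>, so the product is lower triangular with the Vandermonde factors on its
  diagonal, while the coefficient matrix is upper triangular with diagonal 0!, 1!, and so
  on.\<close>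

lemma det_gbinomial:
  "det (mat h h (\<lambda>(i, j). real_of_int (d i) gchoose j)) * hyperfact h = vandermonde_prod d h"
proof -
  define B C where "B = mat h h (\<lambda>(i, j). real_of_int (d i) gchoose j)"
    and "C = mat h h (\<lambda>(k, j). newton_coeff d k j)"
  have carr: "B \<in> carrier_mat h h" "C \<in> carrier_mat h h" by (auto simp: B_def C_def)
  have BC: "B * C = mat h h (\<lambda>(i, j). \<Prod>l<j. real_of_int (d i) - real_of_int (d l))" (is "_ = ?Q")
  proof (rule eq_matI)
    fix i j assume "i < dim_row ?Q" "j < dim_col ?Q"
    then have ij: "i < h" "j < h" by auto
    have "(B * C) $$ (i, j) = (\<Sum>k\<in>{0..<h}. (real_of_int (d i) gchoose k) * newton_coeff d k j)"
      using ij by (simp add: B_def C_def scalar_prod_def)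
    also have "\<dots> = (\<Sum>k\<le>j. (real_of_int (d i) gchoose k) * newton_coeff d k j)"
      using ij by (intro sum.mono_neutral_right) (auto simp: newton_coeff_eq_0)
    finally show "(B * C) $$ (i, j) = ?Q $$ (i, j)"
      using ij by (simp add: newton_expansion)
  qed (auto simp: B_def C_def)
  have "det C = prod_list (diag_mat C)"
    by (rule det_upper_triangular[OF _ carr(2)]) (auto simp: upper_triangular_def C_def newton_coeff_eq_0)
  also have "\<dots> = hyperfact h"
    by (simp add: prod_list_diag_prod C_def newton_coeff_diag hyperfact_def atLeast0LessThan)
  finally have detC: "det C = hyperfact h" .
  have "det ?Q = prod_list (diag_mat ?Q)"
    by (rule det_lower_triangular[of h]) (auto intro!: prod_zero)
  also have "\<dots> = vandermonde_prod d h"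
    by (simp add: prod_list_diag_prod vandermonde_prod_def atLeast0LessThan)
  finally show ?thesis
    using det_mult[OF carr] BC detC by (simp add: B_def)
qed

lemma sum_gbinomial_int:
  assumes "b \<le> c"
  shows "(\<Sum>t\<in>{b..<c}. real_of_int t gchoose j) = (real_of_int c gchoose Suc j) - (real_of_int b gchoose Suc j)"
  using assms
proof (induction c rule: int_ge_induct)
  case (step i)
  have "{b..<i + 1} = insert i {b..<i}" using step by auto
  then show ?case using step gbinomial_Suc_Suc[of "real_of_int i" j] by simp
qed simp

text \<open>Subtracting from every row its predecessor, by a bidiagonal matrix of determinant 1,
  turns column 0 into a unit vector; the first row and column then split off.\<close>

lemma det_row_differences:
  fixes f :: "nat \<Rightarrow> nat \<Rightarrow> real"
  assumes "\<And>i. f i 0 = 1"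
  shows "det (mat h h (\<lambda>(i, j). f (Suc i) (Suc j) - f i (Suc j))) = det (mat (Suc h) (Suc h) (\<lambda>(i, j). f i j))"
proof -
  define B where "B = mat (Suc h) (Suc h) (\<lambda>(i, j). f i j)"
  define L where "L = mat (Suc h) (Suc h) (\<lambda>(i, j). if i = j then 1 else if i = Suc j then -1 else (0::real))"
  define M where "M = mat h h (\<lambda>(i, j). f (Suc i) (Suc j) - f i (Suc j))"
  have carr: "L \<in> carrier_mat (Suc h) (Suc h)" "B \<in> carrier_mat (Suc h) (Suc h)"
    by (auto simp: B_def L_def)
  have "det L = prod_list (diag_mat L)"
    by (rule det_lower_triangular[OF _ carr(1)]) (auto simp: L_def)
  then have detL: "det L = 1"
    by (simp add: prod_list_diag_prod L_def)
  have entry: "(L * B) $$ (i, j) = f i j - (if i = 0 then 0 else f (i - 1) j)" if ij: "i < Suc h" "j < Suc h" for i j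
  proof -
    have "(L * B) $$ (i, j) = (\<Sum>k\<in>{0..<Suc h}. (if i = k then f k j else 0) + (if i = Suc k then - f k j else 0))"
      using ij unfolding L_def B_def by (auto simp: scalar_prod_def simp del: sum.op_ivl_Suc intro!: sum.cong)
    also have "\<dots> = f i j - (if i = 0 then 0 else f (i - 1) j)"
      using ij by (cases i) (auto simp: sum.distrib simp del: sum.op_ivl_Suc)
    finally show ?thesis .
  qed
  have "L * B = four_block_mat (1\<^sub>m 1) (mat 1 h (\<lambda>(i, j). f 0 (Suc j))) (0\<^sub>m h 1) M" (is "_ = ?F")
  proof (rule eq_matI)
    fix i j assume "i < dim_row ?F" "j < dim_col ?F"
    then have ij: "i < Suc h" "j < Suc h" by (auto simp: M_def)
    show "(L * B) $$ (i, j) = ?F $$ (i, j)"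
      using ij by (subst entry) (auto simp: M_def assms split: nat.splits dest: less_Suc_eq_0_disj[THEN iffD1])
  qed (auto simp: L_def B_def M_def)
  then have "det (L * B) = det M"
    using det_four_block_mat_lower_left_zero_col[of "1\<^sub>m 1" "mat 1 h (\<lambda>(i, j). f 0 (Suc j))" h "0\<^sub>m h 1" M]
    by (simp add: M_def)
  then show ?thesis
    using det_mult[OF carr] detL by (simp add: B_def M_def)
qed

text \<open>In the Leibniz expansion of the binomial determinant row \<open>i\<close> depends on
  \<open>e i\<close> alone, so the sum over the product of intervals can be taken entrywise. Each
  entry telescopes to a difference of neighbouring rows of the larger matrix.\<close>

lemma sum_vandermonde_prod_interlacing:
  assumes "\<And>i. i < h \<Longrightarrow> d i \<le> d (Suc i)"
  shows "(\<Sum>e\<in>PiE {..<h} (\<lambda>i. {d i..<d (Suc i)}). vandermonde_prod e h / hyperfact h) = vandermonde_prod d (Suc h) / hyperfact (Suc h)"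
proof -
  let ?b = "\<lambda>t j. real_of_int t gchoose j"
  have hp: "hyperfact n \<noteq> 0" for n by (simp add: hyperfact_def)
  have det_eq: "vandermonde_prod e n / hyperfact n = det (mat n n (\<lambda>(i, j). ?b (e i) j))" for e n
    using det_gbinomial[of n e] hp by (simp add: field_simps)
  have leib: "det (mat h h g) = (\<Sum>p\<in>{p. p permutes {0..<h}}. signof p * (\<Prod>i<h. g (i, p i)))"
    for g :: "nat \<times> nat \<Rightarrow> real"
  proof -
    have "(\<Prod>i = 0..<h. mat h h g $$ (i, p i)) = (\<Prod>i<h. g (i, p i))" if "p permutes {0..<h}" for p
      using that permutes_in_image[OF that] by (auto simp: atLeast0LessThan intro!: prod.cong)
    then show ?thesis by (subst det_def'[of _ h]) (auto intro!: sum.cong)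
  qed
  have "(\<Sum>e\<in>PiE {..<h} (\<lambda>i. {d i..<d (Suc i)}). vandermonde_prod e h / hyperfact h)
      = (\<Sum>p\<in>{p. p permutes {0..<h}}. \<Sum>e\<in>PiE {..<h} (\<lambda>i. {d i..<d (Suc i)}). signof p * (\<Prod>i<h. ?b (e i) (p i)))"
    unfolding det_eq leib by (subst sum.swap) simp
  also have "\<dots> = (\<Sum>p\<in>{p. p permutes {0..<h}}. signof p * (\<Prod>i<h. \<Sum>t\<in>{d i..<d (Suc i)}. ?b t (p i)))"
    by (intro sum.cong refl) (simp add: sum_distrib_left [symmetric] prod_sum_PiE)
  also have "\<dots> = det (mat h h (\<lambda>(i, j). ?b (d (Suc i)) (Suc j) - ?b (d i) (Suc j)))"
    unfolding leib by (intro sum.cong refl arg_cong2[of _ _ _ _ "(*)"] prod.cong) (auto simp: sum_gbinomial_int assms)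
  also have "\<dots> = vandermonde_prod d (Suc h) / hyperfact (Suc h)"
    unfolding det_eq by (rule det_row_differences) simp
  finally show ?thesis .
qed

section \<open>Lozenge tilings and cuts\<close>

definition tilings :: "tri set \<Rightarrow> tri set set set" where
  "tilings R = {T. lozenge_tiling R T}"

lemma two_common_verts:
  assumes PQ: "P \<noteq> Q" "P \<in> verts s" "P \<in> verts t" "Q \<in> verts s" "Q \<in> verts t"
  shows "s = Up u v \<Longrightarrow> t = Down u' v' \<Longrightarrow> u' = u \<and> v' = v \<or> u' = u - 1 \<and> v' = v \<or> u' = u \<and> v' = v - 1"
    and "s = Up u v \<Longrightarrow> t = Up u' v' \<Longrightarrow> s = t"
    and "s = Down u v \<Longrightarrow> t = Down u' v' \<Longrightarrow> s = t"
proof -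
  obtain p1 p2 q1 q2 where e: "P = (p1, p2)" "Q = (q1, q2)" by (cases P; cases Q) auto
  show "u' = u \<and> v' = v \<or> u' = u - 1 \<and> v' = v \<or> u' = u \<and> v' = v - 1"
    if "s = Up u v" "t = Down u' v'"
    using PQ that unfolding e by simp (elim disjE conjE; simp)
  show "s = t" if "s = Up u v" "t = Up u' v'"
    using PQ that unfolding e by simp (elim disjE conjE; simp)
  show "s = t" if "s = Down u v" "t = Down u' v'"
    using PQ that unfolding e by simp (elim disjE conjE; simp)
qed

text \<open>The cases are listed by the edge of the up-pointing face that is shared: right, left,
  bottom. Only the third kind straddles a horizontal line.\<close>

lemma lozenge_iff:
  "lozenge L \<longleftrightarrow>
    (\<exists>u v. L = {Up u v, Down u v} \<or> L = {Up u v, Down (u - 1) v} \<or> L = {Up u v, Down u (v - 1)})"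
  (is "_ \<longleftrightarrow> ?rhs L")
proof
  assume "lozenge L"
  then obtain s t where L: "L = {s, t}" and c: "card (verts s \<inter> verts t) = 2"
    by (auto simp: lozenge_def)
  obtain P Q where "P \<noteq> Q" "verts s \<inter> verts t = {P, Q}"
    using c unfolding card_2_iff by blast
  then have PQ: "P \<noteq> Q" "P \<in> verts s" "P \<in> verts t" "Q \<in> verts s" "Q \<in> verts t"
    by auto
  have "card (verts t) = 3" by (cases t) auto
  then have st: "s \<noteq> t" using c by auto
  show "?rhs L"
  proof (cases s; cases t)
    fix u v u' v' assume "s = Up u v" "t = Up u' v'"
    then show ?thesis using two_common_verts(2)[OF PQ] st by metis
  next
    fix u v u' v' assume "s = Down u v" "t = Down u' v'"
    then show ?thesis using two_common_verts(3)[OF PQ] st by metis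
  next
    fix u v u' v' assume "s = Up u v" "t = Down u' v'"
    then show ?thesis using two_common_verts(1)[OF PQ] L by metis
  next
    fix u v u' v' assume "s = Down u v" "t = Up u' v'"
    then show ?thesis using two_common_verts(1)[OF PQ(1,3,2,5,4)] L by (metis insert_commute)
  qed
next
  have [simp]: "card (verts (Up u v) \<inter> verts (Down u v)) = 2"
    "card (verts (Up u v) \<inter> verts (Down (u - 1) v)) = 2"
    "card (verts (Up u v) \<inter> verts (Down u (v - 1))) = 2" for u v
  proof -
    have "verts (Up u v) \<inter> verts (Down u v) = {(u + 1, v), (u, v + 1)}"
      "verts (Up u v) \<inter> verts (Down (u - 1) v) = {(u, v), (u, v + 1)}"
      "verts (Up u v) \<inter> verts (Down u (v - 1)) = {(u, v), (u + 1, v)}" by auto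
    then show "card (verts (Up u v) \<inter> verts (Down u v)) = 2"
      "card (verts (Up u v) \<inter> verts (Down (u - 1) v)) = 2"
      "card (verts (Up u v) \<inter> verts (Down u (v - 1))) = 2" by simp_all
  qed
  assume "?rhs L"
  then show "lozenge L"
    unfolding lozenge_def by (elim exE disjE) (rule exI, rule exI, erule conjI, simp del: verts.simps)+
qed

lemma tilings_iff:
  "T \<in> tilings R \<longleftrightarrow> (\<forall>L\<in>T. lozenge L \<and> L \<subseteq> R) \<and> (\<forall>t\<in>R. \<exists>!L. L \<in> T \<and> t \<in> L)"
proof
  assume "T \<in> tilings R"
  then have "partition_on R T" "\<forall>L\<in>T. lozenge L" by (auto simp: tilings_def lozenge_tiling_def)
  then show "(\<forall>L\<in>T. lozenge L \<and> L \<subseteq> R) \<and> (\<forall>t\<in>R. \<exists>!L. L \<in> T \<and> t \<in> L)"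
    unfolding partition_on_def disjoint_def by blast
next
  assume *: "(\<forall>L\<in>T. lozenge L \<and> L \<subseteq> R) \<and> (\<forall>t\<in>R. \<exists>!L. L \<in> T \<and> t \<in> L)"
  have "{} \<notin> T" using * by (auto simp: lozenge_def)
  moreover have "disjoint T" unfolding disjoint_def using * by blast
  ultimately show "T \<in> tilings R"
    using * unfolding tilings_def lozenge_tiling_def partition_on_def by blast
qed

lemma tilingsD:
  assumes "T \<in> tilings R"
  shows "\<And>L. L \<in> T \<Longrightarrow> lozenge L" "\<And>L. L \<in> T \<Longrightarrow> L \<subseteq> R"
    "\<And>t. t \<in> R \<Longrightarrow> \<exists>L\<in>T. t \<in> L"
    "\<And>L L' t. L \<in> T \<Longrightarrow> L' \<in> T \<Longrightarrow> t \<in> L \<Longrightarrow> t \<in> L' \<Longrightarrow> L = L'"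
  using assms unfolding tilings_iff by blast+

lemma tilingsI:
  assumes "\<And>L. L \<in> T \<Longrightarrow> lozenge L" "\<And>L. L \<in> T \<Longrightarrow> L \<subseteq> R"
    "\<And>t. t \<in> R \<Longrightarrow> \<exists>L\<in>T. t \<in> L"
    "\<And>L L' t. L \<in> T \<Longrightarrow> L' \<in> T \<Longrightarrow> t \<in> L \<Longrightarrow> t \<in> L' \<Longrightarrow> L = L'"
  shows "T \<in> tilings R"
  using assms unfolding tilings_iff by blast

lemma finite_tilings: "finite R \<Longrightarrow> finite (tilings R)"
  by (rule finite_subset[of _ "Pow (Pow R)"]) (auto dest: tilingsD(2))

lemma tilings_empty: "tilings {} = {{}}"
proof -
  have "T = {}" if "T \<in> tilings {}" for T
    using tilingsD(1,2)[OF that] by (auto simp: lozenge_def)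
  moreover have "{} \<in> tilings {}" by (simp add: tilings_iff)
  ultimately show ?thesis by blast
qed

fun is_up :: "tri \<Rightarrow> bool" where
  "is_up (Up u v) = True"
| "is_up (Down u v) = False"

text \<open>Every lozenge has one face of each orientation. This excludes all dent sets of the wrong
  size.\<close>

lemma tiling_balanced:
  assumes T: "T \<in> tilings R" and fin: "finite R"
  shows "card {t \<in> R. is_up t} = card {t \<in> R. \<not> is_up t}"
proof -
  have finT: "finite T" "\<And>L. L \<in> T \<Longrightarrow> finite L"
    using tilingsD(2)[OF T] fin by (auto intro: finite_subset[of _ "Pow R"] finite_subset)
  have one: "card {t \<in> L. is_up t} = card {t \<in> L. \<not> is_up t}" if L: "L \<in> T" for L
  proof -
    obtain u v u' v' where "L = {Up u v, Down u' v'}"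
      using tilingsD(1)[OF T L] unfolding lozenge_iff by blast
    then have "{t \<in> L. is_up t} = {Up u v}" "{t \<in> L. \<not> is_up t} = {Down u' v'}" by auto
    then show ?thesis by simp
  qed
  have split: "card {t \<in> R. P t} = (\<Sum>L\<in>T. card {t \<in> L. P t})" for P
  proof -
    have "{t \<in> R. P t} = (\<Union>L\<in>T. {t \<in> L. P t})"
      using tilingsD(2,3)[OF T] by blast
    moreover have "card (\<Union>L\<in>T. {t \<in> L. P t}) = (\<Sum>L\<in>T. card {t \<in> L. P t})"
      using finT tilingsD(4)[OF T] by (intro card_UN_disjoint) auto
    ultimately show ?thesis by simp
  qed
  show ?thesis using one by (simp add: split)
qed

lemma tilings_forced:
  assumes forced: "\<And>T. T \<in> tilings R \<Longrightarrow> F \<subseteq> T" and F: "F \<in> tilings (\<Union>F)" "\<Union>F \<subseteq> R"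
  shows "card (tilings R) = card (tilings (R - \<Union>F))"
proof -
  have "bij_betw (\<lambda>T. F \<union> T) (tilings (R - \<Union>F)) (tilings R)"
  proof (rule bij_betw_byWitness[where f' = "\<lambda>T. T - F"])
    have nemp: "T \<inter> F = {}" if "T \<in> tilings (R - \<Union>F)" for T
      using tilingsD(1,2)[OF that] by (fastforce simp: lozenge_def)
    then show "\<forall>T\<in>tilings (R - \<Union>F). F \<union> T - F = T" by blast
    show "\<forall>T\<in>tilings R. F \<union> (T - F) = T" using forced by blast
    show "(\<union>) F ` tilings (R - \<Union>F) \<subseteq> tilings R"
    proof safe
      fix T assume T: "T \<in> tilings (R - \<Union>F)"
      show "F \<union> T \<in> tilings R"
      proof (rule tilingsI)
        fix L assume L: "L \<in> F \<union> T"
        then show "lozenge L" using tilingsD(1)[OF T] tilingsD(1)[OF F(1)] by auto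
        show "L \<subseteq> R" using L tilingsD(2)[OF T] F(2) by auto
      next
        fix t assume "t \<in> R" then show "\<exists>L\<in>F \<union> T. t \<in> L"
          using tilingsD(3)[OF T, of t] by auto
      next
        fix L L' t assume "L \<in> F \<union> T" "L' \<in> F \<union> T" and t: "t \<in> L" "t \<in> L'"
        then consider "L \<in> F" "L' \<in> F" | "L \<in> T" "L' \<in> T"
          using tilingsD(2)[OF T, of L] tilingsD(2)[OF T, of L'] by auto
        then show "L = L'"
          by cases (use t tilingsD(4)[OF T] tilingsD(4)[OF F(1)] in auto)
      qed
    qed
    show "(\<lambda>T. T - F) ` tilings R \<subseteq> tilings (R - \<Union>F)"
    proof safe
      fix T assume T: "T \<in> tilings R"
      show "T - F \<in> tilings (R - \<Union>F)"
      proof (rule tilingsI)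
        fix L assume L: "L \<in> T - F"
        then show "lozenge L" using tilingsD(1)[OF T] by auto
        have "t \<notin> M" if "t \<in> L" "M \<in> F" for t M
          using tilingsD(4)[OF T, of L M t] forced[OF T] that L by auto
        then show "L \<subseteq> R - \<Union>F" using L tilingsD(2)[OF T] by auto
      next
        fix t assume "t \<in> R - \<Union>F" then show "\<exists>L\<in>T - F. t \<in> L"
          using tilingsD(3)[OF T, of t] by auto
      next
        fix L L' t assume "L \<in> T - F" "L' \<in> T - F" "t \<in> L" "t \<in> L'"
        then show "L = L'" using tilingsD(4)[OF T, of L L' t] by auto
      qed
    qed
  qed
  then show ?thesis using bij_betw_same_card by fastforce
qed

text \<open>A region split into \<open>A\<close> and \<open>B\<close> where all lozenges that can
  straddle the cut are known and pairwise disjoint, so that a crossing pattern is just a subset of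
  \<open>I\<close>. It serves twice: to split the bottom row off a trapezoid, and to cut the region
  along its centre line.\<close>

locale cut =
  fixes A B :: "tri set" and cr :: "int \<Rightarrow> tri set" and I :: "int set"
  assumes disj: "A \<inter> B = {}" and finA: "finite A" and finB: "finite B" and finI: "finite I"
    and cr_lozenge: "i \<in> I \<Longrightarrow> lozenge (cr i)"
    and cr_cross: "i \<in> I \<Longrightarrow> cr i \<subseteq> A \<union> B \<and> \<not> cr i \<subseteq> A \<and> \<not> cr i \<subseteq> B"
    and cross_cr: "lozenge L \<Longrightarrow> L \<subseteq> A \<union> B \<Longrightarrow> \<not> L \<subseteq> A \<Longrightarrow> \<not> L \<subseteq> B \<Longrightarrow> L \<in> cr ` I"
    and cr_disj: "i \<noteq> j \<Longrightarrow> cr i \<inter> cr j = {}"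
begin

definition crossing :: "tri set set \<Rightarrow> tri set set" where
  "crossing T = {L \<in> T. \<not> L \<subseteq> A \<and> \<not> L \<subseteq> B}"

lemma cr_inj: "inj_on cr I"
proof (rule inj_onI, rule ccontr)
  fix i j assume "i \<in> I" "cr i = cr j" "i \<noteq> j"
  then show False using cr_disj[of i j] cr_cross[of i] by simp
qed

lemma crossing_obtain:
  assumes "T \<in> tilings (A \<union> B)"
  obtains S where "S \<subseteq> I" "crossing T = cr ` S"
proof -
  have "crossing T \<subseteq> cr ` I"
    using cross_cr tilingsD(1,2)[OF assms] unfolding crossing_def by blast
  then show ?thesis using that by (meson subset_image_iff)
qed

lemma glue_tiling:
  assumes S: "S \<subseteq> I" and T1: "T1 \<in> tilings (A - \<Union>(cr ` S))" and T2: "T2 \<in> tilings (B - \<Union>(cr ` S))"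
  shows "cr ` S \<union> T1 \<union> T2 \<in> tilings (A \<union> B)" "crossing (cr ` S \<union> T1 \<union> T2) = cr ` S"
    "{L \<in> cr ` S \<union> T1 \<union> T2. L \<subseteq> A} = T1" "{L \<in> cr ` S \<union> T1 \<union> T2. L \<subseteq> B} = T2"
proof -
  have 1: "L \<subseteq> A \<and> \<not> L \<subseteq> B \<and> L \<inter> \<Union>(cr ` S) = {} \<and> lozenge L" if "L \<in> T1" for L
    using tilingsD(1,2)[OF T1 that] disj by (fastforce simp: lozenge_def)
  have 2: "L \<subseteq> B \<and> \<not> L \<subseteq> A \<and> L \<inter> \<Union>(cr ` S) = {} \<and> lozenge L" if "L \<in> T2" for L
    using tilingsD(1,2)[OF T2 that] disj by (fastforce simp: lozenge_def)
  have 3: "L \<subseteq> A \<union> B \<and> \<not> L \<subseteq> A \<and> \<not> L \<subseteq> B \<and> lozenge L" if "L \<in> cr ` S" for L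
    using that cr_cross cr_lozenge S by blast
  show "crossing (cr ` S \<union> T1 \<union> T2) = cr ` S"
    unfolding crossing_def using 1 2 3 by blast
  show "{L \<in> cr ` S \<union> T1 \<union> T2. L \<subseteq> A} = T1" "{L \<in> cr ` S \<union> T1 \<union> T2. L \<subseteq> B} = T2"
    using 1 2 3 by blast+
  show "cr ` S \<union> T1 \<union> T2 \<in> tilings (A \<union> B)"
  proof (rule tilingsI)
    fix L L' t
    assume "L \<in> cr ` S \<union> T1 \<union> T2" "L' \<in> cr ` S \<union> T1 \<union> T2" and t: "t \<in> L" "t \<in> L'"
    then have LL: "L \<in> cr ` S \<or> L \<in> T1 \<or> L \<in> T2" "L' \<in> cr ` S \<or> L' \<in> T1 \<or> L' \<in> T2" by auto
    have in1: "t \<in> A \<and> t \<notin> B \<and> t \<notin> \<Union>(cr ` S)" if "M \<in> T1" "t \<in> M" for M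
      using 1[OF that(1)] that(2) disj by auto
    have in2: "t \<in> B \<and> t \<notin> A \<and> t \<notin> \<Union>(cr ` S)" if "M \<in> T2" "t \<in> M" for M
      using 2[OF that(1)] that(2) disj by auto
    have in3: "t \<in> \<Union>(cr ` S)" if "M \<in> cr ` S" "t \<in> M" for M
      using that by auto
    show "L = L'"
    proof (cases "t \<in> \<Union>(cr ` S)")
      case True
      then have "L \<in> cr ` S" "L' \<in> cr ` S"
        using LL t in1[of L] in1[of L'] in2[of L] in2[of L'] by blast+
      then obtain i j where "L = cr i" "L' = cr j" by auto
      then show ?thesis using t cr_disj[of i j] by (cases "i = j") auto
    next
      case False
      then consider "L \<in> T1" "L' \<in> T1" | "L \<in> T2" "L' \<in> T2"
        using LL t in1[of L] in1[of L'] in2[of L] in2[of L'] in3[of L] in3[of L'] by blast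
      then show ?thesis
        by cases (use t tilingsD(4)[OF T1] tilingsD(4)[OF T2] in auto)
    qed
  next
    fix t assume "t \<in> A \<union> B" then show "\<exists>L\<in>cr ` S \<union> T1 \<union> T2. t \<in> L"
      using tilingsD(3)[OF T1, of t] tilingsD(3)[OF T2, of t] by auto
  next
    fix L assume "L \<in> cr ` S \<union> T1 \<union> T2"
    then show "lozenge L" "L \<subseteq> A \<union> B" using 1[of L] 2[of L] 3[of L] by auto
  qed
qed

lemma cut_tiling:
  assumes T: "T \<in> tilings (A \<union> B)" and S: "crossing T = cr ` S"
  shows "{L \<in> T. L \<subseteq> A} \<in> tilings (A - \<Union>(cr ` S))" "{L \<in> T. L \<subseteq> B} \<in> tilings (B - \<Union>(cr ` S))"
    "cr ` S \<union> {L \<in> T. L \<subseteq> A} \<union> {L \<in> T. L \<subseteq> B} = T"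
proof -
  note D = tilingsD[OF T]
  have cr: "L \<in> cr ` S \<longleftrightarrow> L \<in> T \<and> \<not> L \<subseteq> A \<and> \<not> L \<subseteq> B" for L
    using S unfolding crossing_def by blast
  show "cr ` S \<union> {L \<in> T. L \<subseteq> A} \<union> {L \<in> T. L \<subseteq> B} = T" using cr by blast
  show "{L \<in> T. L \<subseteq> A} \<in> tilings (A - \<Union>(cr ` S))"
  proof (rule tilingsI)
    fix L assume L: "L \<in> {L \<in> T. L \<subseteq> A}"
    then show "lozenge L" using D(1) by auto
    have "t \<notin> M" if "t \<in> L" "M \<in> cr ` S" for t M
      using D(4)[of L M t] cr[of M] that L by auto
    then show "L \<subseteq> A - \<Union>(cr ` S)" using L by auto
  next
    fix t assume t: "t \<in> A - \<Union>(cr ` S)"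
    then obtain L where L: "L \<in> T" "t \<in> L" using D(3)[of t] by auto
    then have "L \<notin> cr ` S" using t by auto
    then show "\<exists>L\<in>{L \<in> T. L \<subseteq> A}. t \<in> L" using t cr[of L] disj L by auto
  next
    fix L L' t assume "L \<in> {L \<in> T. L \<subseteq> A}" "L' \<in> {L \<in> T. L \<subseteq> A}" "t \<in> L" "t \<in> L'"
    then show "L = L'" using D(4)[of L L' t] by auto
  qed
  show "{L \<in> T. L \<subseteq> B} \<in> tilings (B - \<Union>(cr ` S))"
  proof (rule tilingsI)
    fix L assume L: "L \<in> {L \<in> T. L \<subseteq> B}"
    then show "lozenge L" using D(1) by auto
    have "t \<notin> M" if "t \<in> L" "M \<in> cr ` S" for t M
      using D(4)[of L M t] cr[of M] that L by auto
    then show "L \<subseteq> B - \<Union>(cr ` S)" using L by auto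
  next
    fix t assume t: "t \<in> B - \<Union>(cr ` S)"
    then obtain L where L: "L \<in> T" "t \<in> L" using D(3)[of t] by auto
    then have "L \<notin> cr ` S" using t by auto
    then show "\<exists>L\<in>{L \<in> T. L \<subseteq> B}. t \<in> L" using t cr[of L] disj L by auto
  next
    fix L L' t assume "L \<in> {L \<in> T. L \<subseteq> B}" "L' \<in> {L \<in> T. L \<subseteq> B}" "t \<in> L" "t \<in> L'"
    then show "L = L'" using D(4)[of L L' t] by auto
  qed
qed

text \<open>Stated for an arbitrary set \<open>X\<close> of tilings, in order to cover both all
  tilings and only the rotation-invariant ones.\<close>

lemma card_by_crossing:
  assumes "X \<subseteq> tilings (A \<union> B)"
  shows "card X = (\<Sum>S\<in>Pow I. card {T \<in> X. crossing T = cr ` S})"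
proof -
  have finX: "finite X" using assms finite_tilings[of "A \<union> B"] finA finB by (auto intro: finite_subset)
  have "X = (\<Union>S\<in>Pow I. {T \<in> X. crossing T = cr ` S})"
  proof (intro equalityI subsetI)
    fix T assume T: "T \<in> X"
    obtain S where "S \<subseteq> I" "crossing T = cr ` S"
      using crossing_obtain[of T] assms T by auto
    then show "T \<in> (\<Union>S\<in>Pow I. {T \<in> X. crossing T = cr ` S})" using T by auto
  qed auto
  then have "card X = card (\<Union>S\<in>Pow I. {T \<in> X. crossing T = cr ` S})" by simp
  also have "\<dots> = (\<Sum>S\<in>Pow I. card {T \<in> X. crossing T = cr ` S})"
  proof (rule card_UN_disjoint)
    show "\<forall>S\<in>Pow I. \<forall>S'\<in>Pow I. S \<noteq> S' \<longrightarrow>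
        {T \<in> X. crossing T = cr ` S} \<inter> {T \<in> X. crossing T = cr ` S'} = {}"
    proof (intro ballI impI)
      fix S S' assume "S \<in> Pow I" "S' \<in> Pow I" "S \<noteq> S'"
      then have "cr ` S \<noteq> cr ` S'" using inj_on_image_eq_iff[OF cr_inj, of S S'] by auto
      then show "{T \<in> X. crossing T = cr ` S} \<inter> {T \<in> X. crossing T = cr ` S'} = {}"
        by (intro Int_emptyI) simp
    qed
  qed (use finX finI in auto)
  finally show ?thesis .
qed

text \<open>Once the crossing lozenges are fixed, the two sides are tiled independently.\<close>

lemma card_tilings_cut:
  "card (tilings (A \<union> B))
     = (\<Sum>S\<in>Pow I. card (tilings (A - \<Union>(cr ` S))) * card (tilings (B - \<Union>(cr ` S))))"
proof -
  have "card {T \<in> tilings (A \<union> B). crossing T = cr ` S}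
      = card (tilings (A - \<Union>(cr ` S))) * card (tilings (B - \<Union>(cr ` S)))" if S: "S \<subseteq> I" for S
  proof -
    have "bij_betw (\<lambda>(T1, T2). cr ` S \<union> T1 \<union> T2)
        (tilings (A - \<Union>(cr ` S)) \<times> tilings (B - \<Union>(cr ` S))) {T \<in> tilings (A \<union> B). crossing T = cr ` S}"
      (is "bij_betw _ ?D ?E")
    proof (rule bij_betw_byWitness[where f' = "\<lambda>T. ({L \<in> T. L \<subseteq> A}, {L \<in> T. L \<subseteq> B})"])
      show "\<forall>p\<in>?D. (\<lambda>T. ({L \<in> T. L \<subseteq> A}, {L \<in> T. L \<subseteq> B})) (case p of (T1, T2) \<Rightarrow> cr ` S \<union> T1 \<union> T2) = p"
        using glue_tiling(3,4)[OF S] by (auto simp del: Un_iff)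
      show "\<forall>T\<in>?E. (case ({L \<in> T. L \<subseteq> A}, {L \<in> T. L \<subseteq> B}) of (T1, T2) \<Rightarrow> cr ` S \<union> T1 \<union> T2) = T"
        using cut_tiling(3) by simp
      show "(\<lambda>(T1, T2). cr ` S \<union> T1 \<union> T2) ` ?D \<subseteq> ?E"
        using glue_tiling(1,2)[OF S] by auto
      show "(\<lambda>T. ({L \<in> T. L \<subseteq> A}, {L \<in> T. L \<subseteq> B})) ` ?E \<subseteq> ?D"
        using cut_tiling(1,2) by auto
    qed
    from bij_betw_same_card[OF this] show ?thesis by (simp add: card_cartesian_product)
  qed
  then show ?thesis using card_by_crossing[of "tilings (A \<union> B)"] by simp
qed

end

section \<open>Tilings invariant under the half-turn\<close>

lemma rot_rot [simp]: "rot C (rot C t) = t"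
  by (cases t) auto

lemma inj_rot: "inj (rot C)"
  by (rule inj_on_inverseI[where g = "rot C"]) simp

lemma rot_eq_iff [simp]: "rot C s = rot C t \<longleftrightarrow> s = t"
  by (metis rot_rot)

lemma image_rot_rot [simp]: "rot C ` rot C ` L = L"
  by (simp add: image_image)

lemma image_image_rot [simp]: "(`) (rot C) ` (`) (rot C) ` T = T"
  by (simp add: image_image)

lemma lozenge_rot:
  assumes "lozenge L"
  shows "lozenge (rot C ` L)"
proof -
  have rots: "rot C ` {Up u v, Down u v} = {Up (fst C - u - 1) (snd C - v - 1), Down (fst C - u - 1) (snd C - v - 1)}"
    "rot C ` {Up u v, Down (u - 1) v} = {Up (fst C - u) (snd C - v - 1), Down (fst C - u - 1) (snd C - v - 1)}"
    "rot C ` {Up u v, Down u (v - 1)} = {Up (fst C - u - 1) (snd C - v), Down (fst C - u - 1) (snd C - v - 1)}"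
    for u v by (simp_all add: insert_commute)
  from assms obtain u v where
    "L = {Up u v, Down u v} \<or> L = {Up u v, Down (u - 1) v} \<or> L = {Up u v, Down u (v - 1)}"
    unfolding lozenge_iff by auto
  then show ?thesis
  proof (elim disjE)
    assume "L = {Up u v, Down u v}"
    then have "rot C ` L = {Up (fst C - u - 1) (snd C - v - 1), Down (fst C - u - 1) (snd C - v - 1)}"
      by (simp only: rots)
    then show ?thesis unfolding lozenge_iff by blast
  next
    assume "L = {Up u v, Down (u - 1) v}"
    then have "rot C ` L = {Up (fst C - u) (snd C - v - 1), Down (fst C - u - 1) (snd C - v - 1)}"
      by (simp only: rots)
    then show ?thesis unfolding lozenge_iff by blast
  next
    assume "L = {Up u v, Down u (v - 1)}"
    then have "rot C ` L = {Up (fst C - u - 1) (snd C - v), Down (fst C - u - 1) (snd C - v - 1)}"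
      by (simp only: rots)
    then show ?thesis unfolding lozenge_iff by blast
  qed
qed

lemma tilings_rot:
  assumes T: "T \<in> tilings R"
  shows "(`) (rot C) ` T \<in> tilings (rot C ` R)"
proof (rule tilingsI)
  fix L assume "L \<in> (`) (rot C) ` T"
  then obtain M where M: "M \<in> T" "L = rot C ` M" by auto
  then show "lozenge L" "L \<subseteq> rot C ` R"
    using tilingsD(1,2)[OF T, of M] lozenge_rot[of M C] by auto
next
  fix t assume "t \<in> rot C ` R"
  then show "\<exists>L\<in>(`) (rot C) ` T. t \<in> L" using tilingsD(3)[OF T] by auto
next
  fix L L' t
  assume L: "L \<in> (`) (rot C) ` T" "L' \<in> (`) (rot C) ` T" "t \<in> L" "t \<in> L'"
  then obtain M M' where "M \<in> T" "L = rot C ` M" "M' \<in> T" "L' = rot C ` M'" by auto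
  moreover have "rot C t \<in> M" "rot C t \<in> M'" using calculation L(3,4) by auto
  ultimately show "L = L'" using tilingsD(4)[OF T, of M M'] by auto
qed

text \<open>In contrast to \<open>card_tilings_cut\<close> there is one factor per summand, because
  the tiling of \<open>B\<close> is the rotated tiling of \<open>A\<close>. Conversely, for a
  \<open>\<sigma>\<close>-invariant crossing set any tiling of the rest of \<open>A\<close>, glued
  to its image, is invariant.\<close>

lemma (in cut) M_odot_cut:
  assumes rotA: "rot C ` A = B" and rot_cr: "\<And>i. rot C ` cr i = cr (\<sigma> i)" and \<sigma>: "\<sigma> ` I \<subseteq> I"
  shows "M_odot C (A \<union> B) = (\<Sum>S | S \<subseteq> I \<and> \<sigma> ` S = S. card (tilings (A - \<Union>(cr ` S))))"
proof -
  let ?\<rho> = "(`) ((`) (rot C))"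
  let ?X = "{T \<in> tilings (A \<union> B). ?\<rho> T = T}"
  have rotB: "rot C ` B = A" using rotA by (metis image_rot_rot)
  have rot_crS: "?\<rho> (cr ` S) = cr ` \<sigma> ` S" for S
    by (auto simp: rot_cr image_image)
  have rotU: "rot C ` \<Union>(cr ` S) = \<Union>(cr ` \<sigma> ` S)" for S
    by (simp add: image_Union rot_cr image_image)
  have sub: "rot C ` L \<subseteq> A \<longleftrightarrow> L \<subseteq> B" "rot C ` L \<subseteq> B \<longleftrightarrow> L \<subseteq> A" for L
    using rotA rotB by (metis image_mono image_rot_rot)+
  have filt: "{L \<in> ?\<rho> T. P L} = ?\<rho> {L \<in> T. P (rot C ` L)}" for P T
    by auto
  have sym: "\<sigma> ` S = S" if "?\<rho> T = T" "crossing T = cr ` S" "S \<subseteq> I" for S T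
  proof -
    have "?\<rho> (crossing T) = crossing (?\<rho> T)"
      unfolding crossing_def filt sub by (simp add: conj_commute)
    then have "cr ` \<sigma> ` S = cr ` S" using that by (simp add: rot_crS)
    then show ?thesis
      using inj_on_image_eq_iff[OF cr_inj, of "\<sigma> ` S" S] that(3) \<sigma> by (simp add: subset_trans[OF image_mono])
  qed
  have "card {T \<in> ?X. crossing T = cr ` S} = (if \<sigma> ` S = S then card (tilings (A - \<Union>(cr ` S))) else 0)"
    if S: "S \<subseteq> I" for S
  proof (cases "\<sigma> ` S = S")
    case False
    then have "{T \<in> ?X. crossing T = cr ` S} = {}" using sym[OF _ _ S] by auto
    then show ?thesis using False by (simp only: card.empty if_False)
  next
    case True
    have rotAS: "rot C ` (A - \<Union>(cr ` S)) = B - \<Union>(cr ` S)"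
      by (simp only: image_set_diff[OF inj_rot] rotA rotU True)
    have T2: "?\<rho> T \<in> tilings (B - \<Union>(cr ` S))" if "T \<in> tilings (A - \<Union>(cr ` S))" for T
      using tilings_rot[OF that, of C] rotAS by simp
    have fix1: "?\<rho> (cr ` S \<union> T \<union> ?\<rho> T) = cr ` S \<union> T \<union> ?\<rho> T" for T
      by (simp only: image_Un rot_crS True image_image_rot Un_ac)
    have half: "?\<rho> {L \<in> T. L \<subseteq> A} = {L \<in> T. L \<subseteq> B}" if "?\<rho> T = T" for T
    proof -
      have "?\<rho> {L \<in> T. L \<subseteq> A} = {L \<in> ?\<rho> T. L \<subseteq> B}" unfolding filt sub ..
      then show ?thesis using that by simp
    qed
    have "bij_betw (\<lambda>T. cr ` S \<union> T \<union> ?\<rho> T) (tilings (A - \<Union>(cr ` S))) {T \<in> ?X. crossing T = cr ` S}"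
    proof (rule bij_betw_byWitness[where f' = "\<lambda>T. {L \<in> T. L \<subseteq> A}"])
      show "\<forall>T\<in>tilings (A - \<Union>(cr ` S)). {L \<in> cr ` S \<union> T \<union> ?\<rho> T. L \<subseteq> A} = T"
        by (intro ballI glue_tiling(3)[OF S _ T2])
      show "\<forall>T\<in>{T \<in> ?X. crossing T = cr ` S}. cr ` S \<union> {L \<in> T. L \<subseteq> A} \<union> ?\<rho> {L \<in> T. L \<subseteq> A} = T"
        using cut_tiling(3) half by simp
      show "(\<lambda>T. cr ` S \<union> T \<union> ?\<rho> T) ` tilings (A - \<Union>(cr ` S)) \<subseteq> {T \<in> ?X. crossing T = cr ` S}"
      proof (intro image_subsetI CollectI conjI)
        fix T assume "T \<in> tilings (A - \<Union>(cr ` S))"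
        from glue_tiling(1,2)[OF S this T2[OF this]]
        show "cr ` S \<union> T \<union> ?\<rho> T \<in> tilings (A \<union> B)" "crossing (cr ` S \<union> T \<union> ?\<rho> T) = cr ` S" .
        show "?\<rho> (cr ` S \<union> T \<union> ?\<rho> T) = cr ` S \<union> T \<union> ?\<rho> T" by (rule fix1)
      qed
      show "(\<lambda>T. {L \<in> T. L \<subseteq> A}) ` {T \<in> ?X. crossing T = cr ` S} \<subseteq> tilings (A - \<Union>(cr ` S))"
        using cut_tiling(1) by (intro image_subsetI) simp
    qed
    then show ?thesis using True bij_betw_same_card by fastforce
  qed
  then have "card ?X = (\<Sum>S\<in>Pow I. if \<sigma> ` S = S then card (tilings (A - \<Union>(cr ` S))) else 0)"
    using card_by_crossing[of ?X] by simp
  also have "\<dots> = (\<Sum>S\<in>{S \<in> Pow I. \<sigma> ` S = S}. card (tilings (A - \<Union>(cr ` S))))"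
    by (rule sum.inter_filter[symmetric]) (simp add: finI)
  also have "{S \<in> Pow I. \<sigma> ` S = S} = {S. S \<subseteq> I \<and> \<sigma> ` S = S}" by blast
  finally show ?thesis by (simp add: M_odot_def tilings_def)
qed

section \<open>Dented trapezoids\<close>

definition tri_row :: "int \<Rightarrow> int set \<Rightarrow> int set \<Rightarrow> tri set" where
  "tri_row v U W = (\<lambda>u. Up u v) ` U \<union> (\<lambda>u. Down u v) ` W"

lemma Up_in_tri_row [simp]: "Up u w \<in> tri_row v U W \<longleftrightarrow> w = v \<and> u \<in> U"
  and Down_in_tri_row [simp]: "Down u w \<in> tri_row v U W \<longleftrightarrow> w = v \<and> u \<in> W"
  by (auto simp: tri_row_def)

abbreviation rloz :: "int \<Rightarrow> int \<Rightarrow> tri set" where "rloz v u \<equiv> {Up u v, Down u v}"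
text \<open>Both kinds are indexed by their \<open>Down\<close> face: \<open>Down u v\<close> lies
  in \<open>rloz v u\<close> or \<open>lloz v u\<close>, whereas \<open>Up u v\<close> lies in
  \<open>rloz v u\<close> or \<open>lloz v (u - 1)\<close>.\<close>

abbreviation lloz :: "int \<Rightarrow> int \<Rightarrow> tri set" where "lloz v u \<equiv> {Up (u + 1) v, Down u v}"

lemma lozenge_rloz: "lozenge (rloz v u)" and lozenge_lloz: "lozenge (lloz v u)"
proof -
  show "lozenge (rloz v u)" unfolding lozenge_iff by blast
  have "lloz v u = {Up (u + 1) v, Down (u + 1 - 1) v}" by simp
  then show "lozenge (lloz v u)" unfolding lozenge_iff by blast
qed

lemma row_tilingD:
  assumes T: "T \<in> tilings (tri_row v U W)"
  shows "\<And>L. L \<in> T \<Longrightarrow> \<exists>u. L = rloz v u \<or> L = lloz v u"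
    and "\<And>u. rloz v u \<in> T \<Longrightarrow> u \<in> U \<and> u \<in> W" and "\<And>u. lloz v u \<in> T \<Longrightarrow> u + 1 \<in> U \<and> u \<in> W"
    and "\<And>u. u \<in> U \<Longrightarrow> rloz v u \<in> T \<longleftrightarrow> lloz v (u - 1) \<notin> T"
    and "\<And>u. u \<in> W \<Longrightarrow> rloz v u \<in> T \<longleftrightarrow> lloz v u \<notin> T"
proof -
  note D = tilingsD[OF T]
  show shape: "\<exists>u. L = rloz v u \<or> L = lloz v u" if L: "L \<in> T" for L
  proof -
    have sub: "L \<subseteq> tri_row v U W" using D(2)[OF L] .
    from D(1)[OF L] obtain u w where
      "L = {Up u w, Down u w} \<or> L = {Up u w, Down (u - 1) w} \<or> L = {Up u w, Down u (w - 1)}"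
      unfolding lozenge_iff by blast
    then show ?thesis
    proof (elim disjE)
      assume "L = {Up u w, Down u w}"
      then show ?thesis using sub by auto
    next
      assume *: "L = {Up u w, Down (u - 1) w}"
      then have "L = lloz v (u - 1)" using sub by auto
      then show ?thesis by blast
    next
      assume *: "L = {Up u w, Down u (w - 1)}"
      then show ?thesis using sub by auto
    qed
  qed
  show "u \<in> U \<and> u \<in> W" if "rloz v u \<in> T" for u
    using D(2)[OF that] by auto
  show "u + 1 \<in> U \<and> u \<in> W" if "lloz v u \<in> T" for u
    using D(2)[OF that] by auto
  show "rloz v u \<in> T \<longleftrightarrow> lloz v (u - 1) \<notin> T" if u: "u \<in> U" for u
  proof
    assume "rloz v u \<in> T"
    then show "lloz v (u - 1) \<notin> T"
      using D(4)[of "rloz v u" "lloz v (u - 1)" "Up u v"] by (auto simp: doubleton_eq_iff)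
  next
    assume n: "lloz v (u - 1) \<notin> T"
    obtain L where L: "L \<in> T" "Up u v \<in> L" using D(3)[of "Up u v"] u by auto
    obtain w where "L = rloz v w \<or> L = lloz v w" using shape[OF L(1)] by blast
    then have "L = rloz v u \<or> L = lloz v (u - 1)" using L(2) by auto
    then show "rloz v u \<in> T" using L n by auto
  qed
  show "rloz v u \<in> T \<longleftrightarrow> lloz v u \<notin> T" if u: "u \<in> W" for u
  proof
    assume "rloz v u \<in> T"
    then show "lloz v u \<notin> T"
      using D(4)[of "rloz v u" "lloz v u" "Down u v"] by (auto simp: doubleton_eq_iff)
  next
    assume n: "lloz v u \<notin> T"
    obtain L where L: "L \<in> T" "Down u v \<in> L" using D(3)[of "Down u v"] u by auto
    obtain w where "L = rloz v w \<or> L = lloz v w" using shape[OF L(1)] by blast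
    then have "L = rloz v u \<or> L = lloz v u" using L(2) by auto
    then show "rloz v u \<in> T" using L n by auto
  qed
qed

text \<open>
  In a tiling of a row, \<open>excess D D' u\<close> is 1 if \<open>Up u\<close> is matched with the face to its left, and 0 otherwise;
  this is why such a tiling is unique and exists only for interlacing sets.
\<close>

definition excess :: "int set \<Rightarrow> int set \<Rightarrow> int \<Rightarrow> int" where
  "excess D D' u = int (card {e \<in> D. e < u}) - int (card {e \<in> D'. e < u})"

text \<open>If d_0 < ... < d_h are the elements of \<open>D\<close>, the condition says that exactly
  i elements of \<open>D'\<close> lie below d_i, that is, one in each half-open interval from d_i to
  d_(i+1) and none elsewhere. The counting form is the one that a row tiling produces.\<close>

definition interlace :: "int set \<Rightarrow> int set \<Rightarrow> bool" where
  "interlace D D' \<longleftrightarrow> card D = Suc (card D') \<and> (\<forall>u\<in>D. excess D D' u = 0)"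

lemma card_less_add_1:
  assumes "finite D"
  shows "card {e \<in> D. e < u + 1} = card {e \<in> D. e < (u::int)} + of_bool (u \<in> D)"
proof (cases "u \<in> D")
  case True
  then have "{e \<in> D. e < u + 1} = insert u {e \<in> D. e < u}" by auto
  then show ?thesis using assms True by simp
next
  case False
  then have "{e \<in> D. e < u + 1} = {e \<in> D. e < u}" by (auto simp: less_le zless_add1_eq)
  then show ?thesis using False by simp
qed

lemma excess_add_1:
  assumes "finite D" "finite D'"
  shows "excess D D' (u + 1) = excess D D' u + of_bool (u \<in> D) - of_bool (u \<in> D')"
  unfolding excess_def card_less_add_1[OF assms(1)] card_less_add_1[OF assms(2)] by simp

text \<open>The excess vanishes at the elements of \<open>D\<close>. Up to the next element at or
  after \<open>u\<close> only \<open>D'\<close> can gain, which gives the lower bound; since the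
  last element before \<open>u\<close> the count of \<open>D\<close> has grown by one only, which
  gives the upper bound.\<close>

lemma excess_bounds:
  assumes fin: "finite D" "finite D'" and il: "interlace D D'"
  shows "0 \<le> excess D D' u" "excess D D' u \<le> 1"
proof -
  have zero: "card {e \<in> D'. e < d} = card {e \<in> D. e < d}" if "d \<in> D" for d
    using il that by (auto simp: interlace_def excess_def)
  show "0 \<le> excess D D' u"
  proof (cases "{d \<in> D. u \<le> d} = {}")
    case True
    then have "{e \<in> D. e < u} = D" by auto
    moreover have "card {e \<in> D'. e < u} \<le> card D'" using fin by (intro card_mono) auto
    ultimately show ?thesis using il by (simp add: excess_def interlace_def)
  next
    case False
    define d where "d = Min {d \<in> D. u \<le> d}"
    have d: "d \<in> D" "u \<le> d" and dmin: "\<And>e. e \<in> D \<Longrightarrow> u \<le> e \<Longrightarrow> d \<le> e"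
      using Min_in[of "{d \<in> D. u \<le> d}"] False fin by (auto simp: d_def)
    have "{e \<in> D. e < u} = {e \<in> D. e < d}" using d dmin by force
    moreover have "card {e \<in> D'. e < u} \<le> card {e \<in> D'. e < d}"
      using fin d by (intro card_mono) auto
    ultimately show ?thesis using zero[OF d(1)] by (simp add: excess_def)
  qed
  show "excess D D' u \<le> 1"
  proof (cases "{d \<in> D. d < u} = {}")
    case True
    show ?thesis unfolding excess_def True by simp
  next
    case False
    define d where "d = Max {d \<in> D. d < u}"
    have d: "d \<in> D" "d < u" and dmax: "\<And>e. e \<in> D \<Longrightarrow> e < u \<Longrightarrow> e \<le> d"
      using Max_in[of "{d \<in> D. d < u}"] False fin by (auto simp: d_def)
    have "{e \<in> D. e < u} = insert d {e \<in> D. e < d}" using d dmax by force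
    then have "card {e \<in> D. e < u} = Suc (card {e \<in> D. e < d})" using fin by simp
    moreover have "card {e \<in> D'. e < d} \<le> card {e \<in> D'. e < u}"
      using fin d by (intro card_mono) auto
    ultimately show ?thesis using zero[OF d(1)] by (simp add: excess_def)
  qed
qed

lemma excess_0:
  assumes "D \<subseteq> {0..}" "D' \<subseteq> {0..}" shows "excess D D' 0 = 0"
proof -
  have e: "{e \<in> D. e < 0} = {}" "{e \<in> D'. e < 0} = {}" using assms by auto
  show ?thesis unfolding excess_def e by simp
qed

text \<open>Induction from the left end, where \<open>Up 0 v\<close> has no left neighbour in the
  row. Going right, the presence of the faces at \<open>u\<close> determines the next matching by
  the same recurrence as \<open>excess_add_1\<close>.\<close>

lemma row_excess:
  assumes T: "T \<in> tilings (tri_row v ({0..<n} - D) ({0..<n - 1} - D'))"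
    and D: "D \<subseteq> {0..<n}" and D': "D' \<subseteq> {0..<n - 1}" and u: "0 \<le> u" "u \<le> n - 1"
  shows "of_bool (lloz v (u - 1) \<in> T) = excess D D' u"
  using u
proof (induction u rule: int_ge_induct)
  case base
  have "lloz v (0 - 1) \<notin> T" using row_tilingD(3)[OF T, of "0 - 1"] by auto
  moreover have "D \<subseteq> {0..}" "D' \<subseteq> {0..}" using D D' by auto
  ultimately show ?case using excess_0[of D D'] by simp
next
  case (step u)
  note R = row_tilingD[OF T]
  have fin: "finite D" "finite D'" using D D' by (auto intro: finite_subset)
  have IH: "of_bool (lloz v (u - 1) \<in> T) = excess D D' u" using step by simp
  have a: "u \<notin> D \<Longrightarrow> rloz v u \<in> T \<longleftrightarrow> lloz v (u - 1) \<notin> T" using R(4)[of u] step by simp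
  have b: "u \<notin> D' \<Longrightarrow> rloz v u \<in> T \<longleftrightarrow> lloz v u \<notin> T" using R(5)[of u] step by simp
  have c: "u \<in> D \<or> u \<in> D' \<Longrightarrow> rloz v u \<notin> T" using R(2)[of u] by auto
  have d: "u \<in> D' \<Longrightarrow> lloz v u \<notin> T" using R(3)[of u] by auto
  have e: "u \<in> D \<Longrightarrow> lloz v (u - 1) \<notin> T" using R(3)[of "u - 1"] by auto
  have "of_bool (lloz v u \<in> T) = (of_bool (lloz v (u - 1) \<in> T) :: int) + of_bool (u \<in> D) - of_bool (u \<in> D')"
    using a b c d e by (cases "u \<in> D"; cases "u \<in> D'"; simp)
  then show ?case using excess_add_1[OF fin, of u] IH by simp
qed

text \<open>A missing up face is not matched to the left, so the excess is 0 on \<open>D\<close>. At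
  the right end \<open>Down (n - 1) v\<close> is outside the row, so the last up face, if present,
  is matched to the left; this makes the total excess 1, which is the cardinality condition.\<close>

lemma row_tiling_interlace:
  assumes T: "T \<in> tilings (tri_row v ({0..<n} - D) ({0..<n - 1} - D'))"
    and D: "D \<subseteq> {0..<n}" and D': "D' \<subseteq> {0..<n - 1}" and n: "n \<ge> 1"
  shows "interlace D D'"
proof -
  note R = row_tilingD[OF T] and E = row_excess[OF T D D']
  have fin: "finite D" "finite D'" using D D' by (auto intro: finite_subset)
  have zero: "excess D D' u = 0" if u: "u \<in> D" for u
  proof -
    have "lloz v (u - 1) \<notin> T" using R(3)[of "u - 1"] u by auto
    then show ?thesis using E[of u] u D by auto
  qed
  have "{e \<in> D. e < n} = D" "{e \<in> D'. e < n} = D'" using D D' by auto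
  then have total: "excess D D' n = int (card D) - int (card D')" by (simp add: excess_def)
  have "rloz v (n - 1) \<notin> T" using R(2)[of "n - 1"] by auto
  then have "n - 1 \<notin> D \<Longrightarrow> lloz v (n - 1 - 1) \<in> T" using R(4)[of "n - 1"] n by auto
  moreover have "n - 1 \<in> D \<Longrightarrow> excess D D' (n - 1) = 0" by (rule zero)
  ultimately have "excess D D' (n - 1) = of_bool (n - 1 \<notin> D)"
    using E[of "n - 1"] n by (cases "n - 1 \<in> D") auto
  moreover have "n - 1 \<notin> D'" using D' by auto
  ultimately have "excess D D' n = 1" using excess_add_1[OF fin, of "n - 1"] by simp
  then show ?thesis using total zero by (auto simp: interlace_def)
qed

lemma row_tiling_unique:
  assumes T: "T \<in> tilings (tri_row v ({0..<n} - D) ({0..<n - 1} - D'))"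
    and T': "T' \<in> tilings (tri_row v ({0..<n} - D) ({0..<n - 1} - D'))"
    and D: "D \<subseteq> {0..<n}" and D': "D' \<subseteq> {0..<n - 1}"
  shows "T \<subseteq> T'"
proof
  fix L assume L: "L \<in> T"
  note R = row_tilingD[OF T] and R' = row_tilingD[OF T']
  have same: "lloz v (u - 1) \<in> T \<longleftrightarrow> lloz v (u - 1) \<in> T'" if "0 \<le> u" "u \<le> n - 1" for u
    using row_excess[OF T D D' that] row_excess[OF T' D D' that] by (simp add: of_bool_def split: if_splits)
  obtain u where "L = rloz v u \<or> L = lloz v u" using R(1)[OF L] by blast
  then show "L \<in> T'"
  proof
    assume Lu: "L = rloz v u"
    then have u: "u \<in> {0..<n} - D" using R(2)[of u] L by auto
    then have "lloz v (u - 1) \<notin> T" using R(4)[OF u] L Lu by auto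
    then have "lloz v (u - 1) \<notin> T'" using same[of u] u by auto
    then show ?thesis using R'(4)[OF u] Lu by auto
  next
    assume Lu: "L = lloz v u"
    then have u: "u \<in> {0..<n - 1} - D'" using R(3)[of u] L by auto
    then show ?thesis using same[of "u + 1"] L Lu by auto
  qed
qed

text \<open>The excess is used as a recipe: \<open>Up u v\<close> goes right if it is 0 and left if
  it is 1. Interlacing ensures that the chosen partner is present and is chosen by no other
  face.\<close>

lemma interlace_row_tiling:
  assumes D: "D \<subseteq> {0..<n}" and D': "D' \<subseteq> {0..<n - 1}" and il: "interlace D D'"
  shows "\<exists>T. T \<in> tilings (tri_row v ({0..<n} - D) ({0..<n - 1} - D'))"
proof -
  let ?U = "{0..<n} - D" and ?W = "{0..<n - 1} - D'"
  have fin: "finite D" "finite D'" using D D' by (auto intro: finite_subset)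
  have ex01: "excess D D' u = 0 \<or> excess D D' u = 1" for u
    using excess_bounds[OF fin il, of u] by linarith
  have step: "excess D D' (u + 1) = excess D D' u + of_bool (u \<in> D) - of_bool (u \<in> D')" for u
    by (rule excess_add_1[OF fin])
  have ex0: "excess D D' 0 = 0" by (rule excess_0) (use D D' in auto)
  have exD: "excess D D' u = 0" if "u \<in> D" for u using il that by (auto simp: interlace_def)
  have exD': "excess D D' (u + 1) = 0" "u \<in> D \<or> excess D D' u = 1" if "u \<in> D'" for u
    using step[of u] ex01[of u] ex01[of "u + 1"] exD[of u] that by (cases "u \<in> D"; auto)+
  have "{e \<in> D. e < n} = D" "{e \<in> D'. e < n} = D'" using D D' by auto
  then have "excess D D' n = 1" using il by (simp add: excess_def interlace_def)
  \<comment> \<open>At the right end the recipe must not point to a face outside the row.\<close>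
  then have exn: "excess D D' (n - 1) = 1" if "n - 1 \<notin> D"
    using step[of "n - 1"] that ex01[of "n - 1"] by (cases "n - 1 \<in> D'"; auto)
  define T where "T = {rloz v u |u. u \<in> ?U \<and> excess D D' u = 0} \<union> {lloz v u |u. u \<in> ?W \<and> excess D D' (u + 1) = 1}"
  have rT: "rloz v u \<in> T" if "u \<in> ?U" "excess D D' u = 0" for u
    unfolding T_def using that by blast
  have lT: "lloz v u \<in> T" if "u \<in> ?W" "excess D D' (u + 1) = 1" for u
    unfolding T_def using that by blast
  have rW: "u \<in> ?W \<and> excess D D' (u + 1) = 0" if "u \<in> ?U" "excess D D' u = 0" for u
  proof -
    have "u \<noteq> n - 1" using exn that by auto
    moreover have "u \<notin> D'" using exD'(2)[of u] that by auto
    ultimately show ?thesis using that step[of u] by auto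
  qed
  have lU: "u + 1 \<in> ?U" if "u \<in> ?W" "excess D D' (u + 1) = 1" for u
    using exD[of "u + 1"] that by auto
  have "T \<in> tilings (tri_row v ?U ?W)"
  proof (rule tilingsI)
    fix L assume "L \<in> T"
    then consider u where "L = rloz v u" "u \<in> ?U" "excess D D' u = 0"
      | u where "L = lloz v u" "u \<in> ?W" "excess D D' (u + 1) = 1" unfolding T_def by blast
    note cs = this
    show "lozenge L" using cs by cases (simp_all only: lozenge_rloz lozenge_lloz)
    show "L \<subseteq> tri_row v ?U ?W"
      using cs by cases (use rW lU in auto)
  next
    fix t assume "t \<in> tri_row v ?U ?W"
    then consider u where "t = Up u v" "u \<in> ?U" | u where "t = Down u v" "u \<in> ?W"
      by (cases t) auto
    then show "\<exists>L\<in>T. t \<in> L"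
    proof cases
      case 1
      show ?thesis
      proof (cases "excess D D' u = 0")
        case True
        then show ?thesis using 1 by (intro bexI[OF _ rT[of u]]) auto
      next
        case False
        then have ex1: "excess D D' u = 1" using ex01[of u] by auto
        then have "u \<noteq> 0" using ex0 by auto
        moreover have "u - 1 \<notin> D'" using exD'(1)[of "u - 1"] ex1 by auto
        ultimately have "u - 1 \<in> ?W" using 1 by auto
        then show ?thesis using 1 ex1 by (intro bexI[OF _ lT[of "u - 1"]]) auto
      qed
    next
      case 2
      show ?thesis
      proof (cases "excess D D' (u + 1) = 1")
        case True
        then show ?thesis using 2 by (intro bexI[OF _ lT[of u]]) auto
      next
        case False
        then have "excess D D' u = 0 \<and> u \<notin> D"
          using ex01[of u] ex01[of "u + 1"] step[of u] 2 by (cases "u \<in> D") auto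
        then show ?thesis using 2 by (intro bexI[OF _ rT[of u]]) auto
      qed
    qed
  next
    fix L L' t assume L: "L \<in> T" "L' \<in> T" and t: "t \<in> L" "t \<in> L'"
    have cs: "\<exists>u. (L = rloz v u \<and> u \<in> ?U \<and> excess D D' u = 0) \<or> (L = lloz v u \<and> u \<in> ?W \<and> excess D D' (u + 1) = 1)"
      if "L \<in> T" for L using that unfolding T_def by blast
    obtain u where u: "(L = rloz v u \<and> u \<in> ?U \<and> excess D D' u = 0) \<or> (L = lloz v u \<and> u \<in> ?W \<and> excess D D' (u + 1) = 1)"
      using cs[OF L(1)] by blast
    obtain w where w: "(L' = rloz v w \<and> w \<in> ?U \<and> excess D D' w = 0) \<or> (L' = lloz v w \<and> w \<in> ?W \<and> excess D D' (w + 1) = 1)"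
      using cs[OF L(2)] by blast
    show "L = L'"
      using u w
    proof (elim disjE conjE)
      assume "L = rloz v u" "L' = rloz v w"
      then show ?thesis using t by auto
    next
      assume "L = lloz v u" "L' = lloz v w"
      then show ?thesis using t by auto
    next
      assume *: "L = rloz v u" "L' = lloz v w" "u \<in> ?U" "excess D D' u = 0" "excess D D' (w + 1) = 1"
      then have "u = w + 1 \<or> u = w" using t by auto
      then show ?thesis using rW[of u] * by auto
    next
      assume *: "L = lloz v u" "L' = rloz v w" "w \<in> ?U" "excess D D' w = 0" "excess D D' (u + 1) = 1"
      then have "w = u + 1 \<or> u = w" using t by auto
      then show ?thesis using rW[of w] * by auto
    qed
  qed
  then show ?thesis ..
qed

lemma card_tilings_row:
  assumes "D \<subseteq> {0..<n}" and "D' \<subseteq> {0..<n - 1}" and "n \<ge> 1"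
  shows "card (tilings (tri_row v ({0..<n} - D) ({0..<n - 1} - D'))) = of_bool (interlace D D')"
proof (cases "interlace D D'")
  case True
  then obtain T where T: "T \<in> tilings (tri_row v ({0..<n} - D) ({0..<n - 1} - D'))"
    using interlace_row_tiling assms by blast
  then have "tilings (tri_row v ({0..<n} - D) ({0..<n - 1} - D')) = {T}"
    using row_tiling_unique[OF _ _ assms(1,2)] by (intro equalityI subsetI) (auto intro!: equalityI)
  then show ?thesis using True by simp
next
  case False
  then have "tilings (tri_row v ({0..<n} - D) ({0..<n - 1} - D')) = {}"
    using row_tiling_interlace[OF _ assms] by auto
  then show ?thesis using False by simp
qed

text \<open>Passes from interlacing sets to the product of intervals over which
  \<open>sum_vandermonde_prod_interlacing\<close> sums; the inverse picks the single element of
  \<open>D'\<close> in each interval.\<close>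

lemma bij_betw_interlacing:
  assumes d: "\<And>i j. i < j \<Longrightarrow> j \<le> h \<Longrightarrow> d i < d j"
  shows "bij_betw (\<lambda>e. e ` {..<h}) (PiE {..<h} (\<lambda>i. {d i..<d (Suc i)})) {D'. finite D' \<and> interlace (d ` {..h}) D'}"
    (is "bij_betw ?F ?E ?S")
proof -
  have dle: "d i \<le> d j" if "i \<le> j" "j \<le> h" for i j
    using d[of i j] that by (cases "i = j") auto
  have dinj: "inj_on d {..h}"
    by (rule inj_onI) (metis atMost_iff d less_irrefl linorder_neqE_nat)
  have card_d: "card {x \<in> d ` {..h}. x < d i} = i" if "i \<le> h" for i
  proof -
    have "d j < d i \<longleftrightarrow> j < i" if "j \<le> h" for j
      using d[of j i] dle[of i j] that \<open>i \<le> h\<close> by (cases "j < i") auto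
    then have "{x \<in> d ` {..h}. x < d i} = d ` {..<i}"
      using that by auto
    moreover have "inj_on d {..<i}" using dinj that by (auto intro: inj_on_subset)
    ultimately show ?thesis by (simp add: card_image)
  qed
  have card_D: "card (d ` {..h}) = Suc h" using dinj by (simp add: card_image)
  have ebd: "d i \<le> e i" "e i < d (Suc i)" if "e \<in> ?E" "i < h" for e i
    using that by (auto simp: PiE_def Pi_def)
  have emono: "e i < e j" if "e \<in> ?E" "i < j" "j < h" for e i j
    using ebd[OF that(1), of i] ebd[OF that(1), of j] dle[of "Suc i" j] that by auto
  have einj: "inj_on e {..<h}" if "e \<in> ?E" for e
    by (rule inj_onI) (metis lessThan_iff emono[OF that] less_irrefl linorder_neqE_nat)
  show ?thesis
  proof (rule bij_betw_imageI)
    show "inj_on ?F ?E"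
    proof (rule inj_onI)
      fix e f assume ef: "e \<in> ?E" "f \<in> ?E" "e ` {..<h} = f ` {..<h}"
      show "e = f"
      proof (rule PiE_ext[OF ef(1,2)])
        fix i assume "i \<in> {..<h}"
        then have i: "i < h" by simp
        then have "e i \<in> f ` {..<h}" using ef(3) by blast
        then obtain j where j: "j < h" "e i = f j" by auto
        have "i = j"
        proof (rule ccontr)
          assume "i \<noteq> j"
          then consider "i < j" | "j < i" by linarith
          then show False
            using ebd[OF ef(1) i] ebd[OF ef(2) j(1)] j i dle[of "Suc i" j] dle[of "Suc j" i]
            by cases auto
        qed
        then show "e i = f i" using j by simp
      qed
    qed
    show "?F ` ?E = ?S"
    proof (intro equalityI subsetI)
      fix D' assume "D' \<in> ?F ` ?E"
      then obtain e where e: "e \<in> ?E" "D' = e ` {..<h}" by auto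
      have cD': "card D' = h" using einj[OF e(1)] e(2) by (simp add: card_image)
      have "card {x \<in> D'. x < d i} = i" if i: "i \<le> h" for i
      proof -
        have "e j < d i \<longleftrightarrow> j < i" if "j < h" for j
          using ebd[OF e(1) that] dle[of i j] dle[of "Suc j" i] i that by (cases "j < i") auto
        then have "{x \<in> D'. x < d i} = e ` {..<i}" using e(2) i by auto
        moreover have "inj_on e {..<i}" using einj[OF e(1)] i by (auto intro: inj_on_subset)
        ultimately show ?thesis by (simp add: card_image)
      qed
      then have "interlace (d ` {..h}) D'"
        unfolding interlace_def excess_def using card_d cD' card_D by auto
      then show "D' \<in> ?S" using e by simp
    next
      fix D' assume "D' \<in> ?S"
      then have fin: "finite D'" and il: "interlace (d ` {..h}) D'" by auto
      have cD': "card D' = h" using il card_D by (simp add: interlace_def)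
      have c: "card {x \<in> D'. x < d i} = i" if "i \<le> h" for i
        using il card_d[OF that] that by (auto simp: interlace_def excess_def)
      have "\<exists>x. D' \<inter> {d i..<d (Suc i)} = {x}" if i: "i < h" for i
      proof -
        have "D' \<inter> {d i..<d (Suc i)} = {x \<in> D'. x < d (Suc i)} - {x \<in> D'. x < d i}" by auto
        also have "card \<dots> = Suc i - i"
          using c[of i] c[of "Suc i"] i fin d[of i "Suc i"] by (subst card_Diff_subset) auto
        finally show ?thesis by (auto simp: card_1_singleton_iff)
      qed
      then obtain g where g: "\<And>i. i < h \<Longrightarrow> D' \<inter> {d i..<d (Suc i)} = {g i}" by metis
      define e where "e = restrict g {..<h}"
      have gin: "g i \<in> D' \<and> g i \<in> {d i..<d (Suc i)}" if "i < h" for i using g[OF that] by auto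
      have eE: "e \<in> ?E" using gin by (auto simp: e_def)
      have "e ` {..<h} \<subseteq> D'" using gin by (auto simp: e_def)
      moreover have "card (e ` {..<h}) = card D'" using einj[OF eE] cD' by (simp add: card_image)
      ultimately have "e ` {..<h} = D'" using fin by (intro card_subset_eq)
      then show "D' \<in> ?F ` ?E" using eE by blast
    qed
  qed
qed

text \<open>
  \<open>v\<close> is the level of the bottom side, \<open>n\<close> its length, and \<open>h\<close> the height.
\<close>

definition trapezoid :: "int \<Rightarrow> int \<Rightarrow> nat \<Rightarrow> int set \<Rightarrow> tri set" where
  "trapezoid v n h D = {t. case t of
       Up u w \<Rightarrow> v \<le> w \<and> w < v + int h \<and> 0 \<le> u \<and> u + w < n + v \<and> \<not> (w = v \<and> u \<in> D)
     | Down u w \<Rightarrow> v \<le> w \<and> w < v + int h \<and> 0 \<le> u \<and> u + w + 1 < n + v}"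

lemma Up_in_trapezoid [simp]:
    "Up u w \<in> trapezoid v n h D \<longleftrightarrow> v \<le> w \<and> w < v + int h \<and> 0 \<le> u \<and> u + w < n + v \<and> \<not> (w = v \<and> u \<in> D)"
  and Down_in_trapezoid [simp]:
    "Down u w \<in> trapezoid v n h D \<longleftrightarrow> v \<le> w \<and> w < v + int h \<and> 0 \<le> u \<and> u + w + 1 < n + v"
  by (auto simp: trapezoid_def)

lemma finite_trapezoid: "finite (trapezoid v n h D)"
proof (rule finite_subset)
  show "trapezoid v n h D \<subseteq> (\<lambda>(u, w). Up u w) ` ({0..n} \<times> {v..v + int h}) \<union> (\<lambda>(u, w). Down u w) ` ({0..n} \<times> {v..v + int h})"
  proof
    fix t assume "t \<in> trapezoid v n h D"
    then show "t \<in> (\<lambda>(u, w). Up u w) ` ({0..n} \<times> {v..v + int h}) \<union> (\<lambda>(u, w). Down u w) ` ({0..n} \<times> {v..v + int h})"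
      by (cases t) (auto simp: image_iff)
  qed
qed auto

lemma finite_row: "finite U \<Longrightarrow> finite W \<Longrightarrow> finite (tri_row v U W)"
  by (simp add: tri_row_def)

text \<open>The lozenges that cross the line above the bottom row take down faces from this row and
  leave dents in the trapezoid above. The row itself has one tiling if the two dent sets interlace
  and none otherwise.\<close>

lemma card_tilings_trapezoid_Suc:
  assumes D: "D \<subseteq> {0..<n}" and n: "n \<ge> 1"
  shows "card (tilings (trapezoid v n (Suc h) D))
    = (\<Sum>D' | D' \<subseteq> (if h = 0 then {} else {0..<n - 1}) \<and> interlace D D'. card (tilings (trapezoid (v + 1) (n - 1) h D')))"
proof -
  let ?A = "tri_row v ({0..<n} - D) {0..<n - 1}" and ?B = "trapezoid (v + 1) (n - 1) h {}"
  \<comment> \<open>For \<open>h = 0\<close> nothing lies above the row, so no lozenge may leave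
    it.\<close>
  let ?I = "if h = 0 then {} else {0..<n - 1}"
  let ?cr = "\<lambda>u. {Up u (v + 1), Down u v}"
  have AB: "trapezoid v n (Suc h) D = ?A \<union> ?B"
  proof (rule Set.set_eqI)
    fix t show "t \<in> trapezoid v n (Suc h) D \<longleftrightarrow> t \<in> ?A \<union> ?B"
      by (cases t) auto
  qed
  interpret cut ?A ?B ?cr ?I
  proof
    show "?A \<inter> ?B = {}"
    proof (rule Int_emptyI)
      fix t assume "t \<in> ?A" "t \<in> ?B" then show False by (cases t) auto
    qed
    show "finite ?A" "finite ?B" by (auto intro: finite_row finite_trapezoid)
    show "finite ?I" by simp
    show "?cr i \<inter> ?cr j = {}" if "i \<noteq> j" for i j using that by auto
    show "lozenge (?cr i)" for i
    proof -
      have "?cr i = {Up i (v + 1), Down i (v + 1 - 1)}" by simp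
      then show ?thesis unfolding lozenge_iff by blast
    qed
    show "?cr i \<subseteq> ?A \<union> ?B \<and> \<not> ?cr i \<subseteq> ?A \<and> \<not> ?cr i \<subseteq> ?B" if "i \<in> ?I" for i
      using that by (auto split: if_splits)
    show "L \<in> ?cr ` ?I" if L: "lozenge L" "L \<subseteq> ?A \<union> ?B" "\<not> L \<subseteq> ?A" "\<not> L \<subseteq> ?B" for L
    proof -
      from L(1) obtain u w where
        "L = {Up u w, Down u w} \<or> L = {Up u w, Down (u - 1) w} \<or> L = {Up u w, Down u (w - 1)}"
        unfolding lozenge_iff by blast
      then have "L = {Up u w, Down u (w - 1)} \<and> w = v + 1"
        using L(2-4) by (elim disjE) auto
      then have Lu: "L = ?cr u" by simp
      then have "u \<in> ?I" using L(2) by auto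
      then show ?thesis using Lu by blast
    qed
  qed
  have A: "?A - \<Union>(?cr ` S) = tri_row v ({0..<n} - D) ({0..<n - 1} - S)" for S
  proof (rule Set.set_eqI)
    fix t show "t \<in> ?A - \<Union>(?cr ` S) \<longleftrightarrow> t \<in> tri_row v ({0..<n} - D) ({0..<n - 1} - S)"
      by (cases t) auto
  qed
  have B: "?B - \<Union>(?cr ` S) = trapezoid (v + 1) (n - 1) h S" for S
  proof (rule Set.set_eqI)
    fix t show "t \<in> ?B - \<Union>(?cr ` S) \<longleftrightarrow> t \<in> trapezoid (v + 1) (n - 1) h S"
      by (cases t) auto
  qed
  have "card (tilings (trapezoid v n (Suc h) D))
      = (\<Sum>S\<in>Pow ?I. card (tilings (tri_row v ({0..<n} - D) ({0..<n - 1} - S))) * card (tilings (trapezoid (v + 1) (n - 1) h S)))"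
    unfolding AB card_tilings_cut A B ..
  also have "\<dots> = (\<Sum>S\<in>Pow ?I. if interlace D S then card (tilings (trapezoid (v + 1) (n - 1) h S)) else 0)"
  proof (rule sum.cong[OF refl])
    fix S assume "S \<in> Pow ?I"
    then have "S \<subseteq> {0..<n - 1}" by (auto split: if_splits)
    from card_tilings_row[OF D this n]
    show "card (tilings (tri_row v ({0..<n} - D) ({0..<n - 1} - S))) * card (tilings (trapezoid (v + 1) (n - 1) h S))
        = (if interlace D S then card (tilings (trapezoid (v + 1) (n - 1) h S)) else 0)"
      by simp
  qed
  also have "\<dots> = (\<Sum>D' | D' \<subseteq> ?I \<and> interlace D D'. card (tilings (trapezoid (v + 1) (n - 1) h D')))"
    by (subst sum.inter_filter[symmetric]) (auto intro!: sum.cong)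
  finally show ?thesis .
qed

lemma card_tilings_trapezoid:
  assumes "\<And>i j. i < j \<Longrightarrow> j < h \<Longrightarrow> d i < d j" and "d ` {..<h} \<subseteq> {0..<n}"
  shows "real (card (tilings (trapezoid v n h (d ` {..<h})))) = vandermonde_prod d h / hyperfact h"
  using assms
proof (induction h arbitrary: v n d)
  case 0
  have "trapezoid v n 0 {} = {}"
  proof (rule Set.set_eqI)
    fix t show "t \<in> trapezoid v n 0 {} \<longleftrightarrow> t \<in> {}" by (cases t) auto
  qed
  then show ?case by (simp add: tilings_empty vandermonde_prod_def hyperfact_def)
next
  case (Suc h)
  let ?E = "PiE {..<h} (\<lambda>i. {d i..<d (Suc i)})"
  have mono: "\<And>i j. i < j \<Longrightarrow> j \<le> h \<Longrightarrow> d i < d j" using Suc.prems(1) by auto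
  have range: "0 \<le> d i \<and> d i < n" if "i \<le> h" for i
  proof -
    have "d i \<in> d ` {..<Suc h}" using that by auto
    then show ?thesis using Suc.prems(2) by auto
  qed
  have n: "n \<ge> 1" using range[of 0] by auto
  have dle: "d i \<le> d j" if "i \<le> j" "j \<le> h" for i j
    using mono[of i j] that by (cases "i = j") auto
  have ebd: "d i \<le> e i" "e i < d (Suc i)" if "e \<in> ?E" "i < h" for e i
    using that by (auto simp: PiE_def Pi_def)
  have bij: "bij_betw (\<lambda>e. e ` {..<h}) ?E {D'. finite D' \<and> interlace (d ` {..h}) D'}"
    by (rule bij_betw_interlacing) (rule mono)
  have sub: "e ` {..<h} \<subseteq> {0..<n - 1}" if e: "e \<in> ?E" for e
  proof
    fix u assume "u \<in> e ` {..<h}"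
    then obtain i where i: "i < h" "u = e i" by auto
    then show "u \<in> {0..<n - 1}" using ebd[OF e i(1)] range[of i] range[of "Suc i"] by auto
  qed
  \<comment> \<open>Interlacing confines \<open>D'\<close> between the first and the last dent, so
    the range condition is automatic; for \<open>h = 0\<close> both sides contain just the empty
    set.\<close>
  have sets: "{D'. D' \<subseteq> (if h = 0 then {} else {0..<n - 1}) \<and> interlace (d ` {..h}) D'}
      = {D'. finite D' \<and> interlace (d ` {..h}) D'}" (is "?L = ?R")
  proof (intro equalityI subsetI)
    fix D' assume "D' \<in> ?L" then show "D' \<in> ?R"
      by (auto intro: finite_subset split: if_splits)
  next
    fix D' assume D': "D' \<in> ?R"
    then have "D' \<in> (\<lambda>e. e ` {..<h}) ` ?E" using bij_betw_imp_surj_on[OF bij] by simp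
    then obtain e where "e \<in> ?E" "D' = e ` {..<h}" by blast
    then show "D' \<in> ?L" using D' sub[of e] by auto
  qed
  have D: "d ` {..h} \<subseteq> {0..<n}" using range by auto
  have "card (tilings (trapezoid v n (Suc h) (d ` {..<Suc h})))
      = (\<Sum>D' | finite D' \<and> interlace (d ` {..h}) D'. card (tilings (trapezoid (v + 1) (n - 1) h D')))"
    unfolding lessThan_Suc_atMost card_tilings_trapezoid_Suc[OF D n] sets ..
  also have "\<dots> = (\<Sum>e\<in>?E. card (tilings (trapezoid (v + 1) (n - 1) h (e ` {..<h}))))"
    by (rule sum.reindex_bij_betw[OF bij, symmetric])
  finally have "real (card (tilings (trapezoid v n (Suc h) (d ` {..<Suc h}))))
      = (\<Sum>e\<in>?E. real (card (tilings (trapezoid (v + 1) (n - 1) h (e ` {..<h})))))" by simp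
  also have "\<dots> = (\<Sum>e\<in>?E. vandermonde_prod e h / hyperfact h)"
  proof (rule sum.cong[OF refl])
    fix e assume e: "e \<in> ?E"
    have "e i < e j" if "i < j" "j < h" for i j
      using ebd[OF e, of i] ebd[OF e, of j] dle[of "Suc i" j] that by auto
    then show "real (card (tilings (trapezoid (v + 1) (n - 1) h (e ` {..<h})))) = vandermonde_prod e h / hyperfact h"
      using sub[OF e] by (intro Suc.IH)
  qed
  also have "\<dots> = vandermonde_prod d (Suc h) / hyperfact (Suc h)"
    by (rule sum_vandermonde_prod_interlacing) (simp add: mono less_imp_le)
  finally show ?case .
qed

section \<open>Vandermonde products of finite sets\<close>

definition vandermonde_set :: "int set \<Rightarrow> real" where
  "vandermonde_set D = (\<Prod>j\<in>D. \<Prod>i\<in>{i \<in> D. i < j}. real_of_int (j - i))"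


lemma hyperfact_pos [simp]: "hyperfact n > 0"
  by (auto simp: hyperfact_def intro!: prod_pos)

lemma hyperfact_nonzero [simp]: "hyperfact n \<noteq> 0"
  using hyperfact_pos[of n] by linarith

lemma hyperfact_0 [simp]: "hyperfact 0 = 1"
  by (simp add: hyperfact_def)

lemma vandermonde_set_pos: "vandermonde_set D > 0"
  by (auto simp: vandermonde_set_def intro!: prod_pos)

text \<open>A pair lies in \<open>P\<close>, in \<open>Q\<close>, or across; the absolute value
  covers both orders of a pair across.\<close>

lemma vandermonde_set_union:
  assumes fin: "finite P" "finite Q" and disj: "P \<inter> Q = {}"
  shows "vandermonde_set (P \<union> Q) = vandermonde_set P * vandermonde_set Q * (\<Prod>e\<in>P. \<Prod>w\<in>Q. real_of_int \<bar>w - e\<bar>)"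
proof -
  have filt: "(\<Prod>i\<in>{i \<in> A. i < j}. real_of_int (j - i)) = (\<Prod>i\<in>A. if i < j then real_of_int (j - i) else 1)"
    if "finite A" for A and j :: int
    using that by (rule prod.inter_filter)
  have split: "(\<Prod>i\<in>{i \<in> P \<union> Q. i < j}. real_of_int (j - i))
      = (\<Prod>i\<in>{i \<in> P. i < j}. real_of_int (j - i)) * (\<Prod>i\<in>{i \<in> Q. i < j}. real_of_int (j - i))" for j
  proof -
    have "{i \<in> P \<union> Q. i < j} = {i \<in> P. i < j} \<union> {i \<in> Q. i < j}" by auto
    then show ?thesis using fin disj by (simp add: prod.union_disjoint disjoint_iff)
  qed
  have "vandermonde_set (P \<union> Q) = (vandermonde_set P * (\<Prod>j\<in>P. \<Prod>i\<in>{i \<in> Q. i < j}. real_of_int (j - i)))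
      * ((\<Prod>j\<in>Q. \<Prod>i\<in>{i \<in> P. i < j}. real_of_int (j - i)) * vandermonde_set Q)"
    unfolding vandermonde_set_def[of "P \<union> Q"] split using fin disj
    by (simp add: prod.union_disjoint prod.distrib vandermonde_set_def)
  moreover have "(\<Prod>j\<in>P. \<Prod>i\<in>{i \<in> Q. i < j}. real_of_int (j - i)) * (\<Prod>j\<in>Q. \<Prod>i\<in>{i \<in> P. i < j}. real_of_int (j - i))
      = (\<Prod>e\<in>P. \<Prod>w\<in>Q. real_of_int \<bar>w - e\<bar>)"
  proof -
    have "(\<Prod>j\<in>Q. \<Prod>i\<in>{i \<in> P. i < j}. real_of_int (j - i)) = (\<Prod>e\<in>P. \<Prod>w\<in>Q. if e < w then real_of_int (w - e) else 1)"
      unfolding filt[OF fin(1)] by (rule prod.swap)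
    then show ?thesis
      unfolding filt[OF fin(2)] using disj
      by (auto simp: prod.distrib [symmetric] intro!: prod.cong)
  qed
  ultimately show ?thesis by (simp add: mult_ac)
qed

lemma vandermonde_set_shift: "vandermonde_set ((+) k ` D) = vandermonde_set D"
proof -
  have inj: "inj_on ((+) k) A" for A :: "int set" by simp
  have "{i \<in> (+) k ` D. i < k + j} = (+) k ` {i \<in> D. i < j}" for j by auto
  then show ?thesis
    unfolding vandermonde_set_def prod.reindex[OF inj] by (simp add: prod.reindex)
qed

lemma prod_fact_interval:
  "(\<Prod>e\<in>{int c..<int (c + b)}. fact (nat e)) = hyperfact (c + b) / hyperfact c"
proof -
  have "(\<Prod>e\<in>{int c..<int (c + b)}. (fact (nat e) :: real)) = (\<Prod>i\<in>{c..<c + b}. fact i)"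
    by (rule prod.reindex_bij_witness[of _ int nat]) auto
  moreover have "hyperfact (c + b) = hyperfact c * (\<Prod>i\<in>{c..<c + b}. fact i)"
    unfolding hyperfact_def by (metis le_add1 lessThan_atLeast0 prod.atLeastLessThan_concat zero_le)
  ultimately show ?thesis by simp
qed

lemma vandermonde_set_interval: "vandermonde_set {c..<c + int p} = hyperfact p"
proof (induction p)
  case (Suc p)
  have "{c..<c + int (Suc p)} = {c..<c + int p} \<union> {c + int p}" by auto
  moreover have "(\<Prod>e\<in>{c..<c + int p}. real_of_int \<bar>c + int p - e\<bar>) = fact p"
  proof -
    have "(\<Prod>e\<in>{c..<c + int p}. real_of_int \<bar>c + int p - e\<bar>) = (\<Prod>i\<in>{1..p}. real i)"
      by (rule prod.reindex_bij_witness[of _ "\<lambda>i. c + int p - int i" "\<lambda>e. nat (c + int p - e)"]) auto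
    then show ?thesis by (simp add: fact_prod)
  qed
  moreover have "vandermonde_set {c + int p} = 1"
  proof -
    have "{i. i = c + int p \<and> i < c + int p} = {}" by auto
    note e = this
    show ?thesis by (simp add: vandermonde_set_def e)
  qed
  ultimately show ?case
    using Suc vandermonde_set_union[of "{c..<c + int p}" "{c + int p}"] by (simp add: hyperfact_def)
qed (simp add: vandermonde_set_def hyperfact_def)

lemma vandermonde_set_image:
  assumes d: "\<And>i j. i < j \<Longrightarrow> j < h \<Longrightarrow> d i < d j"
  shows "vandermonde_set (d ` {..<h}) = vandermonde_prod d h"
proof -
  have inj: "inj_on d {..<h}"
    by (rule inj_onI) (metis lessThan_iff d less_irrefl linorder_neqE_nat)
  have "{i \<in> d ` {..<h}. i < d j} = d ` {..<j}" if "j < h" for j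
  proof -
    have "d i < d j \<longleftrightarrow> i < j" if "i < h" for i
      using d[of i j] d[of j i] that \<open>j < h\<close> by (cases i j rule: linorder_cases) auto
    then show ?thesis using that by auto
  qed
  then have "(\<Prod>i\<in>{i \<in> d ` {..<h}. i < d j}. real_of_int (d j - i)) = (\<Prod>i<j. real_of_int (d j - d i))"
    if "j < h" for j
    using prod.reindex[of d "{..<j}"] inj_on_subset[OF inj, of "{..<j}"] that by (simp add: subset_eq)
  then show ?thesis
    unfolding vandermonde_set_def vandermonde_prod_def by (simp add: prod.reindex[OF inj])
qed

lemma card_tilings_trapezoid_set:
  assumes "D \<subseteq> {0..<n}" and "card D = h"
  shows "real (card (tilings (trapezoid v n h D))) = vandermonde_set D / hyperfact h"
proof -
  have fin: "finite D" using assms(1) by (auto intro: finite_subset)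
  define d where "d = (\<lambda>i. sorted_list_of_set D ! i)"
  have len: "length (sorted_list_of_set D) = h" using assms(2) by simp
  have D: "d ` {..<h} = D"
    using fin len unfolding d_def by (metis lessThan_atLeast0 list.set_map map_nth set_sorted_list_of_set set_upt)
  have mono: "d i < d j" if "i < j" "j < h" for i j
    using strict_sorted_list_of_set[of D] len that unfolding d_def
    by (simp add: sorted_wrt_nth_less)
  show ?thesis
    using card_tilings_trapezoid[of h d n v] vandermonde_set_image[of h d] mono D assms(1) by simp
qed

text \<open>Sending \<open>Down u w\<close> to \<open>Up (u + 1) w\<close> identifies the down faces
  with the up faces, dents included, other than the leftmost one of each of the \<open>h\<close>
  rows. So up faces plus dents equal down faces plus \<open>h\<close>, and a balanced trapezoid has
  \<open>h\<close> dents. By \<open>int h \<le> n\<close> no row is empty.\<close>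

lemma tilings_trapezoid_unbalanced:
  assumes D: "D \<subseteq> {0..<n}" and n: "int h \<le> n" and h: "h \<ge> 1" and neq: "card D \<noteq> h"
  shows "tilings (trapezoid v n h D) = {}"
proof (rule equals0I)
  fix T assume T: "T \<in> tilings (trapezoid v n h D)"
  let ?R = "trapezoid v n h D"
  let ?sh = "\<lambda>t. case t of Down u w \<Rightarrow> Up (u + 1) w | t \<Rightarrow> t"
  have finD: "finite D" using D by (auto intro: finite_subset)
  let ?X = "{t \<in> ?R. is_up t}" and ?Y = "(\<lambda>u. Up u v) ` D" and ?Z = "?sh ` {t \<in> ?R. \<not> is_up t}"
    and ?V = "Up 0 ` {v..<v + int h}"
  have "?X \<union> ?Y = ?Z \<union> ?V"
  proof (rule Set.set_eqI)
    fix t show "t \<in> ?X \<union> ?Y \<longleftrightarrow> t \<in> ?Z \<union> ?V"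
    proof (cases t)
      case (Up u w)
      have "t \<in> ?Z \<longleftrightarrow> v \<le> w \<and> w < v + int h \<and> 1 \<le> u \<and> u + w < n + v"
      proof
        assume "t \<in> ?Z"
        then obtain s where "s \<in> ?R" "\<not> is_up s" "t = ?sh s" by auto
        then show "v \<le> w \<and> w < v + int h \<and> 1 \<le> u \<and> u + w < n + v" using Up by (cases s) auto
      next
        assume "v \<le> w \<and> w < v + int h \<and> 1 \<le> u \<and> u + w < n + v"
        then have "Down (u - 1) w \<in> {t \<in> ?R. \<not> is_up t}" by auto
        then have "?sh (Down (u - 1) w) \<in> ?Z" by (rule imageI)
        then show "t \<in> ?Z" using Up by simp
      qed
      then show ?thesis using D n h Up by auto
    next
      case (Down u w)
      have "t \<notin> ?Z"
      proof
        assume "t \<in> ?Z"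
        then obtain s where "\<not> is_up s" "t = ?sh s" by auto
        then show False using Down by (cases s) auto
      qed
      then show ?thesis using Down by auto
    qed
  qed
  moreover have "card (?X \<union> ?Y) = card ?X + card D"
  proof -
    have "?X \<inter> ?Y = {}" by auto
    moreover have "card ?Y = card D" by (rule card_image) (simp add: inj_on_def)
    ultimately show ?thesis using finD finite_trapezoid by (subst card_Un_disjoint) auto
  qed
  moreover have "card (?Z \<union> ?V) = card {t \<in> ?R. \<not> is_up t} + h"
  proof -
    have "t \<notin> ?V" if "t \<in> ?Z" for t
    proof -
      from that obtain s where "s \<in> ?R" "\<not> is_up s" "t = ?sh s" by auto
      then show ?thesis by (cases s) auto
    qed
    then have "?Z \<inter> ?V = {}" by blast
    moreover have "inj_on ?sh {t \<in> ?R. \<not> is_up t}"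
    proof (rule inj_onI)
      fix s t assume "s \<in> {t \<in> ?R. \<not> is_up t}" "t \<in> {t \<in> ?R. \<not> is_up t}" "?sh s = ?sh t"
      then show "s = t" by (cases s; cases t) auto
    qed
    moreover have "card ?V = h" by (subst card_image) (auto simp: inj_on_def)
    ultimately show ?thesis using finite_trapezoid by (subst card_Un_disjoint) (auto simp: card_image)
  qed
  ultimately show False using tiling_balanced[OF T finite_trapezoid] neq by simp
qed

section \<open>Forced lozenges over runs of dents\<close>

lemma Up_in_up_triangle [simp]:
    "Up i j \<in> up_triangle (u, v) b \<longleftrightarrow> u \<le> i \<and> v \<le> j \<and> i + j + 1 \<le> u + v + int b"
  and Down_in_up_triangle [simp]:
    "Down i j \<in> up_triangle (u, v) b \<longleftrightarrow> u \<le> i \<and> v \<le> j \<and> i + j + 2 \<le> u + v + int b"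
  and Up_in_down_triangle [simp]:
    "Up i j \<in> down_triangle (u, v) b \<longleftrightarrow> i + 1 \<le> u + int b \<and> j + 1 \<le> v \<and> u + v \<le> i + j"
  and Down_in_down_triangle [simp]:
    "Down i j \<in> down_triangle (u, v) b \<longleftrightarrow> i + 1 \<le> u + int b \<and> j + 1 \<le> v \<and> u + v \<le> i + j + 1"
  by (auto simp: up_triangle_def down_triangle_def faces_def)

text \<open>A down face between two adjacent dents has lost both neighbours in its row and must join
  the up face above it. These up faces are then used, which forces the next level, and so on to the
  apex. The forced lozenges fill the triangle except for its bottom up faces, and these are the
  dents.\<close>

lemma card_tilings_trapezoid_triangles:
  assumes D: "D \<subseteq> {0..<n}" and J: "\<And>l b. (l, b) \<in> J \<Longrightarrow> {l..<l + int b} \<subseteq> D \<and> b \<le> h"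
  shows "card (tilings (trapezoid v n h D - (\<Union>(l, b)\<in>J. up_triangle (l, v) b))) = card (tilings (trapezoid v n h D))"
proof -
  let ?R = "trapezoid v n h D" and ?\<Delta> = "\<Union>(l, b)\<in>J. up_triangle (l, v) b"
  let ?c = "\<lambda>u w. {Up u (w + 1), Down u w}"
  define F where "F = {?c u w |u w. Down u w \<in> ?\<Delta>}"
  have loz: "lozenge (?c u w)" for u w
  proof -
    have "?c u w = {Up u (w + 1), Down u (w + 1 - 1)}" by simp
    then show ?thesis unfolding lozenge_iff by blast
  qed
  have sub: "?c u w \<subseteq> ?R" if "Down u w \<in> ?\<Delta>" for u w
  proof -
    obtain l b where lb: "(l, b) \<in> J" "l \<le> u" "v \<le> w" "u + w + 2 \<le> l + v + int b" using \<open>Down u w \<in> ?\<Delta>\<close> by auto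
    have "l \<in> D" "l + int b - 1 \<in> D" using J[OF lb(1)] lb by auto
    then have "0 \<le> l" "l + int b \<le> n" using D by auto
    then show ?thesis using lb J[OF lb(1)] by auto
  qed
  have UF: "t \<in> \<Union>F \<longleftrightarrow> (\<exists>u w. Down u w \<in> ?\<Delta> \<and> t \<in> ?c u w)" for t
    unfolding F_def by blast
  have DownUF: "Down u w \<in> \<Union>F \<longleftrightarrow> Down u w \<in> ?\<Delta>" for u w unfolding UF by auto
  have UpUF: "Up u w \<in> \<Union>F \<longleftrightarrow> Down u (w - 1) \<in> ?\<Delta>" for u w
  proof
    assume "Up u w \<in> \<Union>F"
    then show "Down u (w - 1) \<in> ?\<Delta>" unfolding UF by force
  next
    assume "Down u (w - 1) \<in> ?\<Delta>"
    moreover have "Up u w \<in> ?c u (w - 1)" by simp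
    ultimately show "Up u w \<in> \<Union>F" unfolding UF by blast
  qed
  have forced: "F \<subseteq> T" if T: "T \<in> tilings ?R" for T
  proof -
    note TD = tilingsD[OF T]
    have step: "?c u w \<in> T" if \<Delta>: "Down u w \<in> ?\<Delta>" and noUp: "\<And>L. L \<in> T \<Longrightarrow> Down u w \<in> L \<Longrightarrow> Up u w \<notin> L \<and> Up (u + 1) w \<notin> L" for u w
    proof -
      obtain L where L: "L \<in> T" "Down u w \<in> L" using TD(3)[of "Down u w"] sub[OF \<Delta>] by auto
      obtain u' w' where
        "L = {Up u' w', Down u' w'} \<or> L = {Up u' w', Down (u' - 1) w'} \<or> L = {Up u' w', Down u' (w' - 1)}"
        using TD(1)[OF L(1)] unfolding lozenge_iff by blast
      then have "L = ?c u w" using L(2) noUp[OF L] by (elim disjE) auto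
      then show ?thesis using L by simp
    qed
    have "?c u (v + int k) \<in> T" if "Down u (v + int k) \<in> ?\<Delta>" for u k
      using that
    proof (induction k arbitrary: u)
      case (0 u)
      obtain l b where lb: "(l, b) \<in> J" "l \<le> u" "u + 2 \<le> l + int b" using 0 by auto
      have "u \<in> D" "u + 1 \<in> D" using J[OF lb(1)] lb by auto
      then have no: "Up u v \<notin> ?R" "Up (u + 1) v \<notin> ?R" by auto
      show ?case
      proof (rule step[OF 0])
        fix L assume "L \<in> T"
        then show "Up u (v + int 0) \<notin> L \<and> Up (u + 1) (v + int 0) \<notin> L"
          using TD(2)[of L] no by auto
      qed
    next
      case (Suc k u)
      obtain l b where lb: "(l, b) \<in> J" "l \<le> u" "u + (v + int (Suc k)) + 2 \<le> l + v + int b"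
        using Suc.prems by auto
      have "Down u (v + int k) \<in> up_triangle (l, v) b" "Down (u + 1) (v + int k) \<in> up_triangle (l, v) b"
        using lb by auto
      then have \<Delta>: "Down u (v + int k) \<in> ?\<Delta>" "Down (u + 1) (v + int k) \<in> ?\<Delta>" using lb(1) by blast+
      have IH: "?c u (v + int k) \<in> T" "?c (u + 1) (v + int k) \<in> T"
        by (rule Suc.IH[OF \<Delta>(1)], rule Suc.IH[OF \<Delta>(2)])
      show ?case
      proof (rule step[OF Suc.prems], intro conjI notI)
        fix L assume L: "L \<in> T" "Down u (v + int (Suc k)) \<in> L"
        { assume "Up u (v + int (Suc k)) \<in> L"
          then have "L = ?c u (v + int k)" using TD(4)[OF L(1) IH(1), of "Up u (v + int (Suc k))"] by (simp add: ac_simps)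
          then show False using L(2) by simp }
        { assume "Up (u + 1) (v + int (Suc k)) \<in> L"
          then have "L = ?c (u + 1) (v + int k)" using TD(4)[OF L(1) IH(2), of "Up (u + 1) (v + int (Suc k))"] by (simp add: ac_simps)
          then show False using L(2) by simp }
      qed
    qed
    note all = this
    show ?thesis
    proof
      fix L assume "L \<in> F"
      then obtain u w where uw: "L = ?c u w" "Down u w \<in> ?\<Delta>" unfolding F_def by blast
      then have "v \<le> w" by auto
      then show "L \<in> T" using all[of u "nat (w - v)"] uw by simp
    qed
  qed
  have "F \<in> tilings (\<Union>F)"
  proof (rule tilingsI)
    fix L assume L: "L \<in> F"
    then obtain u w where "L = ?c u w" unfolding F_def by blast
    then show "lozenge L" using loz by simp
    show "L \<subseteq> \<Union>F" using L by blast
  next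
    fix L L' t assume "L \<in> F" "L' \<in> F" "t \<in> L" "t \<in> L'"
    then show "L = L'" unfolding F_def by auto
  qed auto
  moreover have "\<Union>F \<subseteq> ?R" using sub unfolding F_def by blast
  ultimately have "card (tilings ?R) = card (tilings (?R - \<Union>F))"
    using forced by (intro tilings_forced)
  moreover have "?R - \<Union>F = ?R - ?\<Delta>"
  proof (rule Set.set_eqI)
    fix t show "t \<in> ?R - \<Union>F \<longleftrightarrow> t \<in> ?R - ?\<Delta>"
    proof (cases t)
      case (Down u w)
      then show ?thesis using DownUF by simp
    next
      case (Up u w)
      have "Down u (w - 1) \<in> ?\<Delta> \<longleftrightarrow> Up u w \<in> ?\<Delta>" if "Up u w \<in> ?R"
      proof
        assume "Down u (w - 1) \<in> ?\<Delta>" then show "Up u w \<in> ?\<Delta>" by fastforce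
      next
        assume "Up u w \<in> ?\<Delta>"
        then obtain l b where lb: "(l, b) \<in> J" "l \<le> u" "v \<le> w" "u + w + 1 \<le> l + v + int b" by auto
        have "w \<noteq> v"
        proof
          assume "w = v"
          then have "u \<in> D" using lb J[OF lb(1)] by auto
          then show False using that \<open>w = v\<close> by simp
        qed
        then have "Down u (w - 1) \<in> up_triangle (l, v) b" using lb by simp
        then show "Down u (w - 1) \<in> ?\<Delta>" using lb(1) by blast
      qed
      then show ?thesis unfolding Up Diff_iff UpUF by blast
    qed
  qed
  ultimately show ?thesis by simp
qed

section \<open>Cells of a fern\<close>

text \<open>
  The unit segments covered by the lobes that point up; the flag is the one of \<open>fern_from\<close>.
\<close>

fun cells :: "bool \<Rightarrow> int \<Rightarrow> nat list \<Rightarrow> int set" where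
  "cells up c [] = {}"
| "cells up c (b # bs) = (if up then {c..<c + int b} else {}) \<union> cells (\<not> up) (c + int b) bs"

lemma cells_subset: "cells up c bs \<subseteq> {c..<c + int (sum_list bs)}"
proof (induction bs arbitrary: up c)
  case (Cons b bs)
  show ?case using Cons.IH[of "\<not> up" "c + int b"] by auto
qed simp

lemma cells_bounds: "t \<in> cells up c bs \<Longrightarrow> c \<le> t \<and> t < c + int (sum_list bs)"
  using cells_subset[of up c bs] by auto

lemma finite_cells [simp]: "finite (cells up c bs)"
  by (rule finite_subset[OF cells_subset]) simp

lemma cells_partition:
  "cells up c bs \<union> cells (\<not> up) c bs = {c..<c + int (sum_list bs)}" "cells up c bs \<inter> cells (\<not> up) c bs = {}"
proof -
  have "cells up c bs \<union> cells (\<not> up) c bs = {c..<c + int (sum_list bs)} \<and> cells up c bs \<inter> cells (\<not> up) c bs = {}"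
  proof (induction bs arbitrary: up c)
    case (Cons b bs)
    show ?case
      using Cons.IH[of up "c + int b"] cells_subset[of up "c + int b" bs] cells_subset[of "\<not> up" "c + int b" bs]
      by (cases up) (auto simp: add.assoc)
  qed simp
  then show "cells up c bs \<union> cells (\<not> up) c bs = {c..<c + int (sum_list bs)}" "cells up c bs \<inter> cells (\<not> up) c bs = {}"
    by auto
qed

lemma cells_append:
  "cells up c (xs @ ys) = cells up c xs \<union> cells (if even (length xs) then up else \<not> up) (c + int (sum_list xs)) ys"
  by (induction xs arbitrary: up c) (auto simp: add.assoc)

lemma cells_shift: "cells up (k + c) bs = (+) k ` cells up c bs"
proof (induction bs arbitrary: up c)
  case (Cons b bs)
  have "(+) k ` {c..<c + int b} = {k + c..<k + c + int b}" by (simp add: ac_simps)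
  then show ?case using Cons.IH[of "\<not> up" "c + int b"] by (auto simp: add.assoc image_Un)
qed simp

text \<open>The leftmost lobe of the reversed fern is the last lobe of the original, which has
  orientation \<open>up\<close> exactly for odd length.\<close>

lemma cells_rev:
  "cells (if odd (length bs) then up else \<not> up) c (rev bs) = (\<lambda>t. 2 * c + int (sum_list bs) - 1 - t) ` cells up c bs"
proof (induction bs arbitrary: up)
  case (Cons b bs)
  let ?n = "int (sum_list bs)"
  have refl: "(\<lambda>t. 2 * c + (int b + ?n) - 1 - t) ` {c..<c + int b} = {c + ?n..<c + ?n + int b}"
  proof (intro equalityI subsetI)
    fix s assume "s \<in> {c + ?n..<c + ?n + int b}"
    then show "s \<in> (\<lambda>t. 2 * c + (int b + ?n) - 1 - t) ` {c..<c + int b}"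
      by (intro image_eqI[of _ _ "2 * c + (int b + ?n) - 1 - s"]) auto
  qed auto
  have "cells (\<not> up) (c + int b) bs = (+) (int b) ` cells (\<not> up) c bs"
    using cells_shift[of "\<not> up" "int b" c bs] by (simp add: add.commute)
  then have "(\<lambda>t. 2 * c + (int b + ?n) - 1 - t) ` cells (\<not> up) (c + int b) bs
      = (\<lambda>t. 2 * c + ?n - 1 - t) ` cells (\<not> up) c bs"
    by (simp add: image_image algebra_simps)
  also have "\<dots> = cells (if odd (length bs) then \<not> up else up) c (rev bs)"
    using Cons.IH[of "\<not> up"] by (simp cong: if_cong)
  finally show ?case
    using refl by (auto simp: cells_append image_Un split: if_splits)
qed simp

section \<open>Hyperfactorial products over cells and the function s\<close>

fun alternating_hyperfact :: "nat \<Rightarrow> nat list \<Rightarrow> real" where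
  "alternating_hyperfact c [] = 1"
| "alternating_hyperfact c (b # bs) = hyperfact (c + b) / alternating_hyperfact (c + b) bs"

lemma alternating_hyperfact_pos [simp]: "alternating_hyperfact c bs > 0"
  by (induction bs arbitrary: c) auto

lemma alternating_hyperfact_nonzero [simp]: "alternating_hyperfact c bs \<noteq> 0"
  using alternating_hyperfact_pos[of c bs] by linarith

text \<open>Over one lobe the factorials give the hyperfactorial of its right end over that of its
  left end, and \<open>alternating_hyperfact\<close> collects these with alternating exponents. The
  case distinction corrects the exponent at the right end of the fern when the last lobe is not
  counted. Both flags go through one induction because they swap at each lobe.\<close>

lemma prod_fact_cells:
  "(\<Prod>e\<in>cells True (int c) bs. fact (nat e))
     = alternating_hyperfact c bs / hyperfact c * (if even (length bs) then hyperfact (c + sum_list bs) else 1)"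
  "(\<Prod>e\<in>cells False (int c) bs. fact (nat e))
     = 1 / alternating_hyperfact c bs * (if odd (length bs) then hyperfact (c + sum_list bs) else 1)"
proof -
  have "(\<Prod>e\<in>cells True (int c) bs. fact (nat e))
     = alternating_hyperfact c bs / hyperfact c * (if even (length bs) then hyperfact (c + sum_list bs) else 1) \<and>
    (\<Prod>e\<in>cells False (int c) bs. fact (nat e))
     = 1 / alternating_hyperfact c bs * (if odd (length bs) then hyperfact (c + sum_list bs) else 1)"
  proof (induction bs arbitrary: c)
    case (Cons b bs)
    have disj: "{int c..<int (c + b)} \<inter> cells False (int (c + b)) bs = {}"
      using cells_subset[of False "int (c + b)" bs] by auto
    have "(\<Prod>e\<in>cells True (int c) (b # bs). (fact (nat e) :: real))
        = (\<Prod>e\<in>{int c..<int (c + b)}. fact (nat e)) * (\<Prod>e\<in>cells False (int (c + b)) bs. fact (nat e))"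
      using prod.union_disjoint[OF _ _ disj, of "\<lambda>e. fact (nat e) :: real"] by simp
    also have "\<dots> = alternating_hyperfact c (b # bs) / hyperfact c * (if even (length (b # bs)) then hyperfact (c + sum_list (b # bs)) else 1)"
      using Cons.IH[of "c + b"] unfolding prod_fact_interval by (simp add: add.assoc)
    finally show ?case using Cons.IH[of "c + b"] by (simp add: add.assoc)
  qed simp
  then show "(\<Prod>e\<in>cells True (int c) bs. fact (nat e))
     = alternating_hyperfact c bs / hyperfact c * (if even (length bs) then hyperfact (c + sum_list bs) else 1)"
  "(\<Prod>e\<in>cells False (int c) bs. fact (nat e))
     = 1 / alternating_hyperfact c bs * (if odd (length bs) then hyperfact (c + sum_list bs) else 1)" by auto
qed

text \<open>One factor per nonempty suffix: together they run over all intervals of consecutive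
  lobes, as in the first quotient of s.\<close>

fun interval_hyperfact :: "nat list \<Rightarrow> real" where
  "interval_hyperfact [] = 1"
| "interval_hyperfact (b # bs) = alternating_hyperfact 0 (b # bs) * interval_hyperfact bs"

text \<open>The induction removes an up lobe of size \<open>p\<close> and the gap after it. A
  remaining cell \<open>w\<close> has distances to the removed lobe with product w! / (w - p)!, and
  \<open>prod_fact_cells\<close> evaluates numerator and denominator, from the starting points
  \<open>p + d\<close> and \<open>d\<close>.\<close>

lemma vandermonde_set_cells: "odd (length bs) \<Longrightarrow> vandermonde_set (cells True c bs) = interval_hyperfact bs"
proof (induction bs arbitrary: c rule: induct_list012)
  case (2 p)
  then show ?case by (simp add: vandermonde_set_interval)
next
  case (3 p d bs)
  let ?P = "{0..<int p}" and ?Q = "cells True (int (p + d)) bs"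
  have len: "odd (length bs)" using 3 by simp
  have "cells True c (p # d # bs) = (+) c ` cells True 0 (p # d # bs)"
    using cells_shift[of True c 0 "p # d # bs"] by simp
  then have "vandermonde_set (cells True c (p # d # bs)) = vandermonde_set (?P \<union> ?Q)" by (simp add: vandermonde_set_shift)
  also have "\<dots> = vandermonde_set ?P * vandermonde_set ?Q * (\<Prod>w\<in>?Q. \<Prod>e\<in>?P. real_of_int \<bar>w - e\<bar>)"
  proof -
    have "?P \<inter> ?Q = {}" using cells_subset[of True "int (p + d)" bs] by auto
    then show ?thesis
      using vandermonde_set_union[of ?P ?Q] prod.swap[of "\<lambda>e w. real_of_int \<bar>w - e\<bar>" ?Q ?P] by simp
  qed
  also have "(\<Prod>w\<in>?Q. \<Prod>e\<in>?P. real_of_int \<bar>w - e\<bar>) = (\<Prod>w\<in>?Q. fact (nat w) / fact (nat (w - int p)))"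
  proof (rule prod.cong[OF refl])
    fix w assume "w \<in> ?Q"
    then have w: "w \<ge> int p" using cells_subset[of True "int (p + d)" bs] by auto
    have "(\<Prod>e\<in>?P. real_of_int \<bar>w - e\<bar>) = (\<Prod>i\<in>{nat w - p<..nat w}. real i)"
      using w by (intro prod.reindex_bij_witness[of _ "\<lambda>i. w - int i" "\<lambda>e. nat (w - e)"]) auto
    also have "\<dots> = fact (nat w) / fact (nat w - p)"
    proof -
      have "{1..nat w} = {1..nat w - p} \<union> {nat w - p<..nat w}" using w by auto
      then have "(fact (nat w) :: real) = fact (nat w - p) * (\<Prod>i\<in>{nat w - p<..nat w}. real i)"
        unfolding fact_prod by (simp, subst prod.union_disjoint) auto
      then show ?thesis by simp
    qed
    also have "nat w - p = nat (w - int p)" using w by auto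
    finally show "(\<Prod>e\<in>?P. real_of_int \<bar>w - e\<bar>) = fact (nat w) / fact (nat (w - int p))" .
  qed
  also have "\<dots> = (\<Prod>w\<in>?Q. fact (nat w)) / (\<Prod>w\<in>?Q. fact (nat (w - int p)))"
    by (rule prod_dividef)
  also have "(\<Prod>w\<in>?Q. fact (nat (w - int p)) :: real) = (\<Prod>w\<in>cells True (int d) bs. fact (nat w))"
    using cells_shift[of True "int p" "int d" bs] by (simp add: prod.reindex)
  finally show ?case
    using 3(1)[OF len] len vandermonde_set_interval[of 0 p] unfolding prod_fact_cells
    by (simp add: field_simps)
qed simp

lemma alternating_hyperfact_prod:
  "alternating_hyperfact c bs = (\<Prod>j<length bs. if even j then hyperfact (c + (\<Sum>t\<le>j. bs ! t)) else inverse (hyperfact (c + (\<Sum>t\<le>j. bs ! t))))"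
proof (induction bs arbitrary: c)
  case (Cons b bs)
  show ?case
    by (simp add: prod.lessThan_Suc_shift sum.atMost_Suc_shift Cons.IH add.assoc divide_inverse prod_inversef [symmetric]
        if_distrib[of inverse] del: sum.atMost_Suc prod.lessThan_Suc cong: if_cong) (auto intro!: prod.cong)
qed simp

lemma interval_hyperfact_prod:
  "interval_hyperfact bs = (\<Prod>i<length bs. \<Prod>j\<in>{i..<length bs}.
     if even (j - i) then hyperfact (\<Sum>t = i..j. bs ! t) else inverse (hyperfact (\<Sum>t = i..j. bs ! t)))"
proof (induction bs)
  case (Cons b bs)
  have f1: "(\<Prod>j\<in>{0..<Suc (length bs)}.
     if even (j - 0) then hyperfact (\<Sum>t = 0..j. (b # bs) ! t) else inverse (hyperfact (\<Sum>t = 0..j. (b # bs) ! t)))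
     = alternating_hyperfact 0 (b # bs)"
    unfolding alternating_hyperfact_prod atLeast0LessThan atLeast0AtMost by (simp cong: if_cong)
  have f2: "(\<Prod>j\<in>{Suc i..<Suc (length bs)}.
     if even (j - Suc i) then hyperfact (\<Sum>t = Suc i..j. (b # bs) ! t) else inverse (hyperfact (\<Sum>t = Suc i..j. (b # bs) ! t)))
     = (\<Prod>j\<in>{i..<length bs}.
     if even (j - i) then hyperfact (\<Sum>t = i..j. bs ! t) else inverse (hyperfact (\<Sum>t = i..j. bs ! t)))" for i
    unfolding prod.shift_bounds_Suc_ivl sum.shift_bounds_cl_Suc_ivl by (simp cong: if_cong)
  show ?case
    unfolding interval_hyperfact.simps list.size add_Suc_right add_0_right prod.lessThan_Suc_shift f1 f2 Cons.IH ..
qed simp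

lemma s_odd_interval_hyperfact:
  "s_odd bs = interval_hyperfact bs / hyperfact (\<Sum>i | i < length bs \<and> even i. bs ! i)"
proof -
  let ?n = "length bs"
  let ?g = "\<lambda>p. hyperfact (\<Sum>t = fst p..snd p. bs ! t)"
  let ?S = "SIGMA i:{..<?n}. {i..<?n}"
  have fin: "finite ?S" by auto
  have "interval_hyperfact bs = (\<Prod>p\<in>?S. if even (snd p - fst p) then ?g p else inverse (?g p))"
    unfolding interval_hyperfact_prod by (subst prod.Sigma) (auto intro!: prod.cong)
  also have "\<dots> = (\<Prod>p\<in>?S \<inter> {p. even (snd p - fst p)}. ?g p) * (\<Prod>p\<in>?S \<inter> - {p. even (snd p - fst p)}. inverse (?g p))"
    by (rule prod.If_cases[OF fin])
  also have "?S \<inter> {p. even (snd p - fst p)} = {(i, j). i \<le> j \<and> j < ?n \<and> odd (j - i + 1)}" by auto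
  also have "?S \<inter> - {p. even (snd p - fst p)} = {(i, j). i \<le> j \<and> j < ?n \<and> even (j - i + 1)}" by auto
  finally have eq: "interval_hyperfact bs = (\<Prod>p\<in>{(i, j). i \<le> j \<and> j < ?n \<and> odd (j - i + 1)}. ?g p)
      * inverse (\<Prod>p\<in>{(i, j). i \<le> j \<and> j < ?n \<and> even (j - i + 1)}. ?g p)"
    by (simp only: prod_inversef [symmetric] comp_def)
  have g: "(\<lambda>(i, j). hyperfact (\<Sum>t = i..j. bs ! t)) = ?g" by auto
  show ?thesis
    unfolding s_odd_def g eq by (simp only: divide_inverse mult_1_left)
qed

lemma card_cells:
  "card (cells True c bs) = (\<Sum>i | i < length bs \<and> even i. bs ! i)"
  "card (cells False c bs) = (\<Sum>i | i < length bs \<and> odd i. bs ! i)"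
proof -
  have set_shift: "{i. i < Suc n \<and> P i} = (if P 0 then {0} else {}) \<union> Suc ` {i. i < n \<and> P (Suc i)}" for n and P :: "nat \<Rightarrow> bool"
    by (auto simp: image_iff less_Suc_eq_0_disj)
  have sum_shift: "(\<Sum>i | i < Suc n \<and> P i. f i) = (if P 0 then f 0 else 0) + (\<Sum>i | i < n \<and> P (Suc i). f (Suc i))" for n P and f :: "nat \<Rightarrow> nat"
    unfolding set_shift by (subst sum.union_disjoint) (auto simp: sum.reindex)
  have "card (cells True c bs) = (\<Sum>i | i < length bs \<and> even i. bs ! i) \<and>
    card (cells False c bs) = (\<Sum>i | i < length bs \<and> odd i. bs ! i)"
  proof (induction bs arbitrary: c)
    case (Cons b bs)
    have disj: "{c..<c + int b} \<inter> cells False (c + int b) bs = {}"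
      using cells_subset[of False "c + int b" bs] by auto
    show ?case using Cons.IH[of "c + int b"]
      by (simp add: sum_shift card_Un_disjoint[OF _ _ disj])
  qed simp
  then show "card (cells True c bs) = (\<Sum>i | i < length bs \<and> even i. bs ! i)"
    "card (cells False c bs) = (\<Sum>i | i < length bs \<and> odd i. bs ! i)" by auto
qed

text \<open>For \<open>c \<ge> 0\<close>, s is thus the number of tilings of a trapezoid whose dents
  are the cells below the up lobes; compare \<open>card_tilings_trapezoid_set\<close>.\<close>

lemma s_odd_cells:
  "odd (length bs) \<Longrightarrow> s_odd bs = vandermonde_set (cells True c bs) / hyperfact (card (cells True c bs))"
  by (simp add: s_odd_interval_hyperfact vandermonde_set_cells card_cells)

text \<open>
  The up-pointing lobes of both ferns, with the leftmost point of the left fern as origin. The centre is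
  the segment \<open>sum_list bs\<close>.
\<close>

definition fern_cells :: "nat list \<Rightarrow> int set" where
  "fern_cells bs = cells True 0 bs \<union> (\<lambda>t. 2 * int (sum_list bs) - t) ` cells False 0 bs"

lemma fern_cells_single: "fern_cells [A] = {0..<int A}"
  by (simp add: fern_cells_def)

lemma finite_fern_cells [simp]: "finite (fern_cells bs)"
  by (simp add: fern_cells_def)

lemma fern_cells_range:
  "fern_cells bs \<subseteq> {0..2 * int (sum_list bs)} - {int (sum_list bs)}"
  by (auto simp: fern_cells_def dest!: cells_bounds)

text \<open>Of \<open>t\<close> and its mirror image exactly one is a cell, since a down lobe of the
  left fern becomes an up lobe after the half-turn. Hence a product of a symmetric function over the
  cells depends on the total width only.\<close>

lemma prod_fern_cells:
  fixes f :: "int \<Rightarrow> real"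
  assumes "\<And>t. f (2 * int (sum_list bs) - t) = f t"
  shows "(\<Prod>t\<in>fern_cells bs. f t) = (\<Prod>t\<in>{0..<int (sum_list bs)}. f t)"
proof -
  let ?r = "\<lambda>t. 2 * int (sum_list bs) - t"
  have "cells True 0 bs \<inter> ?r ` cells False 0 bs = {}"
    by (auto dest!: cells_bounds)
  then have "(\<Prod>t\<in>fern_cells bs. f t) = (\<Prod>t\<in>cells True 0 bs. f t) * (\<Prod>t\<in>?r ` cells False 0 bs. f t)"
    unfolding fern_cells_def by (intro prod.union_disjoint) auto
  also have "(\<Prod>t\<in>?r ` cells False 0 bs. f t) = (\<Prod>t\<in>cells False 0 bs. f t)"
    by (subst prod.reindex) (auto simp: inj_on_def assms)
  also have "(\<Prod>t\<in>cells True 0 bs. f t) * (\<Prod>t\<in>cells False 0 bs. f t) = (\<Prod>t\<in>cells True 0 bs \<union> cells False 0 bs. f t)"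
    using cells_partition(2)[of True 0 bs] by (intro prod.union_disjoint[symmetric]) auto
  finally show ?thesis using cells_partition(1)[of True 0 bs] by simp
qed

lemma card_fern_cells: "card (fern_cells bs) = sum_list bs"
  \<comment> \<open>For the constant 2 the two products are powers of 2, whose exponents are the
    cardinalities.\<close>
  using prod_fern_cells[of "\<lambda>_. 2" bs] by simp

text \<open>The up lobes of the rotated fern, which is the reversed list starting just after the
  central segment.\<close>

lemma reflect_cells:
  "(\<lambda>t. 2 * int (sum_list bs) - t) ` cells False 0 bs = cells (even (length bs)) (int (sum_list bs) + 1) (rev bs)"
proof -
  let ?A = "int (sum_list bs)"
  have "cells (even (length bs)) (?A + 1) (rev bs) = (\<lambda>t. 2 * (?A + 1) + ?A - 1 - t) ` cells False (?A + 1) bs"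
    using cells_rev[of bs False "?A + 1"] by (simp split: if_splits)
  also have "\<dots> = (\<lambda>t. 2 * ?A - t) ` cells False 0 bs"
    using cells_shift[of False "?A + 1" 0 bs] by (simp add: image_image algebra_simps)
  finally show ?thesis ..
qed

section \<open>The right-hand side of the theorem in terms of fern cells\<close>

lemma lobe_ext_list:
  assumes "k \<ge> 1"
  shows "map (lobe_ext k a) [1..<2 * k + 1]
    = (if odd k then map a [1..<k] @ [a k] @ [a k + 1] @ rev (map a [1..<k])
       else map a [1..<k] @ [a k + 1] @ [a k] @ rev (map a [1..<k]))" (is "_ = ?R")
proof (rule nth_equalityI)
  show "length (map (lobe_ext k a) [1..<2 * k + 1]) = length ?R" using assms by auto
  fix i assume "i < length (map (lobe_ext k a) [1..<2 * k + 1])"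
  then have i: "i < 2 * k" by (simp del: upt_Suc)
  have "map (lobe_ext k a) [1..<2 * k + 1] ! i = lobe_ext k a (Suc i)" using i by (simp del: upt_Suc)
  moreover have "?R ! i = lobe_ext k a (Suc i)"
  proof -
    consider "i < k - 1" | "i = k - 1" | "i = k" | "i > k" by linarith
    then show ?thesis
    proof cases
      case 4
      have "Suc (k - Suc (Suc (i - Suc k))) = 2 * k - i" using 4 i by linarith
      then have "rev (map a [1..<k]) ! (i - Suc k) = a (2 * k - i)"
        using 4 i assms by (simp add: rev_nth nth_append)
      moreover have "i - (k - 1) - 2 = i - Suc k" using 4 assms by linarith
      moreover have "i - (k - 1) = Suc (Suc (i - Suc k))" using 4 assms by linarith
      ultimately show ?thesis using 4 i assms
        by (auto simp: lobe_ext_def nth_append)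
    qed (use assms in \<open>auto simp: lobe_ext_def nth_append\<close>)
  qed
  ultimately show "map (lobe_ext k a) [1..<2 * k + 1] ! i = ?R ! i" by simp
qed

definition shifted_facts :: "nat \<Rightarrow> int set \<Rightarrow> real" where
  "shifted_facts m X = (\<Prod>e\<in>X. fact (nat (int m + e)))"

lemma shifted_facts_pos: "shifted_facts c X > 0"
  unfolding shifted_facts_def by (auto intro!: prod_pos)

lemma alternating_hyperfact_map:
  "alternating_hyperfact c (map f [1..<2 * n + 1])
     = (\<Prod>i<n. hyperfact (c + (\<Sum>j = 1..2 * i + 1. f j)) / hyperfact (c + (\<Sum>j = 1..2 * i + 2. f j)))"
proof -
  have part: "(\<Sum>t\<le>j. map f [1..<2 * n + 1] ! t) = (\<Sum>t = 1..Suc j. f t)" if "j < 2 * n" for j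
  proof -
    have "(\<Sum>t\<le>j. map f [1..<2 * n + 1] ! t) = (\<Sum>t\<le>j. f (Suc t))"
      using that by (intro sum.cong) (auto simp del: upt_Suc)
    also have "\<dots> = (\<Sum>t = 1..Suc j. f t)"
      unfolding One_nat_def sum.shift_bounds_cl_Suc_ivl by (simp add: atMost_atLeast0)
    finally show ?thesis .
  qed
  let ?F = "\<lambda>j. if even j then hyperfact (c + (\<Sum>t = 1..Suc j. f t)) else inverse (hyperfact (c + (\<Sum>t = 1..Suc j. f t)))"
  have "alternating_hyperfact c (map f [1..<2 * n + 1]) = (\<Prod>j<2 * n. ?F j)"
    unfolding alternating_hyperfact_prod using part by (intro prod.cong) auto
  also have "\<dots> = (\<Prod>i<n. ?F (2 * i) * ?F (2 * i + 1))"
    by (induction n) (simp_all add: mult.assoc)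
  also have "\<dots> = (\<Prod>i<n. hyperfact (c + (\<Sum>j = 1..2 * i + 1. f j)) / hyperfact (c + (\<Sum>j = 1..2 * i + 2. f j)))"
    by (intro prod.cong) (auto simp: divide_inverse)
  finally show ?thesis .
qed

lemma shifted_facts_interval: "shifted_facts m {0..<int n} * hyperfact m = hyperfact (m + n)"
proof -
  have "shifted_facts m {0..<int n} = (\<Prod>e\<in>(+) (int m) ` {0..<int n}. fact (nat e))"
    unfolding shifted_facts_def by (simp add: prod.reindex del: image_add_atLeastLessThan image_add_atLeastLessThan')
  also have "(+) (int m) ` {0..<int n} = {int m..<int (m + n)}" by (simp add: add.commute)
  finally show ?thesis using prod_fact_interval[of m n] by simp
qed

context
  fixes k :: nat and a :: "nat \<Rightarrow> nat" and bs :: "nat list" and A :: nat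
  assumes k: "k \<ge> 1" and bs: "bs = map a [1..<k + 1]" and A: "A = sum_list bs"
begin

lemma bs_snoc: "bs = map a [1..<k] @ [a k]"
  using k by (simp add: bs)

lemma length_bs: "length bs = k"
  by (simp add: bs)

text \<open>The added unit always falls into an entry of even index, that is, a down lobe. It
  bridges the gap between the ferns without adding a cell.\<close>

lemma cells_lobe_ext: "cells True 0 (map (lobe_ext k a) [1..<2 * k + 1]) = fern_cells bs"
  unfolding fern_cells_def reflect_cells length_bs lobe_ext_list[OF k]
  using k by (auto simp: bs_snoc cells_append algebra_simps)

lemma cells_s_arg:
  "cells True 0 (map a [1..<k] @ [a k + 1] @ rev (map a [1..<k + 1])) = fern_cells bs \<union> (if odd k then {int A} else {})"
proof -
  have "cells True 0 (map a [1..<k] @ [a k + 1]) = cells True 0 bs \<union> (if odd k then {int A} else {})"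
    using k by (auto simp: bs_snoc cells_append A)
  moreover have "sum_list (map a [1..<k] @ [a k + 1]) = A + 1" by (simp add: A bs_snoc)
  moreover have "length (map a [1..<k] @ [a k + 1]) = k" using k by simp
  ultimately have "cells True 0 ((map a [1..<k] @ [a k + 1]) @ rev bs)
      = cells True 0 bs \<union> (if odd k then {int A} else {}) \<union> cells (even k) (int A + 1) (rev bs)"
    unfolding cells_append[of True 0 _ "rev bs"] by (simp add: add.commute)
  then show ?thesis
    unfolding fern_cells_def reflect_cells length_bs unfolding A[symmetric] bs[symmetric] by auto
qed

text \<open>For odd \<open>k\<close> the cells contain in addition the central segment. By symmetry
  its distances to the others multiply to A!, which is also the ratio of the normalising
  hyperfactorials of \<open>A + 1\<close> and \<open>A\<close>.\<close>

lemma s_fun_fern_cells: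
  "s_fun (map a [1..<k] @ [a k + 1] @ rev (map a [1..<k + 1])) = vandermonde_set (fern_cells bs) / hyperfact A"
proof -
  let ?arg = "map a [1..<k] @ [a k + 1] @ rev (map a [1..<k + 1])"
  have len: "length ?arg = 2 * k" using k by simp
  have ne: "?arg \<noteq> []" by simp
  \<comment> \<open>The entry that \<open>s_fun\<close> drops belongs to a down lobe and contributes
    no cells.\<close>
  have "cells True 0 ?arg = cells True 0 (butlast ?arg @ [last ?arg])"
    using append_butlast_last_id[OF ne] by simp
  also have "\<dots> = cells True 0 (butlast ?arg)"
    unfolding cells_append using len k by simp
  finally have cb: "cells True 0 (butlast ?arg) = cells True 0 ?arg" ..
  have "s_fun ?arg = s_odd (butlast ?arg)" using len by (simp add: s_fun_def)
  also have "\<dots> = vandermonde_set (cells True 0 ?arg) / hyperfact (card (cells True 0 ?arg))"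
    unfolding cb[symmetric] by (rule s_odd_cells) (use len k in simp)
  also have "\<dots> = vandermonde_set (fern_cells bs) / hyperfact A"
  proof (cases "odd k")
    case False
    then show ?thesis unfolding cells_s_arg by (simp add: card_fern_cells A)
  next
    case True
    have nin: "int A \<notin> fern_cells bs" using fern_cells_range[of bs] A by auto
    have "(\<Prod>e\<in>fern_cells bs. real_of_int \<bar>int A - e\<bar>) = (\<Prod>e\<in>{0..<int A}. real_of_int \<bar>int A - e\<bar>)"
      unfolding A by (rule prod_fern_cells) simp
    also have "\<dots> = (\<Prod>i\<in>{1..A}. real i)"
      by (rule prod.reindex_bij_witness[of _ "\<lambda>i. int A - int i" "\<lambda>e. nat (int A - e)"]) auto
    finally have fact: "(\<Prod>e\<in>fern_cells bs. real_of_int \<bar>int A - e\<bar>) = fact A" by (simp add: fact_prod)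
    have "{int A..<int A + int 1} = {int A}" by auto
    then have "vandermonde_set {int A} = 1" using vandermonde_set_interval[of "int A" 1] by (simp add: hyperfact_def)
    then have "vandermonde_set (fern_cells bs \<union> {int A}) = vandermonde_set (fern_cells bs) * fact A"
      using nin fact by (subst vandermonde_set_union) auto
    moreover have "card (fern_cells bs \<union> {int A}) = Suc A"
      using nin by (simp add: card_fern_cells A)
    ultimately show ?thesis unfolding cells_s_arg using True by (simp add: hyperfact_def)
  qed
  finally show ?thesis .
qed

lemma shifted_facts_fern_cells:
  "shifted_facts m (fern_cells bs) * hyperfact m
     = (\<Prod>i<k. hyperfact (m + (\<Sum>j = 1..2 * i + 1. lobe_ext k a j)))
       / (\<Prod>i\<in>{1..<k}. hyperfact (m + (\<Sum>j = 1..2 * i. lobe_ext k a j)))"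
proof -
  let ?ext = "map (lobe_ext k a) [1..<2 * k + 1]"
  let ?h = "\<lambda>n. hyperfact (m + (\<Sum>j = 1..n. lobe_ext k a j))"
  have "cells True (int m) ?ext = (+) (int m) ` fern_cells bs"
    using cells_shift[of True "int m" 0 ?ext] cells_lobe_ext by simp
  then have "shifted_facts m (fern_cells bs) = (\<Prod>e\<in>cells True (int m) ?ext. fact (nat e))"
    unfolding shifted_facts_def by (simp add: prod.reindex)
  also have "\<dots> = alternating_hyperfact m ?ext / hyperfact m * ?h (2 * k)"
    unfolding prod_fact_cells by (simp add: interv_sum_list_conv_sum_set_nat atLeastLessThanSuc_atLeastAtMost del: upt_Suc)
  also have "alternating_hyperfact m ?ext = (\<Prod>i<k. ?h (2 * i + 1)) / (\<Prod>i<k. ?h (2 * i + 2))"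
    unfolding alternating_hyperfact_map by (rule prod_dividef)
  \<comment> \<open>The factor of the full width \<open>2 * k\<close> cancels; this is why the
    second product in the theorem stops before it.\<close>
  also have "(\<Prod>i<k. ?h (2 * i + 2)) = (\<Prod>i\<in>{1..<k}. ?h (2 * i)) * ?h (2 * k)"
  proof -
    have "(\<Prod>i<k. ?h (2 * i + 2)) = (\<Prod>i\<in>{0..<k}. ?h (2 * Suc i))"
      by (simp add: atLeast0LessThan)
    also have "\<dots> = (\<Prod>i\<in>{1..<Suc k}. ?h (2 * i))"
      unfolding One_nat_def prod.shift_bounds_Suc_ivl ..
    finally show ?thesis using k by simp
  qed
  finally show ?thesis by simp
qed

text \<open>The leading quotient of hyperfactorials in the formula comes from the denominator, the
  fern with the single lobe \<open>A\<close>.\<close>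

lemma rhs_fern_cells:
  "s_fun (map a [1..<k] @ [a k + 1] @ rev (map a [1..<k + 1]))
      * (hyperfact (M + A) / hyperfact (m + A))
      * (\<Prod>i | 1 \<le> 2 * i + 1 \<and> 2 * i + 1 \<le> 2 * k.
           hyperfact (m + (\<Sum>j = 1..2 * i + 1. lobe_ext k a j)) / hyperfact (M + (\<Sum>j = 1..2 * i + 1. lobe_ext k a j)))
      * (\<Prod>i | 1 \<le> i \<and> 1 < 2 * i \<and> 2 * i < 2 * k.
           hyperfact (M + (\<Sum>j = 1..2 * i. lobe_ext k a j)) / hyperfact (m + (\<Sum>j = 1..2 * i. lobe_ext k a j)))
    = (vandermonde_set (fern_cells bs) * shifted_facts m (fern_cells bs) / shifted_facts M (fern_cells bs))
      / (vandermonde_set (fern_cells [A]) * shifted_facts m (fern_cells [A]) / shifted_facts M (fern_cells [A]))"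
proof -
  have sets: "{i. 1 \<le> 2 * i + 1 \<and> 2 * i + 1 \<le> 2 * k} = {..<k}" "{i. 1 \<le> i \<and> 1 < 2 * i \<and> 2 * i < 2 * k} = {1..<k}"
    by auto
  define po pe where "po n = (\<Prod>i<k. hyperfact (n + (\<Sum>j = 1..2 * i + 1. lobe_ext k a j)))"
    and "pe n = (\<Prod>i\<in>{1..<k}. hyperfact (n + (\<Sum>j = 1..2 * i. lobe_ext k a j)))" for n
  have pos: "po n > 0" "pe n > 0" for n unfolding po_def pe_def by (auto intro!: prod_pos)
  have P: "shifted_facts n (fern_cells bs) = po n / pe n / hyperfact n" for n
    using shifted_facts_fern_cells[of n] unfolding po_def pe_def by (simp add: field_simps)
  have P0: "shifted_facts n (fern_cells [A]) = hyperfact (n + A) / hyperfact n" for n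
    using shifted_facts_interval[of n A] unfolding fern_cells_single by (simp add: field_simps)
  have v0: "vandermonde_set (fern_cells [A]) = hyperfact A"
    unfolding fern_cells_single using vandermonde_set_interval[of 0 A] by simp
  show ?thesis
    unfolding sets prod_dividef po_def[symmetric] pe_def[symmetric] s_fun_fern_cells P P0 v0
    using pos[of m] pos[of M] by (simp add: field_simps)
qed

end

section \<open>The centre line of the region\<close>

fun vrow :: "tri \<Rightarrow> int" where
  "vrow (Up u v) = v"
| "vrow (Down u v) = v"

lemma vrow_rot: "vrow (rot C t) = snd C - 1 - vrow t"
  by (cases t) auto

lemma mem_rot_image: "t \<in> rot C ` X \<longleftrightarrow> rot C t \<in> X"
  by (metis image_iff rot_rot)

text \<open>Keeps the lobes apart, unlike \<open>cells\<close>, because their triangles are filled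
  with forced lozenges one by one.\<close>

fun lobes_from :: "bool \<Rightarrow> int \<Rightarrow> nat list \<Rightarrow> (int \<times> nat) set" where
  "lobes_from up l [] = {}"
| "lobes_from up l (b # bs) = (if up then {(l, b)} else {}) \<union> lobes_from (\<not> up) (l + int b) bs"

lemma fern_from_lobes_from:
  "fern_from up (l, v) bs
     = (\<Union>(i, b)\<in>lobes_from up l bs. up_triangle (i, v) b) \<union> (\<Union>(i, b)\<in>lobes_from (\<not> up) l bs. down_triangle (i, v) b)"
  by (induction bs arbitrary: up l) auto

lemma cells_lobes_from: "(\<Union>(i, b)\<in>lobes_from up l bs. {i..<i + int b}) = cells up l bs"
  by (induction bs arbitrary: up l) auto

lemma lobes_from_size: "(i, b) \<in> lobes_from up l bs \<Longrightarrow> b \<le> sum_list bs"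
  by (induction bs arbitrary: up l) (fastforce split: if_splits)+

lemma Up_in_hexagon [simp]:
    "Up u v \<in> hexagon p q r \<longleftrightarrow> 0 \<le> u \<and> u + 1 \<le> p + q \<and> 0 \<le> u + v \<and> u + v + 1 \<le> p + r \<and> - q \<le> v \<and> v + 1 \<le> r"
  and Down_in_hexagon [simp]:
    "Down u v \<in> hexagon p q r \<longleftrightarrow> 0 \<le> u \<and> u + 1 \<le> p + q \<and> 0 \<le> u + v + 1 \<and> u + v + 2 \<le> p + r \<and> - q \<le> v \<and> v + 1 \<le> r"
  by (auto simp: hexagon_def faces_def)

lemma rot_in_hexagon: "rot (p + q, r - q) t \<in> hexagon p q r \<longleftrightarrow> t \<in> hexagon p q r"
  by (cases t) auto

lemma finite_hexagon: "finite (hexagon p q r)"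
proof (rule finite_subset)
  show "hexagon p q r \<subseteq> (\<lambda>(u, w). Up u w) ` ({0..p + q} \<times> {- q..r}) \<union> (\<lambda>(u, w). Down u w) ` ({0..p + q} \<times> {- q..r})"
  proof
    fix t assume "t \<in> hexagon p q r"
    then show "t \<in> (\<lambda>(u, w). Up u w) ` ({0..p + q} \<times> {- q..r}) \<union> (\<lambda>(u, w). Down u w) ` ({0..p + q} \<times> {- q..r})"
      by (cases t) (auto simp: image_iff)
  qed
qed auto

lemma prod_run:
  "(\<Prod>w\<in>{int s + 1..<int s + 1 + int v}. real_of_int w) = fact (s + v) / fact s"
proof (induction v)
  case (Suc v)
  have eq: "{int s + 1..<int s + 1 + int (Suc v)} = insert (int s + 1 + int v) {int s + 1..<int s + 1 + int v}" by auto
  have "(\<Prod>w\<in>{int s + 1..<int s + 1 + int (Suc v)}. real_of_int w) = real_of_int (int s + 1 + int v) * (fact (s + v) / fact s)"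
    unfolding eq Suc.IH[symmetric] by (rule prod.insert) auto
  then show ?case by (simp add: add_ac)
qed simp

lemma fern_cells_reflect:
  "t \<in> fern_cells bs \<or> 2 * int (sum_list bs) - t \<in> fern_cells bs \<longleftrightarrow> t \<in> {0..2 * int (sum_list bs)} - {int (sum_list bs)}"
proof -
  let ?A = "int (sum_list bs)"
  have part: "s \<in> cells True 0 bs \<or> s \<in> cells False 0 bs" if "0 \<le> s" "s < ?A" for s
    using cells_partition(1)[of True 0 bs] that by auto
  have mem: "s \<in> fern_cells bs \<longleftrightarrow> s \<in> cells True 0 bs \<or> 2 * ?A - s \<in> cells False 0 bs" for s
  proof -
    have "s \<in> (\<lambda>t. 2 * ?A - t) ` cells False 0 bs \<longleftrightarrow> 2 * ?A - s \<in> cells False 0 bs"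
      by (auto intro: image_eqI[of _ _ "2 * ?A - s"])
    then show ?thesis unfolding fern_cells_def by blast
  qed
  show ?thesis
  proof
    assume "t \<in> fern_cells bs \<or> 2 * ?A - t \<in> fern_cells bs"
    then show "t \<in> {0..2 * ?A} - {?A}" using fern_cells_range[of bs] by auto
  next
    assume t: "t \<in> {0..2 * ?A} - {?A}"
    then consider "0 \<le> t" "t < ?A" | "0 \<le> 2 * ?A - t" "2 * ?A - t < ?A" by force
    then show "t \<in> fern_cells bs \<or> 2 * ?A - t \<in> fern_cells bs"
      using part[of t] part[of "2 * ?A - t"] unfolding mem by cases auto
  qed
qed

text \<open>
  Segments of the centre line are numbered as in the hexagon: \<open>v0\<close> is the level of the line and \<open>P\<close> the
  central segment. The upper half is completed to a trapezoid of base \<open>n\<close> and height \<open>h\<close>.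
\<close>

locale centre_line =
  fixes x y z :: int and A :: nat and m M :: nat and v0 P n :: int and h :: nat
  assumes x: "x \<ge> -1" and y: "y \<ge> 0" and z: "z \<ge> 0"
    and xy: "x + y = 2 * int m" and xz: "x + z = 2 * int M" and yz: "z - y = 2 * v0"
    and P: "P = int m + int A" and n: "n = x + z + 2 * int A + 1 - v0" and h: "int h = z + int A - v0"
begin

text \<open>The trapezoid prolongs the two upper slanted sides of the hexagon down to the line. If
  \<open>v0 < 0\<close> the western corner, and if \<open>v0 > 0\<close> the eastern one, lies above
  the line; the run is the base of the triangle added there.\<close>

definition extra :: "int set" where
  "extra = {0..<- v0} \<union> {2 * P + 1..<2 * P + 1 + v0}"

definition dents :: "nat list \<Rightarrow> int set" where
  "dents bs = (+) (P - int A) ` fern_cells bs"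

text \<open>The segments that a lozenge may cross. A segment between the ferns' outer ends, other
  than \<open>P\<close>, is blocked by a lobe on one of its two sides; \<open>free_iff\<close> shows
  that this description without lobes fits every fern.\<close>

definition free :: "int set" where
  "free = {u. Up u v0 \<in> hexagon (x + int A + 1) (y + int A) (z + int A)
       \<and> Down u (v0 - 1) \<in> hexagon (x + int A + 1) (y + int A) (z + int A)} - ({P - int A..P + int A} - {P})"

text \<open>The cardinality is what remains of the \<open>h\<close> dents after \<open>A\<close>
  cells below up lobes and a run of length \<open>\<bar>v0\<bar>\<close>.\<close>

definition sym_sets :: "int set set" where
  "sym_sets = {S. S \<subseteq> free \<and> (\<lambda>u. 2 * P - u) ` S = S \<and> int (card S) = z - v0 - \<bar>v0\<bar>}"

text \<open>The contribution of \<open>S\<close> that is the same for all ferns; the distances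
  between \<open>S\<close> and the cells are written for the single lobe.\<close>

definition common_factor :: "int set \<Rightarrow> real" where
  "common_factor S = vandermonde_set (S \<union> extra) * (\<Prod>e\<in>{0..<int A}. \<Prod>s\<in>S. real_of_int \<bar>s - (P - int A + e)\<bar>)"

definition refl_factor :: "nat \<Rightarrow> real" where
  "refl_factor c = (\<Prod>e\<in>{0..<int A}. fact (nat (int c + e)) * fact (nat (int c + (2 * int A - e))))"

lemma free_facts:
  assumes "u \<in> free"
  shows "0 \<le> u" "u \<le> 2 * P" "0 \<le> u + v0" "u < n" "h \<ge> 1" "u \<notin> {P - int A..P + int A} - {P}"
  using assms P n h xy xz yz unfolding free_def by auto

lemma finite_free: "finite free"
  by (rule finite_subset[of _ "{0..2 * P}"]) (auto dest: free_facts)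

lemma M_eq: "int M = int m + v0"
  using xy xz yz by simp

text \<open>The distances to the run are consecutive integers starting at \<open>s + 1\<close>. The
  side of the run decides whether \<open>s\<close> is counted from the reflected cell or from the
  cell itself.\<close>

lemma prod_extra:
  assumes e: "0 \<le> e" "e \<le> 2 * int A"
  shows "(\<Prod>w\<in>extra. real_of_int \<bar>w - (P - int A + e)\<bar>)
    = (if v0 \<ge> 0 then fact (nat (int M + (2 * int A - e))) / fact (nat (int m + (2 * int A - e)))
       else fact (nat (int m + e)) / fact (nat (int M + e)))"
proof (cases "v0 \<ge> 0")
  case True
  define s where "s = nat (int m + (2 * int A - e))"
  have s: "int s = int m + (2 * int A - e)" using e by (simp add: s_def)
  have "(\<Prod>w\<in>extra. real_of_int \<bar>w - (P - int A + e)\<bar>)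
      = (\<Prod>w\<in>{int s + 1..<int s + 1 + int (nat v0)}. real_of_int w)"
    by (rule prod.reindex_bij_witness[of _ "\<lambda>w. w + (P - int A + e)" "\<lambda>w. w - (P - int A + e)"])
      (use True s P e in \<open>unfold extra_def, auto\<close>)
  also have "\<dots> = fact (s + nat v0) / fact s" by (rule prod_run)
  also have "s + nat v0 = nat (int M + (2 * int A - e))" using True s M_eq e by simp
  finally show ?thesis using True by (simp add: s_def)
next
  case False
  define s where "s = nat (int M + e)"
  have s: "int s = int M + e" using e by (simp add: s_def)
  have "(\<Prod>w\<in>extra. real_of_int \<bar>w - (P - int A + e)\<bar>)
      = (\<Prod>w\<in>{int s + 1..<int s + 1 + int (nat (- v0))}. real_of_int w)"
    by (rule prod.reindex_bij_witness[of _ "\<lambda>w. (P - int A + e) - w" "\<lambda>w. (P - int A + e) - w"])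
      (use False s P e M_eq in \<open>unfold extra_def, auto\<close>)
  also have "\<dots> = fact (s + nat (- v0)) / fact s" by (rule prod_run)
  also have "s + nat (- v0) = nat (int m + e)" using False s M_eq e by simp
  finally show ?thesis using False by (simp add: s_def)
qed

lemma refl_factor_pos: "refl_factor c > 0"
  unfolding refl_factor_def by (auto intro!: prod_pos)

text \<open>\<open>refl_factor\<close> pairs each cell with its mirror image and so is common to all
  ferns. For \<open>v0 \<ge> 0\<close> it trades the factorials of the reflected cells for inverse
  factorials of the cells, and both signs of \<open>v0\<close> give the same quotient.\<close>

lemma prod_extra_fern:
  assumes bs: "sum_list bs = A"
  shows "(\<Prod>e\<in>fern_cells bs. \<Prod>w\<in>extra. real_of_int \<bar>w - (P - int A + e)\<bar>)
    = (if v0 \<ge> 0 then refl_factor M / refl_factor m else 1) * (shifted_facts m (fern_cells bs) / shifted_facts M (fern_cells bs))"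
proof -
  have e: "0 \<le> e \<and> e \<le> 2 * int A" if "e \<in> fern_cells bs" for e
    using fern_cells_range[of bs] that bs by auto
  have R: "refl_factor c = shifted_facts c (fern_cells bs) * (\<Prod>e\<in>fern_cells bs. fact (nat (int c + (2 * int A - e))))" for c
  proof -
    have "refl_factor c = (\<Prod>e\<in>fern_cells bs. fact (nat (int c + e)) * fact (nat (int c + (2 * int A - e))))"
      unfolding refl_factor_def unfolding bs[symmetric] by (rule prod_fern_cells[symmetric]) (simp add: mult.commute)
    then show ?thesis by (simp add: prod.distrib shifted_facts_def)
  qed
  show ?thesis
  proof (cases "v0 \<ge> 0")
    case True
    have "(\<Prod>e\<in>fern_cells bs. \<Prod>w\<in>extra. real_of_int \<bar>w - (P - int A + e)\<bar>)
        = (\<Prod>e\<in>fern_cells bs. fact (nat (int M + (2 * int A - e))) / fact (nat (int m + (2 * int A - e))))"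
      by (rule prod.cong) (use prod_extra e True in auto)
    also have "\<dots> = (\<Prod>e\<in>fern_cells bs. fact (nat (int M + (2 * int A - e))))
        / (\<Prod>e\<in>fern_cells bs. fact (nat (int m + (2 * int A - e))))" by (rule prod_dividef)
    finally show ?thesis
      using True R[of M] R[of m] shifted_facts_pos[of m "fern_cells bs"] shifted_facts_pos[of M "fern_cells bs"] by (simp add: field_simps)
  next
    case False
    have "(\<Prod>e\<in>fern_cells bs. \<Prod>w\<in>extra. real_of_int \<bar>w - (P - int A + e)\<bar>)
        = (\<Prod>e\<in>fern_cells bs. fact (nat (int m + e)) / fact (nat (int M + e)))"
      by (rule prod.cong) (use prod_extra e False in auto)
    also have "\<dots> = shifted_facts m (fern_cells bs) / shifted_facts M (fern_cells bs)"
      unfolding shifted_facts_def by (rule prod_dividef)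
    finally show ?thesis using False by simp
  qed
qed

lemma dents_range: "sum_list bs = A \<Longrightarrow> dents bs \<subseteq> {P - int A..P + int A} - {P}"
  using fern_cells_range[of bs] by (auto simp: dents_def)

lemma dents_reflect:
  assumes "sum_list bs = A"
  shows "u \<in> dents bs \<or> 2 * P - u \<in> dents bs \<longleftrightarrow> u \<in> {P - int A..P + int A} - {P}"
proof -
  have mem: "w \<in> dents bs \<longleftrightarrow> w - (P - int A) \<in> fern_cells bs" for w
    unfolding dents_def by (auto intro: image_eqI[of _ _ "w - (P - int A)"])
  have e: "2 * P - u - (P - int A) = 2 * int A - (u - (P - int A))" by simp
  have "u \<in> dents bs \<or> 2 * P - u \<in> dents bs \<longleftrightarrow> u - (P - int A) \<in> {0..2 * int A} - {int A}"
    unfolding mem e using fern_cells_reflect[of "u - (P - int A)" bs] unfolding assms .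
  then show ?thesis by auto
qed

lemma dents_disjoint:
  assumes bs: "sum_list bs = A" and S: "S \<subseteq> free"
  shows "dents bs \<inter> (S \<union> extra) = {}"
proof (rule Int_emptyI)
  fix u assume u: "u \<in> dents bs" "u \<in> S \<union> extra"
  then have "u \<in> {P - int A..P + int A} - {P}" using dents_range[OF bs] by auto
  moreover from this have "u \<notin> S" using S free_facts(6)[of u] by auto
  ultimately show False using u(2) P M_eq unfolding extra_def by auto
qed

lemma free_extra_disjoint:
  assumes "S \<subseteq> free" shows "S \<inter> extra = {}"
proof (rule Int_emptyI)
  fix u assume u: "u \<in> S" "u \<in> extra"
  then show False using free_facts(2,3)[of u] assms unfolding extra_def by auto
qed

text \<open>As \<open>S\<close> is symmetric, the product of its distances to a segment is unchanged
  when the segment is reflected, so \<open>prod_fern_cells\<close> replaces the fern by a single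
  lobe. Only the distances among the cells and to the run still see the fern.\<close>

lemma vandermonde_set_dents:
  assumes bs: "sum_list bs = A" and S: "S \<subseteq> free" "(\<lambda>u. 2 * P - u) ` S = S"
  shows "vandermonde_set (dents bs \<union> (S \<union> extra))
    = vandermonde_set (fern_cells bs) * shifted_facts m (fern_cells bs) / shifted_facts M (fern_cells bs)
      * ((if v0 \<ge> 0 then refl_factor M / refl_factor m else 1) * common_factor S)"
proof -
  let ?g = "P - int A"
  have finS: "finite S" using S(1) finite_free finite_subset by blast
  have fe: "finite extra" by (simp add: extra_def)
  have dE: "dents bs \<inter> (S \<union> extra) = {}" and dS: "S \<inter> extra = {}"
    using dents_disjoint[OF bs S(1)] free_extra_disjoint[OF S(1)] by auto
  have "(\<Prod>e\<in>dents bs. \<Prod>w\<in>S \<union> extra. real_of_int \<bar>w - e\<bar>)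
      = (\<Prod>e\<in>fern_cells bs. (\<Prod>w\<in>S. real_of_int \<bar>w - (?g + e)\<bar>) * (\<Prod>w\<in>extra. real_of_int \<bar>w - (?g + e)\<bar>))"
    unfolding dents_def using finS fe dS by (simp add: prod.reindex prod.union_disjoint)
  also have "\<dots> = (\<Prod>e\<in>fern_cells bs. \<Prod>w\<in>S. real_of_int \<bar>w - (?g + e)\<bar>)
      * (\<Prod>e\<in>fern_cells bs. \<Prod>w\<in>extra. real_of_int \<bar>w - (?g + e)\<bar>)" by (rule prod.distrib)
  also have "(\<Prod>e\<in>fern_cells bs. \<Prod>w\<in>S. real_of_int \<bar>w - (?g + e)\<bar>) = (\<Prod>e\<in>{0..<int A}. \<Prod>w\<in>S. real_of_int \<bar>w - (?g + e)\<bar>)"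
    unfolding bs[symmetric]
  proof (rule prod_fern_cells)
    fix t
    have "(\<Prod>w\<in>S. real_of_int \<bar>w - (P - int (sum_list bs) + t)\<bar>)
        = (\<Prod>w\<in>(\<lambda>u. 2 * P - u) ` S. real_of_int \<bar>w - (P - int (sum_list bs) + t)\<bar>)"
      using S(2) by simp
    also have "\<dots> = (\<Prod>w\<in>S. real_of_int \<bar>2 * P - w - (P - int (sum_list bs) + t)\<bar>)"
      by (subst prod.reindex) (auto simp: inj_on_def)
    also have "\<dots> = (\<Prod>w\<in>S. real_of_int \<bar>w - (P - int (sum_list bs) + (2 * int (sum_list bs) - t))\<bar>)"
    proof (rule prod.cong[OF refl])
      fix w
      have "2 * P - w - (P - int (sum_list bs) + t) = - (w - (P - int (sum_list bs) + (2 * int (sum_list bs) - t)))" by simp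
      then show "real_of_int \<bar>2 * P - w - (P - int (sum_list bs) + t)\<bar> = real_of_int \<bar>w - (P - int (sum_list bs) + (2 * int (sum_list bs) - t))\<bar>"
        by (metis abs_minus_cancel)
    qed
    finally show "(\<Prod>w\<in>S. real_of_int \<bar>w - (P - int (sum_list bs) + (2 * int (sum_list bs) - t))\<bar>)
        = (\<Prod>w\<in>S. real_of_int \<bar>w - (P - int (sum_list bs) + t)\<bar>)" ..
  qed
  finally have cross: "(\<Prod>e\<in>dents bs. \<Prod>w\<in>S \<union> extra. real_of_int \<bar>w - e\<bar>)
      = (\<Prod>e\<in>{0..<int A}. \<Prod>w\<in>S. real_of_int \<bar>w - (?g + e)\<bar>)
        * ((if v0 \<ge> 0 then refl_factor M / refl_factor m else 1) * (shifted_facts m (fern_cells bs) / shifted_facts M (fern_cells bs)))"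
    unfolding prod_extra_fern[OF bs] .
  have "vandermonde_set (dents bs) = vandermonde_set (fern_cells bs)" unfolding dents_def by (rule vandermonde_set_shift)
  moreover have "finite (dents bs)" by (simp add: dents_def)
  ultimately show ?thesis
    using vandermonde_set_union[of "dents bs" "S \<union> extra"] finS fe dE cross unfolding common_factor_def by (simp add: mult_ac)
qed

lemma common_factor_pos:
  assumes "S \<subseteq> free" shows "common_factor S > 0"
proof -
  have "0 < real_of_int \<bar>s - (P - int A + e)\<bar>" if "s \<in> S" "e \<in> {0..<int A}" for s e
    using free_facts(6)[of s] assms that by auto
  then show ?thesis unfolding common_factor_def by (intro mult_pos_pos vandermonde_set_pos prod_pos)
qed

lemma finite_sym_sets: "finite sym_sets"
  by (rule finite_subset[of _ "Pow free"]) (auto simp: sym_sets_def finite_free)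

text \<open>Needed for the common sum to be positive, so that it cancels in the quotient.\<close>

lemma sym_sets_nonempty: "sym_sets \<noteq> {}"
proof -
  \<comment> \<open>This number is the minimum of \<open>y\<close> and \<open>z\<close>.\<close>
  define \<mu> where "\<mu> = z - v0 - \<bar>v0\<bar>"
  have \<mu>: "\<mu> \<ge> 0" "\<mu> \<le> y" "\<mu> \<le> z" "even \<mu> \<longleftrightarrow> even y" using y z yz unfolding \<mu>_def by presburger+
  define j where "j = \<mu> div 2"
  have j: "j \<ge> 0" "j \<le> int m" "j \<le> int M" using \<mu> x xy xz unfolding j_def by presburger+
  \<comment> \<open>Two blocks of equal size just outside the ferns, and the central segment for odd
    size. For \<open>x = -1\<close> parity makes \<open>y\<close> and \<open>z\<close> odd, and the
    rounding in \<open>j\<close> makes the blocks fit.\<close>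
  define S where "S = {P - int A - j..<P - int A} \<union> {P + int A + 1..<P + int A + 1 + j} \<union> (if odd \<mu> then {P} else {})"
  have card: "int (card S) = \<mu>"
  proof -
    have "card ({P - int A - j..<P - int A} \<union> {P + int A + 1..<P + int A + 1 + j}) = nat j + nat j"
      by (subst card_Un_disjoint) auto
    moreover have "P \<notin> {P - int A - j..<P - int A} \<union> {P + int A + 1..<P + int A + 1 + j}" by auto
    moreover have "\<mu> = 2 * j + (if odd \<mu> then 1 else 0)" unfolding j_def by presburger
    ultimately show ?thesis unfolding S_def using j(1) by (auto split: if_splits)
  qed
  have "(\<lambda>u. 2 * P - u) ` S = S"
  proof -
    have sub: "2 * P - u \<in> S" if "u \<in> S" for u using that unfolding S_def by (auto split: if_splits)
    show ?thesis
    proof (intro equalityI subsetI)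
      fix u assume "u \<in> S"
      then show "u \<in> (\<lambda>u. 2 * P - u) ` S" using sub by (intro image_eqI[of _ _ "2 * P - u"]) auto
    qed (use sub in auto)
  qed
  moreover have "S \<subseteq> free"
  proof
    fix u assume u: "u \<in> S"
    have "\<mu> \<ge> 1"
    proof (rule ccontr)
      assume "\<not> \<mu> \<ge> 1"
      then have "\<mu> = 0" using \<mu> by simp
      then show False using u by (simp add: S_def j_def)
    qed
    moreover have "P - int A - j \<le> u" "u \<le> P + int A + j" "u \<notin> {P - int A..P + int A} - {P}"
      using u j unfolding S_def by (auto split: if_splits)
    ultimately show "u \<in> free"
      using \<mu> j P xy xz yz unfolding free_def by (auto; linarith)
  qed
  ultimately show ?thesis using card unfolding sym_sets_def \<mu>_def by blast
qed

end

section \<open>The upper half of the region as a dented trapezoid\<close>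

lemma rot_up_triangle:
  assumes "snd C = 2 * v"
  shows "rot C ` up_triangle (i, v) b = down_triangle (fst C - i - int b, v) b"
proof (rule Set.set_eqI)
  fix t show "t \<in> rot C ` up_triangle (i, v) b \<longleftrightarrow> t \<in> down_triangle (fst C - i - int b, v) b"
    unfolding mem_rot_image using assms by (cases t) auto
qed

lemma rot_down_triangle:
  assumes "snd C = 2 * v"
  shows "rot C ` down_triangle (i, v) b = up_triangle (fst C - i - int b, v) b"
proof (rule Set.set_eqI)
  fix t show "t \<in> rot C ` down_triangle (i, v) b \<longleftrightarrow> t \<in> up_triangle (fst C - i - int b, v) b"
    unfolding mem_rot_image using assms by (cases t) auto
qed

context centre_line
begin

abbreviation "H \<equiv> hexagon (x + int A + 1) (y + int A) (z + int A)"
abbreviation "C \<equiv> (2 * P + 1, 2 * v0)"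

text \<open>The half-turn exchanges the ends of a lobe: the left end of the image of
  \<open>(i, b)\<close> is the image of \<open>i + int b\<close>.\<close>

definition up_lobes :: "nat list \<Rightarrow> (int \<times> nat) set" where
  "up_lobes bs = lobes_from True (P - int A) bs \<union> (\<lambda>(i, b). (2 * P + 1 - i - int b, b)) ` lobes_from False (P - int A) bs"

definition down_lobes :: "nat list \<Rightarrow> (int \<times> nat) set" where
  "down_lobes bs = lobes_from False (P - int A) bs \<union> (\<lambda>(i, b). (2 * P + 1 - i - int b, b)) ` lobes_from True (P - int A) bs"

lemma C_eq: "(x + int A + 1 + (y + int A), z + int A - (y + int A)) = C"
  using P xy yz by simp

lemma centre_eq:
  assumes "sum_list bs = A" shows "FC'_centre2 x y z bs = C"
  unfolding FC'_centre2_def hexagon_centre2_def Let_def assms C_eq ..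

lemma FC'_eq:
  assumes bs: "sum_list bs = A"
  shows "FC' x y z bs = H - ((\<Union>(i, b)\<in>up_lobes bs. up_triangle (i, v0) b) \<union> (\<Union>(i, b)\<in>down_lobes bs. down_triangle (i, v0) b))"
proof -
  let ?F = "fern (P - int A, v0) bs"
  have F: "?F = (\<Union>(i, b)\<in>lobes_from True (P - int A) bs. up_triangle (i, v0) b) \<union> (\<Union>(i, b)\<in>lobes_from False (P - int A) bs. down_triangle (i, v0) b)"
    unfolding fern_def fern_from_lobes_from by simp
  have "rot C ` ?F = (\<Union>(i, b)\<in>lobes_from True (P - int A) bs. rot C ` up_triangle (i, v0) b) \<union> (\<Union>(i, b)\<in>lobes_from False (P - int A) bs. rot C ` down_triangle (i, v0) b)"
    unfolding F image_Un image_UN by (simp add: case_prod_beta)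
  also have "\<dots> = (\<Union>(i, b)\<in>lobes_from True (P - int A) bs. down_triangle (2 * P + 1 - i - int b, v0) b) \<union> (\<Union>(i, b)\<in>lobes_from False (P - int A) bs. up_triangle (2 * P + 1 - i - int b, v0) b)"
    by (simp add: rot_up_triangle rot_down_triangle)
  finally have "?F \<union> rot C ` ?F = (\<Union>(i, b)\<in>up_lobes bs. up_triangle (i, v0) b) \<union> (\<Union>(i, b)\<in>down_lobes bs. down_triangle (i, v0) b)"
    unfolding F up_lobes_def down_lobes_def by auto
  moreover have "FC' x y z bs = H - (?F \<union> rot C ` ?F)"
    unfolding FC'_def Let_def centre_eq[OF bs] bs by simp
  ultimately show ?thesis by simp
qed

lemma dents_up_lobes:
  assumes bs: "sum_list bs = A"
  shows "(\<Union>(i, b)\<in>up_lobes bs. {i..<i + int b}) = dents bs"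
proof -
  have refl: "{2 * P + 1 - i - int b..<2 * P + 1 - i - int b + int b} = (\<lambda>t. 2 * P - t) ` {i..<i + int b}" for i b
  proof (intro equalityI subsetI)
    fix s assume "s \<in> {2 * P + 1 - i - int b..<2 * P + 1 - i - int b + int b}"
    then show "s \<in> (\<lambda>t. 2 * P - t) ` {i..<i + int b}" by (intro image_eqI[of _ _ "2 * P - s"]) auto
  qed auto
  have "(\<Union>(i, b)\<in>up_lobes bs. {i..<i + int b})
      = (\<Union>(i, b)\<in>lobes_from True (P - int A) bs. {i..<i + int b}) \<union> (\<Union>(i, b)\<in>lobes_from False (P - int A) bs. (\<lambda>t. 2 * P - t) ` {i..<i + int b})"
    unfolding up_lobes_def UN_Un by (simp only: UN_simps(10) case_prod_beta' fst_conv snd_conv refl)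
  also have "\<dots> = cells True (P - int A) bs \<union> (\<lambda>t. 2 * P - t) ` cells False (P - int A) bs"
    unfolding cells_lobes_from[symmetric] by (simp add: image_UN case_prod_beta)
  also have "\<dots> = dents bs"
    using cells_shift[of True "P - int A" 0 bs] cells_shift[of False "P - int A" 0 bs]
    unfolding dents_def fern_cells_def bs by (simp add: image_Un image_image algebra_simps)
  finally show ?thesis .
qed

lemma lobe_size:
  assumes "sum_list bs = A" "(i, b) \<in> up_lobes bs" shows "b \<le> A"
  using assms(2) lobes_from_size[of _ _ _ _ bs] assms(1) unfolding up_lobes_def by auto

lemma rot_FC':
  assumes bs: "sum_list bs = A"
  shows "rot C t \<in> FC' x y z bs \<longleftrightarrow> t \<in> FC' x y z bs"
proof -
  let ?F = "fern (P - int A, v0) bs"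
  have FC: "FC' x y z bs = H - (?F \<union> rot C ` ?F)"
    unfolding FC'_def Let_def centre_eq[OF bs] bs by simp
  show ?thesis
    unfolding FC Diff_iff Un_iff mem_rot_image rot_rot
    using rot_in_hexagon[of "x + int A + 1" "y + int A" "z + int A" t] unfolding C_eq by blast
qed

lemma Up_FC'_row:
  assumes bs: "sum_list bs = A"
  shows "Up u v0 \<in> FC' x y z bs \<longleftrightarrow> Up u v0 \<in> H \<and> u \<notin> dents bs"
  unfolding FC'_eq[OF bs] dents_up_lobes[OF bs, symmetric] by (auto simp: case_prod_beta)

text \<open>The face below segment \<open>u\<close> is the rotated face above
  \<open>2 * P - u\<close>. So \<open>u\<close> is free iff neither \<open>u\<close> nor its mirror
  image is a dent, and \<open>dents_reflect\<close> makes this independent of the fern.\<close>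

lemma free_iff:
  assumes bs: "sum_list bs = A"
  shows "u \<in> free \<longleftrightarrow> Up u v0 \<in> FC' x y z bs \<and> Down u (v0 - 1) \<in> FC' x y z bs"
proof -
  have rot: "rot C (Up (2 * P - u) v0) = Down u (v0 - 1)" by simp
  have "Down u (v0 - 1) \<in> FC' x y z bs \<longleftrightarrow> Up (2 * P - u) v0 \<in> FC' x y z bs"
    using rot_FC'[OF bs, of "Up (2 * P - u) v0"] unfolding rot .
  moreover have "Down u (v0 - 1) \<in> H \<longleftrightarrow> Up (2 * P - u) v0 \<in> H"
    using rot_in_hexagon[of "x + int A + 1" "y + int A" "z + int A" "Up (2 * P - u) v0"] unfolding C_eq rot .
  ultimately show ?thesis
    unfolding free_def Up_FC'_row[OF bs] using dents_reflect[OF bs, of u] by blast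
qed

abbreviation "cr u \<equiv> {Up u v0, Down u (v0 - 1)}"

text \<open>The up lobes and the corner triangle stand on runs of dents, so they are what
  \<open>card_tilings_trapezoid_triangles\<close> removes; the down lobes lie below the
  line.\<close>

lemma upper_half:
  assumes bs: "sum_list bs = A" and S: "S \<subseteq> free"
  shows "{t \<in> FC' x y z bs. v0 \<le> vrow t} - \<Union>(cr ` S)
    = trapezoid v0 n h (dents bs \<union> (S \<union> extra))
      - (\<Union>(i, b)\<in>up_lobes bs \<union> {(0, nat (- v0)), (2 * P + 1, nat v0)}. up_triangle (i, v0) b)"
    (is "?L = trapezoid v0 n h ?D - ?R")
proof (rule Set.set_eqI)
  fix t
  let ?U = "\<Union>(i, b)\<in>up_lobes bs. up_triangle (i, v0) b"
  show "t \<in> ?L \<longleftrightarrow> t \<in> trapezoid v0 n h ?D - ?R"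
  proof (cases t)
    case (Up u w)
    have hex: "v0 \<le> w \<and> Up u w \<in> H \<longleftrightarrow> (v0 \<le> w \<and> w < v0 + int h \<and> 0 \<le> u \<and> u + w < n + v0)
        \<and> Up u w \<notin> up_triangle (0, v0) (nat (- v0)) \<and> Up u w \<notin> up_triangle (2 * P + 1, v0) (nat v0)"
      using y z n h P xy xz yz by auto
    have down: "Up u w \<notin> (\<Union>(i, b)\<in>down_lobes bs. down_triangle (i, v0) b)" if "v0 \<le> w"
      using that by auto
    have dU: "Up u w \<in> ?U" if "w = v0" "u \<in> dents bs"
      using that unfolding dents_up_lobes[OF bs, symmetric] by fastforce
    have dX: "Up u w \<in> up_triangle (0, v0) (nat (- v0)) \<or> Up u w \<in> up_triangle (2 * P + 1, v0) (nat v0)"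
      if "w = v0" "u \<in> extra" using that unfolding extra_def by auto
    have L: "t \<in> ?L \<longleftrightarrow> (v0 \<le> w \<and> Up u w \<in> H) \<and> Up u w \<notin> ?U \<and> \<not> (w = v0 \<and> u \<in> S)"
      using down Up unfolding FC'_eq[OF bs] by auto
    show ?thesis
      unfolding L hex using dU dX Up by auto
  next
    case (Down u w)
    have hex: "v0 \<le> w \<and> Down u w \<in> H \<longleftrightarrow> (v0 \<le> w \<and> w < v0 + int h \<and> 0 \<le> u \<and> u + w + 1 < n + v0)
        \<and> Down u w \<notin> up_triangle (0, v0) (nat (- v0)) \<and> Down u w \<notin> up_triangle (2 * P + 1, v0) (nat v0)"
      unfolding Down_in_hexagon Down_in_up_triangle using y z n h P xy xz yz by (cases "v0 \<ge> 0"; simp; safe; linarith)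
    have down: "Down u w \<notin> (\<Union>(i, b)\<in>down_lobes bs. down_triangle (i, v0) b)" if "v0 \<le> w"
      using that by auto
    have L: "t \<in> ?L \<longleftrightarrow> (v0 \<le> w \<and> Down u w \<in> H) \<and> Down u w \<notin> ?U"
      using down Down unfolding FC'_eq[OF bs] by auto
    show ?thesis
      unfolding L hex using Down by auto
  qed
qed

lemma card_tilings_upper_half:
  assumes bs: "sum_list bs = A" and S: "S \<subseteq> free" "(\<lambda>u. 2 * P - u) ` S = S"
  shows "real (card (tilings ({t \<in> FC' x y z bs. v0 \<le> vrow t} - \<Union>(cr ` S))))
    = (if S \<in> sym_sets then vandermonde_set (dents bs \<union> (S \<union> extra)) / hyperfact h else 0)"
proof -
  let ?D = "dents bs \<union> (S \<union> extra)"
  let ?J = "up_lobes bs \<union> {(0, nat (- v0)), (2 * P + 1, nat v0)}"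
  have finS: "finite S" using S(1) finite_free finite_subset by blast
  have v0: "\<bar>v0\<bar> \<le> int h" "int A \<le> int h" using h y z yz by auto
  have D: "?D \<subseteq> {0..<n}"
  proof
    fix u assume "u \<in> ?D"
    then consider "u \<in> dents bs" | "u \<in> S" | "u \<in> extra" by auto
    then show "u \<in> {0..<n}"
    proof cases
      case 1
      then have "u \<in> {P - int A..P + int A}" using dents_range[OF bs] by auto
      then show ?thesis using P n xy xz yz by auto
    next
      case 2
      then show ?thesis using S(1) free_facts[of u] by auto
    next
      case 3
      then show ?thesis using P n x xy xz yz unfolding extra_def by auto
    qed
  qed
  have "card (tilings (trapezoid v0 n h ?D - (\<Union>(i, b)\<in>?J. up_triangle (i, v0) b))) = card (tilings (trapezoid v0 n h ?D))"
  proof (rule card_tilings_trapezoid_triangles[OF D])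
    fix l b assume "(l, b) \<in> ?J"
    then consider "(l, b) \<in> up_lobes bs" | "l = 0" "b = nat (- v0)" | "l = 2 * P + 1" "b = nat v0" by auto
    then show "{l..<l + int b} \<subseteq> ?D \<and> b \<le> h"
    proof cases
      case 1
      then have "{l..<l + int b} \<subseteq> dents bs" unfolding dents_up_lobes[OF bs, symmetric] by blast
      then show ?thesis using lobe_size[OF bs 1] v0 by auto
    next
      case 2
      then show ?thesis using v0 unfolding extra_def by auto
    next
      case 3
      then show ?thesis using v0 unfolding extra_def by auto
    qed
  qed
  then have eq: "card (tilings ({t \<in> FC' x y z bs. v0 \<le> vrow t} - \<Union>(cr ` S))) = card (tilings (trapezoid v0 n h ?D))"
    unfolding upper_half[OF bs S(1)] .
  have dE: "dents bs \<inter> (S \<union> extra) = {}" and dS: "S \<inter> extra = {}"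
    using dents_disjoint[OF bs S(1)] free_extra_disjoint[OF S(1)] by auto
  have "card extra = nat \<bar>v0\<bar>" unfolding extra_def by (cases "v0 \<ge> 0") auto
  moreover have "card (dents bs) = A" using card_fern_cells[of bs] bs unfolding dents_def by (simp add: card_image)
  moreover have "finite (dents bs)" "finite extra" by (simp_all add: dents_def extra_def)
  ultimately have "card ?D = A + (card S + nat \<bar>v0\<bar>)"
    using finS dE dS by (simp add: card_Un_disjoint)
  then have cardD: "card ?D = h \<longleftrightarrow> S \<in> sym_sets"
    using S h unfolding sym_sets_def by auto
  show ?thesis
  proof (cases "S \<in> sym_sets")
    case True
    then show ?thesis using card_tilings_trapezoid_set[OF D] cardD eq by simp
  next
    case False
    have "tilings (trapezoid v0 n h ?D) = {}"
    proof (rule tilings_trapezoid_unbalanced[OF D])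
      show "card ?D \<noteq> h" using False cardD by simp
      show "int h \<le> n" using h n x xz by simp
      show "1 \<le> h"
      proof (rule ccontr)
        \<comment> \<open>Height 0 means that \<open>A\<close>, \<open>y\<close> and
          \<open>z\<close> vanish; then only the empty \<open>S\<close> is possible, and it has the
          prescribed size.\<close>
        assume "\<not> 1 \<le> h"
        then have h0: "h = 0" by simp
        then have "S = {}" using S(1) free_facts(5) by auto
        moreover have "z - v0 - \<bar>v0\<bar> = 0" using h0 h y z yz by auto
        ultimately show False using False by (simp add: sym_sets_def)
      qed
    qed
    then show ?thesis using False eq by simp
  qed
qed

text \<open>The fern enters the first factor only; the sum depends on \<open>A\<close> but not on
  \<open>bs\<close>.\<close>

lemma M_odot_FC'_eq:
  assumes bs: "sum_list bs = A"
  shows "real (M_odot_FC' x y z bs)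
    = (vandermonde_set (fern_cells bs) * shifted_facts m (fern_cells bs) / shifted_facts M (fern_cells bs))
      * (\<Sum>S\<in>sym_sets. (if v0 \<ge> 0 then refl_factor M / refl_factor m else 1) * common_factor S / hyperfact h)"
proof -
  let ?R = "FC' x y z bs"
  let ?A = "{t \<in> ?R. v0 \<le> vrow t}" and ?B = "{t \<in> ?R. vrow t < v0}"
  have finR: "finite ?R" unfolding FC'_eq[OF bs] using finite_hexagon by auto
  interpret cut ?A ?B cr free
  proof
    show "?A \<inter> ?B = {}" by auto
    show "finite ?A" "finite ?B" using finR by auto
    show "finite free" by (rule finite_free)
    show "cr i \<inter> cr j = {}" if "i \<noteq> j" for i j using that by auto
    show "lozenge (cr i)" for i unfolding lozenge_iff by blast
    show "cr i \<subseteq> ?A \<union> ?B \<and> \<not> cr i \<subseteq> ?A \<and> \<not> cr i \<subseteq> ?B" if "i \<in> free" for i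
      using that unfolding free_iff[OF bs] by auto
    show "L \<in> cr ` free" if L: "lozenge L" "L \<subseteq> ?A \<union> ?B" "\<not> L \<subseteq> ?A" "\<not> L \<subseteq> ?B" for L
    proof -
      from L(1) obtain u w where
        "L = {Up u w, Down u w} \<or> L = {Up u w, Down (u - 1) w} \<or> L = {Up u w, Down u (w - 1)}"
        unfolding lozenge_iff by blast
      then have Lu: "L = cr u" using L(2-4) by (elim disjE) auto
      then have "u \<in> free" using L(2) unfolding free_iff[OF bs] by auto
      then show ?thesis using Lu by blast
    qed
  qed
  have AB: "?R = ?A \<union> ?B" by auto
  have rotA: "rot C ` ?A = ?B"
  proof (rule Set.set_eqI)
    fix t show "t \<in> rot C ` ?A \<longleftrightarrow> t \<in> ?B"
      unfolding mem_rot_image using rot_FC'[OF bs, of t] by (auto simp: vrow_rot)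
  qed
  have rot_cr: "rot C ` cr u = cr (2 * P - u)" for u by auto
  have \<sigma>: "(\<lambda>u. 2 * P - u) ` free \<subseteq> free"
  proof safe
    fix u assume "u \<in> free"
    then show "2 * P - u \<in> free"
      unfolding free_iff[OF bs] using rot_FC'[OF bs, of "Up u v0"] rot_FC'[OF bs, of "Down u (v0 - 1)"] by simp
  qed
  let ?\<Sigma> = "{S. S \<subseteq> free \<and> (\<lambda>u. 2 * P - u) ` S = S}"
  have fin\<Sigma>: "finite ?\<Sigma>" by (rule finite_subset[of _ "Pow free"]) (auto simp: finite_free)
  have "real (M_odot_FC' x y z bs) = real (M_odot C (?A \<union> ?B))"
    unfolding centre_eq[OF bs] AB[symmetric] ..
  also have "\<dots> = (\<Sum>S\<in>?\<Sigma>. real (card (tilings (?A - \<Union>(cr ` S)))))"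
    unfolding M_odot_cut[OF rotA rot_cr \<sigma>] by simp
  also have "\<dots> = (\<Sum>S\<in>?\<Sigma>. if S \<in> sym_sets then vandermonde_set (dents bs \<union> (S \<union> extra)) / hyperfact h else 0)"
    by (rule sum.cong[OF refl]) (use card_tilings_upper_half[OF bs] in auto)
  also have "\<dots> = (\<Sum>S\<in>{S \<in> ?\<Sigma>. S \<in> sym_sets}. vandermonde_set (dents bs \<union> (S \<union> extra)) / hyperfact h)"
    by (rule sum.inter_filter[OF fin\<Sigma>, symmetric])
  also have "{S \<in> ?\<Sigma>. S \<in> sym_sets} = sym_sets" unfolding sym_sets_def by auto
  also have "(\<Sum>S\<in>sym_sets. vandermonde_set (dents bs \<union> (S \<union> extra)) / hyperfact h)
      = (\<Sum>S\<in>sym_sets. (vandermonde_set (fern_cells bs) * shifted_facts m (fern_cells bs) / shifted_facts M (fern_cells bs))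
        * ((if v0 \<ge> 0 then refl_factor M / refl_factor m else 1) * common_factor S / hyperfact h))"
  proof (rule sum.cong[OF refl])
    fix S assume "S \<in> sym_sets"
    then have "S \<subseteq> free" "(\<lambda>u. 2 * P - u) ` S = S" by (auto simp: sym_sets_def)
    from vandermonde_set_dents[OF bs this]
    show "vandermonde_set (dents bs \<union> (S \<union> extra)) / hyperfact h
      = (vandermonde_set (fern_cells bs) * shifted_facts m (fern_cells bs) / shifted_facts M (fern_cells bs))
        * ((if v0 \<ge> 0 then refl_factor M / refl_factor m else 1) * common_factor S / hyperfact h)"
      by simp
  qed
  finally show ?thesis by (simp only: sum_distrib_left)
qed

lemma M_odot_FC'_ratio:
  assumes "sum_list bs = A" "sum_list cs = A"
  shows "real (M_odot_FC' x y z bs) / real (M_odot_FC' x y z cs)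
    = (vandermonde_set (fern_cells bs) * shifted_facts m (fern_cells bs) / shifted_facts M (fern_cells bs))
      / (vandermonde_set (fern_cells cs) * shifted_facts m (fern_cells cs) / shifted_facts M (fern_cells cs))"
proof -
  have "(\<Sum>S\<in>sym_sets. (if v0 \<ge> 0 then refl_factor M / refl_factor m else 1) * common_factor S / hyperfact h) > 0"
  proof (rule sum_pos[OF finite_sym_sets sym_sets_nonempty])
    fix S assume "S \<in> sym_sets"
    then have "common_factor S > 0" by (intro common_factor_pos) (simp add: sym_sets_def)
    then show "(if v0 \<ge> 0 then refl_factor M / refl_factor m else 1) * common_factor S / hyperfact h > 0"
      using refl_factor_pos by simp
  qed
  then show ?thesis unfolding M_odot_FC'_eq[OF assms(1)] M_odot_FC'_eq[OF assms(2)] by simp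
qed

end

theorem theorem2p2:
  fixes x y z :: int and k A :: nat and a :: "nat \<Rightarrow> nat"
  assumes "x \<ge> -1" and "y \<ge> 0" and "z \<ge> 0"
    and "even x \<longleftrightarrow> even y" and "even y \<longleftrightarrow> even z"
    and "k \<ge> 1"
    and "A = (\<Sum>i = 1..k. a i)"
  shows "real (M_odot_FC' x y z (map a [1..<k + 1])) / real (M_odot_FC' x y z [A])
    = s_fun (map a [1..<k] @ [a k + 1] @ rev (map a [1..<k + 1]))
      * (hyperfact (nat ((x + z) div 2) + A) / hyperfact (nat ((x + y) div 2) + A))
      * (\<Prod>i | 1 \<le> 2 * i + 1 \<and> 2 * i + 1 \<le> 2 * k.
           hyperfact (nat ((x + y) div 2) + (\<Sum>j = 1..2 * i + 1. lobe_ext k a j))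
           / hyperfact (nat ((x + z) div 2) + (\<Sum>j = 1..2 * i + 1. lobe_ext k a j)))
      * (\<Prod>i | 1 \<le> i \<and> 1 < 2 * i \<and> 2 * i < 2 * k.
           hyperfact (nat ((x + z) div 2) + (\<Sum>j = 1..2 * i. lobe_ext k a j))
           / hyperfact (nat ((x + y) div 2) + (\<Sum>j = 1..2 * i. lobe_ext k a j)))"
proof -
  have sum: "A = sum_list (map a [1..<k + 1])"
    using assms(7) by (simp add: interv_sum_list_conv_sum_set_nat atLeastLessThanSuc_atLeastAtMost del: upt_Suc)
  define m M where "m = nat ((x + y) div 2)" and "M = nat ((x + z) div 2)"
  \<comment> \<open>If \<open>x = -1\<close>, then \<open>y\<close> and \<open>z\<close> are odd,
    hence at least 1.\<close>
  have "x + y \<ge> 0" "x + z \<ge> 0" "even (x + y)" "even (x + z)" using assms(1-5) by presburger+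
  then have xy: "x + y = 2 * int m" and xz: "x + z = 2 * int M" unfolding m_def M_def by simp_all
  interpret centre_line x y z A m M "(z - y) div 2" "int m + int A" "x + z + 2 * int A + 1 - (z - y) div 2"
    "nat (z + int A - (z - y) div 2)"
  proof
    show "z - y = 2 * ((z - y) div 2)" using assms(4,5) by presburger
    show "int (nat (z + int A - (z - y) div 2)) = z + int A - (z - y) div 2" using assms(2,3) by auto
  qed (use assms xy xz in auto)
  show ?thesis
    using M_odot_FC'_ratio[of "map a [1..<k + 1]" "[A]"] sum
      rhs_fern_cells[OF assms(6) refl sum, of M m]
    unfolding m_def[symmetric] M_def[symmetric] by simp
qed

end
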